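(* The Markov category $\mathsf{BKer}$ has infinite tensor products of all small families of objects, given by the coproduct in $\mathsf{BAlg}$ of the underlying Boolean algebras, and their marginals are deterministic; that is, $\mathsf{BKer}$ has all small Kolmogorov products.
   Context: $\mathsf{EAlg}$ is the category of effect algebras: partial commutative monoids $(E,\oplus,0)$ with an element $1$ such that every $a$ has a unique $a^\perp$ with $a\oplus a^\perp=1$, and such that $a\oplus1$ defined implies $a=0$; morphisms preserve $1$ and all defined sums. Every Boolean algebra is an effect algebra, with $a\oplus b$ defined iff $a\wedge b=0$, and then $a\oplus b=a\vee b$; the category $\mathsf{BAlg}$ of Boolean algebras is a full subcategory of $\mathsf{EAlg}$. $\otimes$ is the tensor product of effect algebras (universal for bimorphisms, i.e. maps additive in each variable and sending $(1,1)$ to $1$), with unit $\mathbb{2}=\{\bot,\top\}$, the initial object of $\mathsf{EAlg}$; for Boolean algebras $A,B$, $A\otimes B$ is their coproduct $A+_{\mathsf{BAlg}}B$ in $\mathsf{BAlg}$. $\mathbb{I}$ is the effect algebra $[0,1]$ with $a\oplus b$ defined iff $a+b\le1$, and then equal to $a+b$. It is a monoid for $\otimes$, with multiplication $\mathbb{I}\otimes\mathbb{I}\to\mathbb{I}$ induced by multiplication of reals and unit the unique map $\mathbb{2}\to\mathbb{I}$, so $\mathbb{I}\otimes(-)$ is a monad on $\mathsf{EAlg}$. $\mathsf{BKer}$ is the opposite of the Kleisli category of the monad $\mathbb{I}\otimes(-)$ on $\mathsf{EAlg}$, restricted to the objects of $\mathsf{BAlg}$: objects are Boolean algebras, and morphisms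 $A\to B$ are maps $B\to\mathbb{I}\otimes A$ in $\mathsf{EAlg}$. The tensor on objects is $A\otimes B$; morphisms given by $f:B\to\mathbb{I}\otimes A$ and $f':B'\to\mathbb{I}\otimes A'$ are tensored as $B\otimes B'\to\mathbb{I}\otimes A\otimes\mathbb{I}\otimes A'\cong\mathbb{I}\otimes\mathbb{I}\otimes A\otimes A'\to\mathbb{I}\otimes A\otimes A'$. The monoidal unit is $\mathbb{2}$. The discard map of $A$ is the unique map $\mathbb{2}\to\mathbb{I}\otimes A$, and the copy map $A\to A\otimes A$ of $\mathsf{BKer}$ is the map $A\otimes A\cong A+_{\mathsf{BAlg}}A\to A\cong\mathbb{2}\otimes A\to\mathbb{I}\otimes A$ given by the codiagonal followed by the unit of $\mathbb{I}$. A morphism $f:A\to B$ is deterministic if $\mathsf{copy}_B\circ f=(f\otimes f)\circ\mathsf{copy}_A$. Kolmogorov products (Fritz–Rischel): given a family $(X_i)_{i\in I}$ in a Markov category, for finite $F\subseteq I$ put $X^F=\bigotimes_{i\in F}X_i$, and for finite $F\subseteq F'$ let $X^{F'}\to X^F$ be the marginalization map discarding the factors in $F'\setminus F$. An infinite tensor product of the family is an object $X^I$ with maps (marginals) $\pi_F:X^I\to X^F$ that form a limit cone over this cofiltered diagram, such that this limit is preserved by $-\otimes Y$ for every object $Y$. It is a Kolmogorov product if moreover all $\pi_F$ are deterministic. *)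

theory Defs
  imports Complex_Main "HOL-Library.Multiset" "HOL-Library.FuncSet"
begin

section \<open>Effect algebras\<close>

text \<open>The partial sum is a function into an option type; its values outside the carrier are
  irrelevant.\<close>

record 'a ea =
  ecarrier :: "'a set"
  osum :: "'a \<Rightarrow> 'a \<Rightarrow> 'a option"
  ezero :: 'a
  eone :: 'a

definition effect_algebra :: "'a ea \<Rightarrow> bool" where
  "effect_algebra E \<longleftrightarrow>
     ezero E \<in> ecarrier E \<and> eone E \<in> ecarrier E \<and>
     (\<forall>a\<in>ecarrier E. \<forall>b\<in>ecarrier E. \<forall>c. osum E a b = Some c \<longrightarrow> c \<in> ecarrier E) \<and>
     (\<forall>a\<in>ecarrier E. osum E (ezero E) a = Some a) \<and>
     (\<forall>a\<in>ecarrier E. \<forall>b\<in>ecarrier E. osum E a b = osum E b a) \<and>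
     (\<forall>a\<in>ecarrier E. \<forall>b\<in>ecarrier E. \<forall>c\<in>ecarrier E.
        Option.bind (osum E a b) (\<lambda>d. osum E d c) = Option.bind (osum E b c) (\<lambda>d. osum E a d)) \<and>
     (\<forall>a\<in>ecarrier E. \<exists>!a'. a' \<in> ecarrier E \<and> osum E a a' = Some (eone E)) \<and>
     (\<forall>a\<in>ecarrier E. osum E a (eone E) \<noteq> None \<longrightarrow> a = ezero E)"

text \<open>Morphisms are extensional functions on the carrier, so that HOL equality of functions is
  equality of morphisms.\<close>

definition ea_hom :: "'a ea \<Rightarrow> 'b ea \<Rightarrow> ('a \<Rightarrow> 'b) set" where
  "ea_hom E F = {f \<in> ecarrier E \<rightarrow>\<^sub>E ecarrier F.
     f (eone E) = eone F \<and>
     (\<forall>a\<in>ecarrier E. \<forall>b\<in>ecarrier E. \<forall>c. osum E a b = Some c \<longrightarrow> osum F (f a) (f b) = Some (f c))}"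

definition ea_id :: "'a ea \<Rightarrow> 'a \<Rightarrow> 'a" where
  "ea_id E = restrict (\<lambda>a. a) (ecarrier E)"

definition ea_comp :: "'a ea \<Rightarrow> ('b \<Rightarrow> 'c) \<Rightarrow> ('a \<Rightarrow> 'b) \<Rightarrow> 'a \<Rightarrow> 'c" where
  "ea_comp E g f = compose (ecarrier E) g f"

definition two :: "bool ea" where
  "two = \<lparr>ecarrier = UNIV,
          osum = (\<lambda>a b. if a \<and> b then None else Some (a \<or> b)),
          ezero = False, eone = True\<rparr>"

definition unit_interval :: "real ea" where
  "unit_interval = \<lparr>ecarrier = {0..1},
          osum = (\<lambda>a b. if a + b \<le> 1 then Some (a + b) else None),
          ezero = 0, eone = 1\<rparr>"


section \<open>Boolean algebras as effect algebras\<close>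

definition boolean_algebra_on ::
  "'a set \<Rightarrow> ('a \<Rightarrow> 'a \<Rightarrow> 'a) \<Rightarrow> ('a \<Rightarrow> 'a \<Rightarrow> 'a) \<Rightarrow> ('a \<Rightarrow> 'a) \<Rightarrow> 'a \<Rightarrow> 'a \<Rightarrow> bool" where
  "boolean_algebra_on A meet join compl z e \<longleftrightarrow>
     z \<in> A \<and> e \<in> A \<and>
     (\<forall>x\<in>A. compl x \<in> A \<and> meet x e = x \<and> join x z = x \<and>
            meet x (compl x) = z \<and> join x (compl x) = e) \<and>
     (\<forall>x\<in>A. \<forall>y\<in>A. meet x y \<in> A \<and> join x y \<in> A \<and> meet x y = meet y x \<and> join x y = join y x) \<and>
     (\<forall>x\<in>A. \<forall>y\<in>A. \<forall>w\<in>A.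
        meet (meet x y) w = meet x (meet y w) \<and> join (join x y) w = join x (join y w) \<and>
        meet x (join y w) = join (meet x y) (meet x w) \<and>
        join x (meet y w) = meet (join x y) (join x w))"

definition arises_from_boolean ::
  "'a ea \<Rightarrow> ('a \<Rightarrow> 'a \<Rightarrow> 'a) \<Rightarrow> ('a \<Rightarrow> 'a \<Rightarrow> 'a) \<Rightarrow> ('a \<Rightarrow> 'a) \<Rightarrow> bool" where
  "arises_from_boolean E meet join compl \<longleftrightarrow>
     boolean_algebra_on (ecarrier E) meet join compl (ezero E) (eone E) \<and>
     (\<forall>a\<in>ecarrier E. \<forall>b\<in>ecarrier E.
        osum E a b = (if meet a b = ezero E then Some (join a b) else None))"

text \<open>The objects of \<open>BAlg\<close>, seen as a full subcategory of \<open>EAlg\<close>. The morphisms of \<open>BAlg\<close> are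
  then given by \<^const>\<open>ea_hom\<close>; that these are the Boolean homomorphisms is
  \<open>ea_hom_boolean_iff\<close>.\<close>

definition boolean_ea :: "'a ea \<Rightarrow> bool" where
  "boolean_ea E \<longleftrightarrow> (\<exists>meet join compl. arises_from_boolean E meet join compl)"

lemma boolean_algebra_on_facts:
  assumes B: "boolean_algebra_on A m j c z e"
  shows "x \<in> A \<Longrightarrow> m x x = x" "x \<in> A \<Longrightarrow> j x x = x"
    and "x \<in> A \<Longrightarrow> m x z = z" "x \<in> A \<Longrightarrow> j x e = e"
    and "x \<in> A \<Longrightarrow> y \<in> A \<Longrightarrow> m x y = z \<Longrightarrow> j x y = e \<Longrightarrow> y = c x"
    and "x \<in> A \<Longrightarrow> y \<in> A \<Longrightarrow> j x y = z \<longleftrightarrow> x = z \<and> y = z"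
proof -
  note B' = B[unfolded boolean_algebra_on_def]
  have z: "z \<in> A" and e: "e \<in> A" using B' by blast+
  have c: "c x \<in> A" if "x \<in> A" for x using B' that by blast
  show mm: "m x x = x" if "x \<in> A" for x
  proof -
    have "m x x = j (m x x) (m x (c x))" using B' that by metis
    also have "\<dots> = m x (j x (c x))" using B' that c by metis
    also have "\<dots> = x" using B' that by metis
    finally show ?thesis .
  qed
  show jj: "j x x = x" if "x \<in> A" for x
  proof -
    have "j x x = m (j x x) (j x (c x))" using B' that by metis
    also have "\<dots> = j x (m x (c x))" using B' that c by metis
    also have "\<dots> = x" using B' that by metis
    finally show ?thesis .
  qed
  show mz: "m x z = z" if "x \<in> A" for x
  proof -
    have "m x z = m x (m x (c x))" using B' that by metis
    also have "\<dots> = m (m x x) (c x)" using B' that c by metis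
    finally show ?thesis using mm B' that by metis
  qed
  show je: "j x e = e" if "x \<in> A" for x
  proof -
    have "j x e = j x (j x (c x))" using B' that by metis
    also have "\<dots> = j (j x x) (c x)" using B' that c by metis
    finally show ?thesis using jj B' that by metis
  qed
  show "y = c x" if "x \<in> A" "y \<in> A" "m x y = z" "j x y = e"
  proof -
    have cx: "c x \<in> A" using c that by blast
    have "y = m y (j x (c x))" using B' that by metis
    also have "\<dots> = j (m y x) (m y (c x))" using B' that cx by blast
    also have "m y x = z" using B' that by metis
    also have "j z (m y (c x)) = m y (c x)" using B' that cx z by metis
    finally have 1: "y = m y (c x)" .
    have "c x = m (c x) (j x y)" using B' that cx by metis
    also have "\<dots> = j (m (c x) x) (m (c x) y)" using B' that cx by blast
    also have "m (c x) x = z" using B' that cx by metis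
    also have "j z (m (c x) y) = m (c x) y" using B' that cx z by metis
    finally show ?thesis using 1 B' that cx by metis
  qed
  show "j x y = z \<longleftrightarrow> x = z \<and> y = z" if "x \<in> A" "y \<in> A"
  proof
    assume h: "j x y = z"
    have "x = j x z" using B' that by metis
    also have "\<dots> = j x (j x y)" using h by simp
    also have "\<dots> = j (j x x) y" using B' that by metis
    also have "\<dots> = z" using h jj that by simp
    finally have "x = z" .
    moreover have "y = z" using h \<open>x = z\<close> B' that z by metis
    ultimately show "x = z \<and> y = z" ..
  qed (use B' z in metis)
qed

lemma arises_effect_algebra:
  assumes "arises_from_boolean E m j c"
  shows "effect_algebra E"
proof -
  let ?A = "ecarrier E" and ?z = "ezero E" and ?e = "eone E"
  have B: "boolean_algebra_on ?A m j c ?z ?e"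
    and s: "\<And>a b. a \<in> ?A \<Longrightarrow> b \<in> ?A \<Longrightarrow> osum E a b = (if m a b = ?z then Some (j a b) else None)"
    using assms unfolding arises_from_boolean_def by blast+
  note B' = B[unfolded boolean_algebra_on_def]
  note F = boolean_algebra_on_facts[OF B]
  have z: "?z \<in> ?A" and e: "?e \<in> ?A" using B' by blast+
  have cl: "\<And>a b. a \<in> ?A \<Longrightarrow> b \<in> ?A \<Longrightarrow> m a b \<in> ?A \<and> j a b \<in> ?A" using B' by blast
  have mc: "\<And>a b. a \<in> ?A \<Longrightarrow> b \<in> ?A \<Longrightarrow> m a b = m b a" using B' by blast
  have jc: "\<And>a b. a \<in> ?A \<Longrightarrow> b \<in> ?A \<Longrightarrow> j a b = j b a" using B' by blast
  have ja: "\<And>a b d. a \<in> ?A \<Longrightarrow> b \<in> ?A \<Longrightarrow> d \<in> ?A \<Longrightarrow> j (j a b) d = j a (j b d)" using B' by blast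
  have md: "\<And>a b d. a \<in> ?A \<Longrightarrow> b \<in> ?A \<Longrightarrow> d \<in> ?A \<Longrightarrow> m a (j b d) = j (m a b) (m a d)"
    using B' by blast
  have C: "\<And>a. a \<in> ?A \<Longrightarrow> c a \<in> ?A \<and> m a (c a) = ?z \<and> j a (c a) = ?e \<and> m a ?e = a \<and> j a ?z = a"
    using B' by blast
  show ?thesis
    unfolding effect_algebra_def
  proof (intro conjI ballI allI impI)
    fix a b d assume "a \<in> ?A" "b \<in> ?A" "osum E a b = Some d"
    then show "d \<in> ?A" using s cl by (auto split: if_splits)
  next
    fix a assume a: "a \<in> ?A"
    then show "osum E ?z a = Some a" using s[OF z a] F(3) mc[OF z a] jc[OF z a] C by simp
  next
    fix a b assume "a \<in> ?A" "b \<in> ?A"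
    then show "osum E a b = osum E b a" using s mc jc by simp
  next
    fix a b d assume h: "a \<in> ?A" "b \<in> ?A" "d \<in> ?A"
    have "m (j a b) d = m d (j a b)" using mc cl h by blast
    also have "\<dots> = j (m d a) (m d b)" using md h by blast
    finally have 1: "m (j a b) d = ?z \<longleftrightarrow> m d a = ?z \<and> m d b = ?z"
      using F(6) cl h by simp
    have 2: "m a (j b d) = ?z \<longleftrightarrow> m a b = ?z \<and> m a d = ?z"
      using md[OF h] F(6) cl h by simp
    show "Option.bind (osum E a b) (\<lambda>x. osum E x d) = Option.bind (osum E b d) (\<lambda>x. osum E a x)"
      using 1 2 s h cl ja mc[OF h(1,3)] mc[OF h(2,3)] by (auto split: if_splits)
  next
    fix a assume a: "a \<in> ?A"
    show "\<exists>!a'. a' \<in> ?A \<and> osum E a a' = Some ?e"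
    proof (rule ex1I[of _ "c a"])
      show "c a \<in> ?A \<and> osum E a (c a) = Some ?e" using C[OF a] s a by simp
      fix b assume b: "b \<in> ?A \<and> osum E a b = Some ?e"
      then show "b = c a" using F(5)[OF a] s[OF a] by (auto split: if_splits)
    qed
  next
    fix a assume a: "a \<in> ?A" and "osum E a ?e \<noteq> None"
    then show "a = ?z" using s[OF a e] C[OF a] by (auto split: if_splits)
  qed (use z e in auto)
qed

lemma ea_hom_boolean_iff:
  assumes E: "arises_from_boolean E m j c" and F: "arises_from_boolean F m' j' c'"
  assumes f: "f \<in> ecarrier E \<rightarrow>\<^sub>E ecarrier F"
  shows "f \<in> ea_hom E F \<longleftrightarrow>
     (\<forall>a\<in>ecarrier E. \<forall>b\<in>ecarrier E. f (m a b) = m' (f a) (f b) \<and> f (j a b) = j' (f a) (f b)) \<and>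
     (\<forall>a\<in>ecarrier E. f (c a) = c' (f a)) \<and> f (ezero E) = ezero F \<and> f (eone E) = eone F"
    (is "_ \<longleftrightarrow> ?rhs")
proof -
  let ?A = "ecarrier E" and ?z = "ezero E" and ?e = "eone E"
  let ?B = "ecarrier F" and ?z' = "ezero F" and ?e' = "eone F"
  have BE: "boolean_algebra_on ?A m j c ?z ?e"
    and s: "\<And>a b. a \<in> ?A \<Longrightarrow> b \<in> ?A \<Longrightarrow> osum E a b = (if m a b = ?z then Some (j a b) else None)"
    using E unfolding arises_from_boolean_def by blast+
  have BF: "boolean_algebra_on ?B m' j' c' ?z' ?e'"
    and s': "\<And>a b. a \<in> ?B \<Longrightarrow> b \<in> ?B \<Longrightarrow> osum F a b = (if m' a b = ?z' then Some (j' a b) else None)"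
    using F unfolding arises_from_boolean_def by blast+
  note E' = BE[unfolded boolean_algebra_on_def] and F' = BF[unfolded boolean_algebra_on_def]
  note EF = boolean_algebra_on_facts[OF BE] and FF = boolean_algebra_on_facts[OF BF]
  have fB: "f a \<in> ?B" if "a \<in> ?A" for a using f that by auto
  have z: "?z \<in> ?A" and e: "?e \<in> ?A" using E' by blast+
  have cl: "\<And>a b. a \<in> ?A \<Longrightarrow> b \<in> ?A \<Longrightarrow> m a b \<in> ?A \<and> j a b \<in> ?A" using E' by blast
  have mc: "\<And>a b. a \<in> ?A \<Longrightarrow> b \<in> ?A \<Longrightarrow> m a b = m b a" using E' by blast
  have jc: "\<And>a b. a \<in> ?A \<Longrightarrow> b \<in> ?A \<Longrightarrow> j a b = j b a" using E' by blast
  have ma: "\<And>a b d. a \<in> ?A \<Longrightarrow> b \<in> ?A \<Longrightarrow> d \<in> ?A \<Longrightarrow> m (m a b) d = m a (m b d)" using E' by blast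
  have ja: "\<And>a b d. a \<in> ?A \<Longrightarrow> b \<in> ?A \<Longrightarrow> d \<in> ?A \<Longrightarrow> j (j a b) d = j a (j b d)" using E' by blast
  have md: "\<And>a b d. a \<in> ?A \<Longrightarrow> b \<in> ?A \<Longrightarrow> d \<in> ?A \<Longrightarrow> m a (j b d) = j (m a b) (m a d)"
    using E' by blast
  have C: "\<And>a. a \<in> ?A \<Longrightarrow> c a \<in> ?A \<and> m a (c a) = ?z \<and> j a (c a) = ?e \<and> m a ?e = a \<and> j a ?z = a"
    using E' by blast
  have mcF: "\<And>a b. a \<in> ?B \<Longrightarrow> b \<in> ?B \<Longrightarrow> m' a b = m' b a" using F' by blast
  have clF: "\<And>a b. a \<in> ?B \<Longrightarrow> b \<in> ?B \<Longrightarrow> m' a b \<in> ?B \<and> j' a b \<in> ?B" using F' by blast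
  have jcF: "\<And>a b. a \<in> ?B \<Longrightarrow> b \<in> ?B \<Longrightarrow> j' a b = j' b a" using F' by blast
  have jaF: "\<And>a b d. a \<in> ?B \<Longrightarrow> b \<in> ?B \<Longrightarrow> d \<in> ?B \<Longrightarrow> j' (j' a b) d = j' a (j' b d)"
    using F' by blast
  have mdF: "\<And>a b d. a \<in> ?B \<Longrightarrow> b \<in> ?B \<Longrightarrow> d \<in> ?B \<Longrightarrow> m' a (j' b d) = j' (m' a b) (m' a d)"
    using F' by blast
  have jdF: "\<And>a b d. a \<in> ?B \<Longrightarrow> b \<in> ?B \<Longrightarrow> d \<in> ?B \<Longrightarrow> j' a (m' b d) = m' (j' a b) (j' a d)"
    using F' by blast
  have CF: "\<And>a. a \<in> ?B \<Longrightarrow> j' a ?z' = a" using F' by blast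
  have zF: "?z' \<in> ?B" using F' by blast
  show ?thesis
  proof
    assume h: "f \<in> ea_hom E F"
    have one: "f ?e = ?e'" using h unfolding ea_hom_def by blast
    have sum: "m' (f a) (f b) = ?z' \<and> f (j a b) = j' (f a) (f b)"
      if "a \<in> ?A" "b \<in> ?A" "m a b = ?z" for a b
    proof -
      have "osum F (f a) (f b) = Some (f (j a b))"
        using h s[OF that(1,2)] that unfolding ea_hom_def by auto
      then show ?thesis using s' fB that by (auto split: if_splits)
    qed
    have zero: "f ?z = ?z'" using sum[OF z z] EF(3)[OF z] FF(1) fB z by simp
    have compl: "f (c a) = c' (f a)" if "a \<in> ?A" for a
    proof -
      have a: "c a \<in> ?A" "m a (c a) = ?z" "j a (c a) = ?e" using C that by auto
      show ?thesis using FF(5)[OF fB[OF that] fB[OF a(1)]] sum[OF that a(1,2)] a(3) one by simp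
    qed
    have "f (m a b) = m' (f a) (f b) \<and> f (j a b) = j' (f a) (f b)" if a: "a \<in> ?A" and b: "b \<in> ?A" for a b
    proof -
      define p q r where "p = m a (c b)" and "q = m a b" and "r = m b (c a)"
      have ca: "c a \<in> ?A" and cb: "c b \<in> ?A" using C a b by auto
      have A: "p \<in> ?A" "q \<in> ?A" "r \<in> ?A" unfolding p_def q_def r_def using cl a b ca cb by auto
      have "m p q = m (m a (c b)) (m b a)" unfolding p_def q_def using mc a b by simp
      also have "\<dots> = m a (m (c b) (m b a))" using ma a cb cl b by simp
      also have "m (c b) (m b a) = m (m (c b) b) a" using ma a cb b by simp
      also have "m (c b) b = ?z" using C[OF b] mc[OF cb b] by simp
      finally have pq: "m p q = ?z" using EF(3) mc[OF z a] a by simp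
      have "m q r = m (m a b) (m (c a) b)" unfolding q_def r_def using mc[OF b ca] by simp
      also have "\<dots> = m (m b a) (m (c a) b)" using mc a b by simp
      also have "\<dots> = m b (m a (m (c a) b))" using ma a ca cl b by simp
      also have "m a (m (c a) b) = m (m a (c a)) b" using ma a ca b by simp
      also have "m a (c a) = ?z" using C[OF a] by simp
      finally have qr: "m q r = ?z" using EF(3) mc[OF z b] b by simp
      have "m a r = m a (m (c a) b)" unfolding r_def using mc[OF b ca] by simp
      also have "\<dots> = m (m a (c a)) b" using ma a ca b by simp
      finally have ar: "m a r = ?z" using C[OF a] EF(3) mc[OF z b] b by simp
      have "j p q = m a (j (c b) b)" unfolding p_def q_def using md a b cb by simp
      also have "j (c b) b = ?e" using jc[OF cb b] C[OF b] by simp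
      finally have a': "j p q = a" using C[OF a] by simp
      have "j q r = m b (j a (c a))" unfolding r_def q_def using md a b ca mc[OF a b] by simp
      then have b': "j q r = b" using C[OF a] C[OF b] by simp
      have qa: "j a q = a"
      proof -
        have "j a q = j (j p q) q" using a' by simp
        also have "\<dots> = j p q" using ja A EF(2) by simp
        finally show ?thesis using a' by simp
      qed
      have "j a b = j a (j q r)" using b' by simp
      also have "\<dots> = j (j a q) r" using ja a A by simp
      finally have jab: "j a b = j a r" using qa by simp
      note P = fB[OF A(1)] and Q = fB[OF A(2)] and R = fB[OF A(3)]
      have fa: "f a = j' (f p) (f q)" using sum[OF A(1,2) pq] a' by simp
      have fb: "f b = j' (f q) (f r)" using sum[OF A(2,3) qr] b' by simp
      have fab: "f (j a b) = j' (f a) (f r)" and dar: "m' (f a) (f r) = ?z'"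
        using sum[OF a A(3) ar] jab by auto
      have qa': "j' (f a) (f q) = f a" using fa jaF[OF P Q Q] FF(2)[OF Q] by simp
      have "j' (f a) (f b) = j' (j' (f a) (f q)) (f r)" using fb jaF fB a Q R by simp
      then have J: "f (j a b) = j' (f a) (f b)" using qa' fab by simp
      have "m' (f p) (f r) = ?z'"
      proof -
        have "m' (f r) (f a) = ?z'" using dar mcF R fB a by simp
        then have "j' (m' (f r) (f p)) (m' (f r) (f q)) = ?z'" using fa mdF P Q R by simp
        then have "m' (f r) (f p) = ?z'" using FF(6) clF P Q R by blast
        then show ?thesis using mcF P R by simp
      qed
      then have "j' (f q) (m' (f p) (f r)) = f q" using CF Q by simp
      then have "m' (j' (f q) (f p)) (j' (f q) (f r)) = f q" using jdF[OF Q P R] by simp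
      then have "m' (f a) (f b) = f q" using fa fb jcF[OF P Q] by simp
      then show ?thesis using J q_def by simp
    qed
    then show ?rhs using one zero compl by blast
  next
    assume h: ?rhs
    have "osum F (f a) (f b) = Some (f d)" if "a \<in> ?A" "b \<in> ?A" "osum E a b = Some d" for a b d
    proof -
      have "m a b = ?z" "d = j a b" using s that by (auto split: if_splits)
      moreover have "f (m a b) = m' (f a) (f b)" "f (j a b) = j' (f a) (f b)" using h that by blast+
      ultimately show ?thesis using s' fB that h by simp
    qed
    then show "f \<in> ea_hom E F" using h f unfolding ea_hom_def by blast
  qed
qed


section \<open>Tensor products of effect algebras\<close>

text \<open>The effect algebra presented by a set \<open>G\<close> of generators, a generator \<open>u\<close> that serves as the
  unit, and relations \<open>R\<close> between finite formal sums of generators. One takes the smallest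
  congruence on formal sums for which the quotient \<open>M\<close> is a barred commutative monoid
  (orthocomplements with respect to \<open>u\<close> are unique, and \<open>x + y = 0\<close> implies \<open>x = 0\<close>);
  the effect algebra is the interval of all \<open>x\<close> in \<open>M\<close> such that \<open>x + y = u\<close> for some \<open>y\<close>.\<close>

inductive pres_cong ::
  "'g set \<Rightarrow> 'g \<Rightarrow> ('g multiset \<times> 'g multiset) set \<Rightarrow> 'g multiset \<Rightarrow> 'g multiset \<Rightarrow> bool"
  for G u R where
  rel: "(m, n) \<in> R \<Longrightarrow> pres_cong G u R m n"
| refl: "set_mset m \<subseteq> G \<Longrightarrow> pres_cong G u R m m"
| sym: "pres_cong G u R m n \<Longrightarrow> pres_cong G u R n m"
| trans: "pres_cong G u R m n \<Longrightarrow> pres_cong G u R n k \<Longrightarrow> pres_cong G u R m k"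
| add: "pres_cong G u R m n \<Longrightarrow> set_mset k \<subseteq> G \<Longrightarrow> pres_cong G u R (m + k) (n + k)"
| cancel: "pres_cong G u R (m + n) {#u#} \<Longrightarrow> pres_cong G u R (m + n') {#u#} \<Longrightarrow> pres_cong G u R n n'"
| positive: "pres_cong G u R (m + n) {#} \<Longrightarrow> pres_cong G u R m {#}"

definition pres_class ::
  "'g set \<Rightarrow> 'g \<Rightarrow> ('g multiset \<times> 'g multiset) set \<Rightarrow> 'g multiset \<Rightarrow> 'g multiset set" where
  "pres_class G u R m = {n. pres_cong G u R m n}"

definition pres_carrier ::
  "'g set \<Rightarrow> 'g \<Rightarrow> ('g multiset \<times> 'g multiset) set \<Rightarrow> 'g multiset set set" where
  "pres_carrier G u R = {pres_class G u R m | m n.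
     set_mset m \<subseteq> G \<and> set_mset n \<subseteq> G \<and> pres_cong G u R (m + n) {#u#}}"

definition presented ::
  "'g set \<Rightarrow> 'g \<Rightarrow> ('g multiset \<times> 'g multiset) set \<Rightarrow> 'g multiset set ea" where
  "presented G u R = \<lparr>
     ecarrier = pres_carrier G u R,
     osum = (\<lambda>x y. let z = {k. \<exists>m\<in>x. \<exists>n\<in>y. pres_cong G u R (m + n) k}
                   in if z \<in> pres_carrier G u R then Some z else None),
     ezero = pres_class G u R {#},
     eone = pres_class G u R {#u#}\<rparr>"

definition tensor_rels ::
  "'a ea \<Rightarrow> 'b ea \<Rightarrow> (('a \<times> 'b) multiset \<times> ('a \<times> 'b) multiset) set" where
  "tensor_rels E F =
     {({#(c, b)#}, {#(a, b), (a', b)#}) | a a' c b.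
        a \<in> ecarrier E \<and> a' \<in> ecarrier E \<and> c \<in> ecarrier E \<and> b \<in> ecarrier F \<and> osum E a a' = Some c} \<union>
     {({#(a, c)#}, {#(a, b), (a, b')#}) | a b b' c.
        a \<in> ecarrier E \<and> b \<in> ecarrier F \<and> b' \<in> ecarrier F \<and> c \<in> ecarrier F \<and> osum F b b' = Some c}"

definition tensor :: "'a ea \<Rightarrow> 'b ea \<Rightarrow> ('a \<times> 'b) multiset set ea" (infixr \<open>\<otimes>\<close> 70) where
  "E \<otimes> F = presented (ecarrier E \<times> ecarrier F) (eone E, eone F) (tensor_rels E F)"

definition ptens :: "'a ea \<Rightarrow> 'b ea \<Rightarrow> 'a \<Rightarrow> 'b \<Rightarrow> ('a \<times> 'b) multiset set" where
  "ptens E F a b =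
     pres_class (ecarrier E \<times> ecarrier F) (eone E, eone F) (tensor_rels E F) {#(a, b)#}"

definition bimorphism :: "'a ea \<Rightarrow> 'b ea \<Rightarrow> 'c ea \<Rightarrow> ('a \<Rightarrow> 'b \<Rightarrow> 'c) \<Rightarrow> bool" where
  "bimorphism E F H \<beta> \<longleftrightarrow>
     (\<forall>a\<in>ecarrier E. \<forall>b\<in>ecarrier F. \<beta> a b \<in> ecarrier H) \<and>
     \<beta> (eone E) (eone F) = eone H \<and>
     (\<forall>a\<in>ecarrier E. \<forall>a'\<in>ecarrier E. \<forall>c. \<forall>b\<in>ecarrier F.
        osum E a a' = Some c \<longrightarrow> osum H (\<beta> a b) (\<beta> a' b) = Some (\<beta> c b)) \<and>
     (\<forall>a\<in>ecarrier E. \<forall>b\<in>ecarrier F. \<forall>b'\<in>ecarrier F. \<forall>c.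
        osum F b b' = Some c \<longrightarrow> osum H (\<beta> a b) (\<beta> a b') = Some (\<beta> a c))"

text \<open>The morphism \<open>E \<otimes> F \<rightarrow> H\<close> induced by a bimorphism.\<close>

definition tensor_lift ::
  "'a ea \<Rightarrow> 'b ea \<Rightarrow> 'c ea \<Rightarrow> ('a \<Rightarrow> 'b \<Rightarrow> 'c) \<Rightarrow> ('a \<times> 'b) multiset set \<Rightarrow> 'c" where
  "tensor_lift E F H \<beta> = (THE h. h \<in> ea_hom (E \<otimes> F) H \<and>
     (\<forall>a\<in>ecarrier E. \<forall>b\<in>ecarrier F. h (ptens E F a b) = \<beta> a b))"

definition tensor_map where
  "tensor_map E F E' F' f g = tensor_lift E F (E' \<otimes> F') (\<lambda>a b. ptens E' F' (f a) (g b))"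

text \<open>The two structural isomorphisms that are needed, determined by their values on pure tensors:
  \<open>E \<otimes> (F \<otimes> H) \<rightarrow> (E \<otimes> F) \<otimes> H\<close> and
  \<open>(E \<otimes> F) \<otimes> (E' \<otimes> F') \<rightarrow> (E \<otimes> E') \<otimes> (F \<otimes> F')\<close>.\<close>

definition tensor_assoc where
  "tensor_assoc E F H = (THE h. h \<in> ea_hom (E \<otimes> (F \<otimes> H)) ((E \<otimes> F) \<otimes> H) \<and>
     (\<forall>a\<in>ecarrier E. \<forall>b\<in>ecarrier F. \<forall>c\<in>ecarrier H.
        h (ptens E (F \<otimes> H) a (ptens F H b c)) = ptens (E \<otimes> F) H (ptens E F a b) c))"

definition tensor_interchange where
  "tensor_interchange E F E' F' =
     (THE h. h \<in> ea_hom ((E \<otimes> F) \<otimes> (E' \<otimes> F')) ((E \<otimes> E') \<otimes> (F \<otimes> F')) \<and>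
       (\<forall>a\<in>ecarrier E. \<forall>b\<in>ecarrier F. \<forall>a'\<in>ecarrier E'. \<forall>b'\<in>ecarrier F'.
          h (ptens (E \<otimes> F) (E' \<otimes> F') (ptens E F a b) (ptens E' F' a' b')) =
            ptens (E \<otimes> E') (F \<otimes> F') (ptens E E' a a') (ptens F F' b b')))"


subsection \<open>Tensor products of families\<close>

text \<open>For finite \<open>I\<close> this is the \<open>I\<close>-fold tensor product, universal for maps that are additive in
  each variable and preserve the unit. For arbitrary \<open>I\<close> the generators are the families that are
  \<open>1\<close> at all but finitely many indices, so one obtains the filtered colimit of the finite tensor
  products along the maps that insert \<open>1\<close>; for Boolean algebras this is the coproduct
  in \<open>BAlg\<close>.\<close>

definition fam_gens :: "'i set \<Rightarrow> ('i \<Rightarrow> 'a ea) \<Rightarrow> ('i \<Rightarrow> 'a) set" where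
  "fam_gens I X = {x \<in> \<Pi>\<^sub>E i\<in>I. ecarrier (X i). finite {i \<in> I. x i \<noteq> eone (X i)}}"

definition fam_one :: "'i set \<Rightarrow> ('i \<Rightarrow> 'a ea) \<Rightarrow> 'i \<Rightarrow> 'a" where
  "fam_one I X = restrict (\<lambda>i. eone (X i)) I"

definition fam_rels ::
  "'i set \<Rightarrow> ('i \<Rightarrow> 'a ea) \<Rightarrow> (('i \<Rightarrow> 'a) multiset \<times> ('i \<Rightarrow> 'a) multiset) set" where
  "fam_rels I X =
     {({#x(i := c)#}, {#x(i := a), x(i := b)#}) | x i a b c.
        x \<in> fam_gens I X \<and> i \<in> I \<and> a \<in> ecarrier (X i) \<and> b \<in> ecarrier (X i) \<and> c \<in> ecarrier (X i) \<and>
        osum (X i) a b = Some c}"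

definition fam_tensor :: "'i set \<Rightarrow> ('i \<Rightarrow> 'a ea) \<Rightarrow> ('i \<Rightarrow> 'a) multiset set ea" where
  "fam_tensor I X = presented (fam_gens I X) (fam_one I X) (fam_rels I X)"

definition fam_ptens :: "'i set \<Rightarrow> ('i \<Rightarrow> 'a ea) \<Rightarrow> ('i \<Rightarrow> 'a) \<Rightarrow> ('i \<Rightarrow> 'a) multiset set" where
  "fam_ptens I X x = pres_class (fam_gens I X) (fam_one I X) (fam_rels I X) {#x#}"

definition fam_inj :: "'i set \<Rightarrow> ('i \<Rightarrow> 'a ea) \<Rightarrow> 'i \<Rightarrow> 'a \<Rightarrow> ('i \<Rightarrow> 'a) multiset set" where
  "fam_inj I X i = restrict (\<lambda>a. fam_ptens I X ((fam_one I X)(i := a))) (ecarrier (X i))"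


section \<open>Coproducts in the category of Boolean algebras\<close>

text \<open>The type argument is the type over which the test objects range.\<close>

definition is_balg_coproduct ::
  "'w itself \<Rightarrow> 'i set \<Rightarrow> ('i \<Rightarrow> 'a ea) \<Rightarrow> 'c ea \<Rightarrow> ('i \<Rightarrow> 'a \<Rightarrow> 'c) \<Rightarrow> bool" where
  "is_balg_coproduct _ I X C \<kappa> \<longleftrightarrow>
     boolean_ea C \<and> (\<forall>i\<in>I. \<kappa> i \<in> ea_hom (X i) C) \<and>
     (\<forall>(W :: 'w ea) f. boolean_ea W \<and> (\<forall>i\<in>I. f i \<in> ea_hom (X i) W) \<longrightarrow>
        (\<exists>!h. h \<in> ea_hom C W \<and> (\<forall>i\<in>I. ea_comp (X i) h (\<kappa> i) = f i)))"

definition codiagonal :: "'a ea \<Rightarrow> ('a \<times> 'a) multiset set \<Rightarrow> 'a" where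
  "codiagonal A = (THE h. h \<in> ea_hom (A \<otimes> A) A \<and>
     (\<forall>a\<in>ecarrier A. h (ptens A A a (eone A)) = a \<and> h (ptens A A (eone A) a) = a))"


section \<open>The category \<open>BKer\<close>\<close>

subsection \<open>The monad\<close>

type_synonym 'a scaled = "(real \<times> 'a) multiset set"

abbreviation scal :: "'a ea \<Rightarrow> 'a scaled ea" where
  "scal A \<equiv> unit_interval \<otimes> A"

definition two_to_interval :: "bool \<Rightarrow> real" where
  "two_to_interval = (THE f. f \<in> ea_hom two unit_interval)"

definition interval_mult :: "real scaled \<Rightarrow> real" where
  "interval_mult = tensor_lift unit_interval unit_interval unit_interval (\<lambda>r s. r * s)"

definition scal_unit :: "'a ea \<Rightarrow> 'a \<Rightarrow> 'a scaled" where
  "scal_unit A = ea_comp A (tensor_map two A unit_interval A two_to_interval (ea_id A))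
     (restrict (\<lambda>a. ptens two A True a) (ecarrier A))"

definition scal_mult :: "'a ea \<Rightarrow> 'a scaled scaled \<Rightarrow> 'a scaled" where
  "scal_mult A = ea_comp (scal (scal A))
     (tensor_map (unit_interval \<otimes> unit_interval) A unit_interval A interval_mult (ea_id A))
     (tensor_assoc unit_interval unit_interval A)"

subsection \<open>Morphisms\<close>

text \<open>A morphism \<open>A \<rightarrow> B\<close> of \<open>BKer\<close> is a map \<open>B \<rightarrow> \<I> \<otimes> A\<close>. The composite of \<open>f : A \<rightarrow> B\<close> and
  \<open>g : B \<rightarrow> C\<close> is \<open>bker_comp A B C g f\<close>; the tensor product of \<open>f : A \<rightarrow> B\<close> and
  \<open>f' : A' \<rightarrow> B'\<close> is \<open>bker_tensor A B A' B' f f'\<close>.\<close>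

definition bker_hom :: "'a ea \<Rightarrow> 'b ea \<Rightarrow> ('b \<Rightarrow> 'a scaled) set" where
  "bker_hom A B = ea_hom B (scal A)"

definition bker_id :: "'a ea \<Rightarrow> 'a \<Rightarrow> 'a scaled" where
  "bker_id A = scal_unit A"

definition bker_comp ::
  "'a ea \<Rightarrow> 'b ea \<Rightarrow> 'c ea \<Rightarrow> ('c \<Rightarrow> 'b scaled) \<Rightarrow> ('b \<Rightarrow> 'a scaled) \<Rightarrow> ('c \<Rightarrow> 'a scaled)" where
  "bker_comp A B C g f = ea_comp C (scal_mult A)
     (ea_comp C (tensor_map unit_interval B unit_interval (scal A) (ea_id unit_interval) f) g)"

text \<open>A Boolean (more generally effect algebra) homomorphism \<open>h : B \<rightarrow> A\<close> as a morphism
  \<open>A \<rightarrow> B\<close> of \<open>BKer\<close>.\<close>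

definition bker_of_hom :: "'a ea \<Rightarrow> 'b ea \<Rightarrow> ('b \<Rightarrow> 'a) \<Rightarrow> 'b \<Rightarrow> 'a scaled" where
  "bker_of_hom A B h = ea_comp B (scal_unit A) h"

definition bker_tensor ::
  "'a ea \<Rightarrow> 'b ea \<Rightarrow> 'c ea \<Rightarrow> 'd ea \<Rightarrow> ('b \<Rightarrow> 'a scaled) \<Rightarrow> ('d \<Rightarrow> 'c scaled) \<Rightarrow>
   ('b \<times> 'd) multiset set \<Rightarrow> ('a \<times> 'c) multiset set scaled" where
  "bker_tensor A B A' B' f f' = ea_comp (B \<otimes> B')
     (tensor_map (unit_interval \<otimes> unit_interval) (A \<otimes> A') unit_interval (A \<otimes> A')
        interval_mult (ea_id (A \<otimes> A')))
     (ea_comp (B \<otimes> B') (tensor_interchange unit_interval A unit_interval A')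
        (tensor_map B B' (scal A) (scal A') f f'))"

definition bker_discard :: "'a ea \<Rightarrow> bool \<Rightarrow> 'a scaled" where
  "bker_discard A = (THE f. f \<in> ea_hom two (scal A))"

definition bker_copy :: "'a ea \<Rightarrow> ('a \<times> 'a) multiset set \<Rightarrow> 'a scaled" where
  "bker_copy A = bker_of_hom A (A \<otimes> A) (codiagonal A)"

definition bker_deterministic :: "'a ea \<Rightarrow> 'b ea \<Rightarrow> ('b \<Rightarrow> 'a scaled) \<Rightarrow> bool" where
  "bker_deterministic A B f \<longleftrightarrow>
     bker_comp A B (B \<otimes> B) (bker_copy B) f =
     bker_comp A (A \<otimes> A) (B \<otimes> B) (bker_tensor A B A B f f) (bker_copy A)"


section \<open>Infinite tensor products and Kolmogorov products\<close>

text \<open>The isomorphism \<open>X\<^sup>F' \<rightarrow> X\<^sup>F \<otimes> X\<^sup>(F'-F)\<close> of \<open>BKer\<close> for \<open>F \<subseteq> F'\<close>, and the right unitor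
  \<open>A \<otimes> 2 \<rightarrow> A\<close> of \<open>BKer\<close>.\<close>

definition bker_split ::
  "('i \<Rightarrow> 'a ea) \<Rightarrow> 'i set \<Rightarrow> 'i set \<Rightarrow>
   (('i \<Rightarrow> 'a) multiset set \<times> ('i \<Rightarrow> 'a) multiset set) multiset set \<Rightarrow> ('i \<Rightarrow> 'a) multiset set scaled" where
  "bker_split X F F' =
     bker_of_hom (fam_tensor F' X) (fam_tensor F X \<otimes> fam_tensor (F' - F) X)
       (THE h. h \<in> ea_hom (fam_tensor F X \<otimes> fam_tensor (F' - F) X) (fam_tensor F' X) \<and>
          (\<forall>x\<in>fam_gens F X. \<forall>y\<in>fam_gens (F' - F) X.
             h (ptens (fam_tensor F X) (fam_tensor (F' - F) X)
                  (fam_ptens F X x) (fam_ptens (F' - F) X y)) =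
             fam_ptens F' X (\<lambda>i. if i \<in> F then x i else y i)))"

definition bker_right_unitor :: "'a ea \<Rightarrow> 'a \<Rightarrow> ('a \<times> bool) multiset set scaled" where
  "bker_right_unitor A = bker_of_hom (A \<otimes> two) A (restrict (\<lambda>a. ptens A two a True) (ecarrier A))"

definition bker_marginalize ::
  "('i \<Rightarrow> 'a ea) \<Rightarrow> 'i set \<Rightarrow> 'i set \<Rightarrow> ('i \<Rightarrow> 'a) multiset set \<Rightarrow> ('i \<Rightarrow> 'a) multiset set scaled" where
  "bker_marginalize X F F' =
    (let XF = fam_tensor F X; XR = fam_tensor (F' - F) X; XF' = fam_tensor F' X
     in bker_comp XF' (XF \<otimes> two) XF (bker_right_unitor XF)
         (bker_comp XF' (XF \<otimes> XR) (XF \<otimes> two)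
            (bker_tensor XF XF XR two (bker_id XF) (bker_discard XR))
            (bker_split X F F')))"

text \<open>\<open>L\<close> with legs \<open>p F : L \<rightarrow> D F\<close> is a limit in \<open>BKer\<close> of the diagram of objects \<open>D F\<close> and
  morphisms \<open>d F F' : D F' \<rightarrow> D F\<close>, where \<open>F \<subseteq> F'\<close> range over the finite subsets of \<open>I\<close>.
  The cones tested have apex over the type given by the first argument; in
  \<open>infinite_tensor_product\<close> the first type is that of the objects tensored with.\<close>

definition is_bker_limit ::
  "'z itself \<Rightarrow> 'i set \<Rightarrow> ('i set \<Rightarrow> 'd ea) \<Rightarrow> ('i set \<Rightarrow> 'i set \<Rightarrow> 'd \<Rightarrow> 'd scaled) \<Rightarrow>
   'l ea \<Rightarrow> ('i set \<Rightarrow> 'd \<Rightarrow> 'l scaled) \<Rightarrow> bool" where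
  "is_bker_limit _ I D d L p \<longleftrightarrow>
     boolean_ea L \<and>
     (\<forall>F. finite F \<and> F \<subseteq> I \<longrightarrow> boolean_ea (D F) \<and> p F \<in> bker_hom L (D F)) \<and>
     (\<forall>F F'. F \<subseteq> F' \<and> finite F' \<and> F' \<subseteq> I \<longrightarrow>
        d F F' \<in> bker_hom (D F') (D F) \<and> bker_comp L (D F') (D F) (d F F') (p F') = p F) \<and>
     (\<forall>(Z :: 'z ea) q.
        boolean_ea Z \<and>
        (\<forall>F. finite F \<and> F \<subseteq> I \<longrightarrow> q F \<in> bker_hom Z (D F)) \<and>
        (\<forall>F F'. F \<subseteq> F' \<and> finite F' \<and> F' \<subseteq> I \<longrightarrow> bker_comp Z (D F') (D F) (d F F') (q F') = q F) \<longrightarrow>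
        (\<exists>!h. h \<in> bker_hom Z L \<and>
           (\<forall>F. finite F \<and> F \<subseteq> I \<longrightarrow> bker_comp Z L (D F) (p F) h = q F)))"

definition infinite_tensor_product ::
  "'y itself \<Rightarrow> 'z itself \<Rightarrow> 'i set \<Rightarrow> ('i \<Rightarrow> 'a ea) \<Rightarrow>
   'p ea \<Rightarrow> ('i set \<Rightarrow> ('i \<Rightarrow> 'a) multiset set \<Rightarrow> 'p scaled) \<Rightarrow> bool" where
  "infinite_tensor_product _ _ I X P p \<longleftrightarrow>
     is_bker_limit TYPE('z) I (\<lambda>F. fam_tensor F X) (bker_marginalize X) P p \<and>
     (\<forall>Y :: 'y ea. boolean_ea Y \<longrightarrow>
        is_bker_limit TYPE('z) I
          (\<lambda>F. fam_tensor F X \<otimes> Y)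
          (\<lambda>F F'. bker_tensor (fam_tensor F' X) (fam_tensor F X) Y Y (bker_marginalize X F F') (bker_id Y))
          (P \<otimes> Y)
          (\<lambda>F. bker_tensor P (fam_tensor F X) Y Y (p F) (bker_id Y)))"

definition kolmogorov_product ::
  "'y itself \<Rightarrow> 'z itself \<Rightarrow> 'i set \<Rightarrow> ('i \<Rightarrow> 'a ea) \<Rightarrow>
   'p ea \<Rightarrow> ('i set \<Rightarrow> ('i \<Rightarrow> 'a) multiset set \<Rightarrow> 'p scaled) \<Rightarrow> bool" where
  "kolmogorov_product _ _ I X P p \<longleftrightarrow>
     infinite_tensor_product TYPE('y) TYPE('z) I X P p \<and>
     (\<forall>F. finite F \<and> F \<subseteq> I \<longrightarrow> bker_deterministic P (fam_tensor F X) (p F))"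

text \<open>The marginals of the coproduct: \<open>X\<^sup>F\<close> is the coproduct in \<open>BAlg\<close> of the \<open>X i\<close> with
  \<open>i \<in> F\<close>, and the marginal is given by the map into the coproduct over \<open>I\<close> that is compatible with
  the coproduct injections.\<close>

definition bker_marginal ::
  "'i set \<Rightarrow> ('i \<Rightarrow> 'a ea) \<Rightarrow> 'i set \<Rightarrow> ('i \<Rightarrow> 'a) multiset set \<Rightarrow> ('i \<Rightarrow> 'a) multiset set scaled" where
  "bker_marginal I X F = bker_of_hom (fam_tensor I X) (fam_tensor F X)
     (THE h. h \<in> ea_hom (fam_tensor F X) (fam_tensor I X) \<and>
        (\<forall>i\<in>F. ea_comp (X i) h (fam_inj F X i) = fam_inj I X i))"


section \<open>The tensor product has its universal property\<close>

lemma pres_cong_subset: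
  assumes "pres_cong G u R m n" "u \<in> G"
    and "R \<subseteq> {m. set_mset m \<subseteq> G} \<times> {m. set_mset m \<subseteq> G}"
  shows "set_mset m \<subseteq> G \<and> set_mset n \<subseteq> G"
  using assms(1) by (induction rule: pres_cong.induct) (use assms(2,3) in auto)

context
  fixes G :: "'g set" and u :: 'g and R :: "('g multiset \<times> 'g multiset) set"
  assumes uG: "u \<in> G" and RG: "R \<subseteq> {m. set_mset m \<subseteq> G} \<times> {m. set_mset m \<subseteq> G}"
begin

lemmas pc_subset = pres_cong_subset[OF _ uG RG]

lemma pres_class_eq_iff:
  assumes "set_mset m \<subseteq> G"
  shows "pres_class G u R m = pres_class G u R n \<longleftrightarrow> pres_cong G u R m n"
proof
  assume "pres_class G u R m = pres_class G u R n"
  then have "pres_cong G u R n m" using pres_cong.refl[OF assms] unfolding pres_class_def by blast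
  then show "pres_cong G u R m n" by (rule pres_cong.sym)
next
  assume "pres_cong G u R m n"
  then show "pres_class G u R m = pres_class G u R n"
    unfolding pres_class_def by (blast intro: pres_cong.sym pres_cong.trans)
qed

lemma pres_cong_add2:
  assumes "pres_cong G u R m m'" "pres_cong G u R n n'"
  shows "pres_cong G u R (m + n) (m' + n')"
proof -
  have "pres_cong G u R (m + n) (m' + n)"
    using pres_cong.add[OF assms(1)] pc_subset[OF assms(2)] by blast
  moreover have "pres_cong G u R (n + m') (n' + m')"
    using pres_cong.add[OF assms(2)] pc_subset[OF assms(1)] by blast
  ultimately show ?thesis by (metis add.commute pres_cong.trans)
qed

definition pres_below where
  "pres_below m \<longleftrightarrow> set_mset m \<subseteq> G \<and> (\<exists>n. set_mset n \<subseteq> G \<and> pres_cong G u R (m + n) {#u#})"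

lemma pres_class_in_carrier:
  assumes "set_mset m \<subseteq> G"
  shows "pres_class G u R m \<in> pres_carrier G u R \<longleftrightarrow> pres_below m"
proof
  assume "pres_class G u R m \<in> pres_carrier G u R"
  then obtain m' n where h: "pres_class G u R m = pres_class G u R m'"
    "set_mset n \<subseteq> G" "pres_cong G u R (m' + n) {#u#}"
    unfolding pres_carrier_def by blast
  have "pres_cong G u R m m'" using h(1) pres_class_eq_iff[OF assms] by blast
  then have "pres_cong G u R (m + n) (m' + n)" using h(2) by (rule pres_cong.add)
  then show "pres_below m" using h assms unfolding pres_below_def by (blast intro: pres_cong.trans)
qed (auto simp: pres_below_def pres_carrier_def)

lemma pres_carrier_obtain:
  assumes "x \<in> pres_carrier G u R"
  obtains m where "x = pres_class G u R m" "pres_below m" "set_mset m \<subseteq> G"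
  using assms unfolding pres_carrier_def pres_below_def by blast

lemma osum_presented:
  assumes "set_mset m \<subseteq> G" "set_mset n \<subseteq> G"
  shows "osum (presented G u R) (pres_class G u R m) (pres_class G u R n) =
    (if pres_below (m + n) then Some (pres_class G u R (m + n)) else None)"
proof -
  have "{k. \<exists>m'\<in>pres_class G u R m. \<exists>n'\<in>pres_class G u R n. pres_cong G u R (m' + n') k} =
     pres_class G u R (m + n)" (is "?L = _")
  proof
    show "?L \<subseteq> pres_class G u R (m + n)"
      unfolding pres_class_def by (blast intro: pres_cong.trans pres_cong_add2)
    show "pres_class G u R (m + n) \<subseteq> ?L"
      using pres_cong.refl[OF assms(1)] pres_cong.refl[OF assms(2)] unfolding pres_class_def by blast
  qed
  then show ?thesis
    using pres_class_in_carrier[of "m + n"] assms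
    unfolding presented_def Let_def by simp
qed

lemma pres_below_add_left: "pres_below (m + n) \<Longrightarrow> pres_below m"
  unfolding pres_below_def by (metis add.assoc le_sup_iff set_mset_union)

lemma pres_below_unit: "pres_below {#u#}"
  unfolding pres_below_def using uG pres_cong.refl[of "{#u#}" G u R]
  by (intro conjI exI[of _ "{#}"]) auto

lemma pres_carrier_simps:
  "ecarrier (presented G u R) = pres_carrier G u R"
  "ezero (presented G u R) = pres_class G u R {#}"
  "eone (presented G u R) = pres_class G u R {#u#}"
  unfolding presented_def by simp_all

lemma presented_effect_algebra: "effect_algebra (presented G u R)"
proof -
  let ?P = "presented G u R" and ?c = "pres_class G u R"
  have zero: "?c {#} \<in> pres_carrier G u R"
    using pres_class_in_carrier[of "{#}"] pres_below_add_left[of "{#}" "{#u#}"] pres_below_unit by simp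
  have one: "?c {#u#} \<in> pres_carrier G u R"
    using pres_class_in_carrier[of "{#u#}"] pres_below_unit uG by simp
  show ?thesis
    unfolding effect_algebra_def pres_carrier_simps
  proof (intro conjI ballI allI impI)
    fix a b c assume h: "a \<in> pres_carrier G u R" "b \<in> pres_carrier G u R" "osum ?P a b = Some c"
    then show "c \<in> pres_carrier G u R"
      unfolding presented_def by (auto simp: Let_def split: if_splits)
  next
    fix a assume "a \<in> pres_carrier G u R"
    then obtain m where "a = ?c m" "pres_below m" "set_mset m \<subseteq> G" by (rule pres_carrier_obtain)
    then show "osum ?P (?c {#}) a = Some a" using osum_presented[of "{#}" m] by simp
  next
    fix a b assume a: "a \<in> pres_carrier G u R" and b: "b \<in> pres_carrier G u R"
    obtain m where "a = ?c m" "set_mset m \<subseteq> G" using a by (rule pres_carrier_obtain)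
    moreover obtain n where "b = ?c n" "set_mset n \<subseteq> G" using b by (rule pres_carrier_obtain)
    ultimately show "osum ?P a b = osum ?P b a"
      using osum_presented[of m n] osum_presented[of n m] by (simp add: add.commute)
  next
    fix a b c assume a: "a \<in> pres_carrier G u R" and b: "b \<in> pres_carrier G u R"
      and c: "c \<in> pres_carrier G u R"
    obtain m where m: "a = ?c m" "set_mset m \<subseteq> G" using a by (rule pres_carrier_obtain)
    obtain n where n: "b = ?c n" "set_mset n \<subseteq> G" using b by (rule pres_carrier_obtain)
    obtain k where k: "c = ?c k" "set_mset k \<subseteq> G" using c by (rule pres_carrier_obtain)
    have "pres_below (m + n) \<and> pres_below (n + k)" if "pres_below (m + n + k)"
      using that pres_below_add_left[of "m + n" k] pres_below_add_left[of "n + k" m]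
      by (simp add: ac_simps)
    then show "Option.bind (osum ?P a b) (\<lambda>d. osum ?P d c) = Option.bind (osum ?P b c) (\<lambda>d. osum ?P a d)"
      using osum_presented[of m n] osum_presented[of n k] osum_presented[of "m + n" k]
        osum_presented[of m "n + k"] m n k
      by (auto simp: ac_simps)
  next
    fix a assume a: "a \<in> pres_carrier G u R"
    obtain m where m: "a = ?c m" "pres_below m" "set_mset m \<subseteq> G" using a by (rule pres_carrier_obtain)
    have *: "osum ?P a (?c n) = Some (?c {#u#}) \<longleftrightarrow> pres_cong G u R (m + n) {#u#}"
      if n: "set_mset n \<subseteq> G" for n
    proof -
      have mn: "set_mset (m + n) \<subseteq> G" using m n by simp
      have "pres_below (m + n)" if "pres_cong G u R (m + n) {#u#}"
        unfolding pres_below_def using that mn by (intro conjI exI[of _ "{#}"]) auto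
      then show ?thesis
        using osum_presented[OF m(3) n] pres_class_eq_iff[OF mn, of "{#u#}"] m(1) by auto
    qed
    obtain n where n: "set_mset n \<subseteq> G" "pres_cong G u R (m + n) {#u#}"
      using m(2) unfolding pres_below_def by blast
    show "\<exists>!a'. a' \<in> pres_carrier G u R \<and> osum ?P a a' = Some (?c {#u#})"
    proof (rule ex1I[of _ "?c n"])
      have "pres_below n" using n m(3) unfolding pres_below_def by (metis add.commute)
      then show "?c n \<in> pres_carrier G u R \<and> osum ?P a (?c n) = Some (?c {#u#})"
        using *[OF n(1)] n pres_class_in_carrier[OF n(1)] by simp
      fix b assume b: "b \<in> pres_carrier G u R \<and> osum ?P a b = Some (?c {#u#})"
      then obtain k where k: "b = ?c k" "set_mset k \<subseteq> G" using pres_carrier_obtain by metis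
      then have "pres_cong G u R (m + k) {#u#}" using * b by blast
      then have "pres_cong G u R k n" using n(2) by (rule pres_cong.cancel)
      then show "b = ?c n" using k pres_class_eq_iff by blast
    qed
  next
    fix a assume a: "a \<in> pres_carrier G u R" and h: "osum ?P a (?c {#u#}) \<noteq> None"
    obtain m where m: "a = ?c m" "set_mset m \<subseteq> G" using a by (rule pres_carrier_obtain)
    have "pres_below (m + {#u#})" using h osum_presented[OF m(2), of "{#u#}"] uG m(1)
      by (auto split: if_splits)
    then obtain n where n: "pres_cong G u R (m + {#u#} + n) {#u#}" unfolding pres_below_def by blast
    have "pres_cong G u R ({#u#} + (m + n)) {#u#}" using n by (simp add: ac_simps)
    moreover have "pres_cong G u R ({#u#} + {#}) {#u#}" using pres_cong.refl[of "{#u#}" G u R] uG by simp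
    ultimately have "pres_cong G u R (m + n) {#}" by (rule pres_cong.cancel)
    then have "pres_cong G u R m {#}" by (rule pres_cong.positive)
    then show "a = ?c {#}" using m pres_class_eq_iff by blast
  qed (use zero one in auto)
qed

end


text \<open>The sum in an effect algebra, extended to a total operation on the carrier together with an
  absorbing element.\<close>

definition tsum :: "'a ea \<Rightarrow> 'a option \<Rightarrow> 'a option \<Rightarrow> 'a option" where
  "tsum E x y = Option.bind x (\<lambda>a. Option.bind y (\<lambda>b.
     if a \<in> ecarrier E \<and> b \<in> ecarrier E then osum E a b else None))"

definition msum :: "'a ea \<Rightarrow> ('g \<Rightarrow> 'a) \<Rightarrow> 'g multiset \<Rightarrow> 'a option" where
  "msum E \<phi> m = fold_mset (\<lambda>g. tsum E (Some (\<phi> g))) (Some (ezero E)) m"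

context
  fixes E :: "'a ea"
  assumes E: "effect_algebra E"
begin

lemmas ea_laws = E[unfolded effect_algebra_def]

lemma ea_zero: "ezero E \<in> ecarrier E"
  by (rule ea_laws[THEN conjunct1])

lemma ea_one: "eone E \<in> ecarrier E"
  by (rule ea_laws[THEN conjunct2, THEN conjunct1])

lemma ea_closed: "a \<in> ecarrier E \<Longrightarrow> b \<in> ecarrier E \<Longrightarrow> osum E a b = Some c \<Longrightarrow> c \<in> ecarrier E"
  using ea_laws[THEN conjunct2, THEN conjunct2, THEN conjunct1] by blast

lemma ea_zero_left: "a \<in> ecarrier E \<Longrightarrow> osum E (ezero E) a = Some a"
  using ea_laws[THEN conjunct2, THEN conjunct2, THEN conjunct2, THEN conjunct1] by simp

lemma ea_comm: "a \<in> ecarrier E \<Longrightarrow> b \<in> ecarrier E \<Longrightarrow> osum E a b = osum E b a"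
  using ea_laws[THEN conjunct2, THEN conjunct2, THEN conjunct2, THEN conjunct2, THEN conjunct1] by simp

lemma ea_assoc:
  "a \<in> ecarrier E \<Longrightarrow> b \<in> ecarrier E \<Longrightarrow> c \<in> ecarrier E \<Longrightarrow>
    Option.bind (osum E a b) (\<lambda>d. osum E d c) = Option.bind (osum E b c) (\<lambda>d. osum E a d)"
  using ea_laws[THEN conjunct2, THEN conjunct2, THEN conjunct2, THEN conjunct2, THEN conjunct2, THEN conjunct1] by simp

lemma ea_compl: "a \<in> ecarrier E \<Longrightarrow> \<exists>!a'. a' \<in> ecarrier E \<and> osum E a a' = Some (eone E)"
  using ea_laws[THEN conjunct2, THEN conjunct2, THEN conjunct2, THEN conjunct2, THEN conjunct2, THEN conjunct2, THEN conjunct1] by simp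

lemma ea_zero_one: "a \<in> ecarrier E \<Longrightarrow> osum E a (eone E) \<noteq> None \<Longrightarrow> a = ezero E"
  using ea_laws[THEN conjunct2, THEN conjunct2, THEN conjunct2, THEN conjunct2, THEN conjunct2, THEN conjunct2, THEN conjunct2] by simp

lemma tsum_comm: "tsum E x y = tsum E y x"
  unfolding tsum_def by (cases x; cases y) (auto simp: ea_comm)

lemma tsum_None [simp]: "tsum E None y = None" "tsum E x None = None"
  unfolding tsum_def by (auto split: bind_splits)

lemma tsum_outside:
  "a \<notin> ecarrier E \<Longrightarrow> tsum E (Some a) y = None" "b \<notin> ecarrier E \<Longrightarrow> tsum E x (Some b) = None"
  unfolding tsum_def by (auto split: bind_splits)

lemma tsum_Some: "a \<in> ecarrier E \<Longrightarrow> b \<in> ecarrier E \<Longrightarrow> tsum E (Some a) (Some b) = osum E a b"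
  unfolding tsum_def by simp

lemma tsum_SomeE:
  assumes "tsum E x y = Some c"
  obtains a b where "x = Some a" "y = Some b" "a \<in> ecarrier E" "b \<in> ecarrier E" "osum E a b = Some c"
  using assms unfolding tsum_def by (auto simp: bind_eq_Some_conv split: if_splits)

lemma tsum_assoc: "tsum E (tsum E x y) z = tsum E x (tsum E y z)"
proof (cases "\<exists>a b c. x = Some a \<and> y = Some b \<and> z = Some c \<and>
    a \<in> ecarrier E \<and> b \<in> ecarrier E \<and> c \<in> ecarrier E")
  case True
  then obtain a b c where x: "x = Some a" "y = Some b" "z = Some c"
    and A: "a \<in> ecarrier E" "b \<in> ecarrier E" "c \<in> ecarrier E" by blast
  have "tsum E (osum E a b) (Some c) = Option.bind (osum E a b) (\<lambda>d. osum E d c)"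
    using ea_closed[OF A(1,2)] A(3) by (cases "osum E a b") (simp_all add: tsum_Some)
  moreover have "tsum E (Some a) (osum E b c) = Option.bind (osum E b c) (\<lambda>d. osum E a d)"
    using ea_closed[OF A(2,3)] A(1) by (cases "osum E b c") (simp_all add: tsum_Some)
  ultimately show ?thesis using ea_assoc[OF A] x A by (simp add: tsum_Some)
next
  case False
  then have "tsum E (tsum E x y) z = None" "tsum E x (tsum E y z) = None"
    by (meson not_None_eq tsum_SomeE)+
  then show ?thesis by simp
qed

lemma tsum_closed: "tsum E x y = Some c \<Longrightarrow> c \<in> ecarrier E"
  by (elim tsum_SomeE) (rule ea_closed)

lemma tsum_zero: "a \<in> ecarrier E \<Longrightarrow> tsum E (Some (ezero E)) (Some a) = Some a"
  by (simp add: tsum_Some ea_zero ea_zero_left)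

lemma msum_empty [simp]: "msum E \<phi> {#} = Some (ezero E)"
  unfolding msum_def by simp

lemma msum_add_mset [simp]: "msum E \<phi> (add_mset g m) = tsum E (Some (\<phi> g)) (msum E \<phi> m)"
proof -
  interpret comp_fun_commute "\<lambda>g. tsum E (Some (\<phi> g))"
    by standard (auto simp: fun_eq_iff comp_def, metis tsum_assoc tsum_comm)
  show ?thesis unfolding msum_def by simp
qed

lemma msum_single: "\<phi> g \<in> ecarrier E \<Longrightarrow> msum E \<phi> {#g#} = Some (\<phi> g)"
  using tsum_zero[of "\<phi> g"] by (simp add: tsum_comm)

lemma msum_closed: "msum E \<phi> m = Some c \<Longrightarrow> c \<in> ecarrier E"
  by (induction m) (auto simp: ea_zero dest: tsum_closed)

lemma msum_plus: "msum E \<phi> (m + n) = tsum E (msum E \<phi> m) (msum E \<phi> n)"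
proof (induction m)
  case empty
  show ?case
    using tsum_zero msum_closed[of \<phi> n] by (cases "msum E \<phi> n") simp_all
next
  case (add g m)
  then show ?case by (simp add: tsum_assoc)
qed

lemma tsum_eq_zero:
  assumes "tsum E x y = Some (ezero E)" shows "x = Some (ezero E)"
proof -
  obtain a b where x: "x = Some a" "y = Some b" "a \<in> ecarrier E" "b \<in> ecarrier E"
    "osum E a b = Some (ezero E)"
    using assms by (rule tsum_SomeE)
  have "Option.bind (osum E (eone E) a) (\<lambda>d. osum E d b) = Some (eone E)"
    using ea_assoc[OF ea_one x(3,4)] x(5) ea_comm[OF ea_one ea_zero] ea_zero_left[OF ea_one] by simp
  then have "osum E a (eone E) \<noteq> None" using ea_comm[OF ea_one x(3)] by (auto split: bind_splits)
  then show ?thesis using ea_zero_one[OF x(3)] x(1) by simp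
qed

lemma tsum_cancel:
  assumes "tsum E x y = Some c" "tsum E x y' = Some c"
  shows "y = y'"
proof -
  have c: "c \<in> ecarrier E" using tsum_closed assms by blast
  then obtain d where d: "d \<in> ecarrier E" "osum E c d = Some (eone E)"
    using ea_compl by blast
  let ?w = "tsum E (Some d) x"
  have *: "tsum E ?w z = Some (eone E)" if "tsum E x z = Some c" for z
    using that d tsum_Some[OF d(1) c] ea_comm[OF d(1) c] by (simp add: tsum_assoc)
  obtain w where w: "?w = Some w" "w \<in> ecarrier E"
    using *[OF assms(1)] tsum_closed[of "Some d" x] by (cases ?w) simp_all
  have **: "\<exists>b. z = Some b \<and> b \<in> ecarrier E \<and> osum E w b = Some (eone E)" if "tsum E x z = Some c" for z
    using *[OF that] unfolding w(1) by (auto elim: tsum_SomeE)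
  have "\<exists>!b. b \<in> ecarrier E \<and> osum E w b = Some (eone E)"
    by (rule ea_compl[OF w(2)])
  then show ?thesis using **[OF assms(1)] **[OF assms(2)] by blast
qed

lemma msum_cong:
  assumes "pres_cong G u R m n"
    and rel: "\<And>m n. (m, n) \<in> R \<Longrightarrow> msum E \<phi> m = msum E \<phi> n"
    and u: "\<phi> u \<in> ecarrier E"
  shows "msum E \<phi> m = msum E \<phi> n"
  using assms(1)
proof (induction rule: pres_cong.induct)
  case (cancel m n n')
  have "msum E \<phi> {#u#} = Some (\<phi> u)" using tsum_zero[OF u] by (simp add: tsum_comm)
  then show ?case using tsum_cancel[of "msum E \<phi> m" "msum E \<phi> n" "\<phi> u" "msum E \<phi> n'"] cancel.IH
    by (simp add: msum_plus)
next
  case (positive m n)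
  then show ?case using tsum_eq_zero[of "msum E \<phi> m" "msum E \<phi> n"] by (simp add: msum_plus)
qed (auto simp: rel msum_plus)

end

lemma presented_universal:
  assumes uG: "u \<in> G" and RG: "R \<subseteq> {m. set_mset m \<subseteq> G} \<times> {m. set_mset m \<subseteq> G}"
    and gens: "\<And>g. g \<in> G \<Longrightarrow> pres_class G u R {#g#} \<in> pres_carrier G u R"
    and E: "effect_algebra E" and \<phi>: "\<And>g. g \<in> G \<Longrightarrow> \<phi> g \<in> ecarrier E"
    and rel: "\<And>m n. (m, n) \<in> R \<Longrightarrow> msum E \<phi> m = msum E \<phi> n"
    and u: "\<phi> u = eone E"
  shows "\<exists>!h. h \<in> ea_hom (presented G u R) E \<and> (\<forall>g\<in>G. h (pres_class G u R {#g#}) = \<phi> g)"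
proof -
  let ?P = "presented G u R" and ?c = "pres_class G u R"
  note iff = pres_class_eq_iff[OF uG RG] and os = osum_presented[OF uG RG]
    and inC = pres_class_in_carrier[OF uG RG] and obt = pres_carrier_obtain[OF uG RG]
    and simps = pres_carrier_simps[OF uG RG] and bel = pres_below_def[OF uG RG]
  have u': "\<phi> u \<in> ecarrier E" using \<phi> uG by blast
  have single: "msum E \<phi> {#g#} = Some (\<phi> g)" if "g \<in> G" for g
    by (rule msum_single[OF E]) (rule \<phi>[OF that])
  have cong: "msum E \<phi> m = msum E \<phi> n" if "pres_cong G u R m n" for m n
    using that by (rule msum_cong[OF E]) (fact rel, fact u')
  have def: "\<exists>a. msum E \<phi> m = Some a" if b: "pres_below G u R m" for m
  proof -
    obtain n where "pres_cong G u R (m + n) {#u#}" using b unfolding bel by blast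
    then have "tsum E (msum E \<phi> m) (msum E \<phi> n) = Some (\<phi> u)"
      using cong[of "m + n" "{#u#}"] single[OF uG] by (simp add: msum_plus[OF E])
    then show ?thesis by (blast elim: tsum_SomeE[OF E])
  qed
  define h where "h = restrict (\<lambda>x. the (msum E \<phi> (SOME m. x = ?c m \<and> set_mset m \<subseteq> G))) (pres_carrier G u R)"
  have h: "msum E \<phi> m = Some (h (?c m))" if m: "pres_below G u R m" for m
  proof -
    have mG: "set_mset m \<subseteq> G" using m unfolding bel by blast
    let ?n = "SOME n. ?c m = ?c n \<and> set_mset n \<subseteq> G"
    have "?c m = ?c ?n \<and> set_mset ?n \<subseteq> G" by (rule someI[of _ m]) (use mG in simp)
    then have "pres_cong G u R m ?n" using iff[OF mG] by blast
    then have "msum E \<phi> m = msum E \<phi> ?n" by (rule cong)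
    moreover have "?c m \<in> pres_carrier G u R" using inC[OF mG] m by blast
    ultimately show ?thesis using def[OF m] unfolding h_def by auto
  qed
  have hom: "h \<in> ea_hom ?P E"
    unfolding ea_hom_def
  proof (intro CollectI conjI PiE_I ballI allI impI)
    fix x assume x: "x \<in> ecarrier ?P"
    then obtain m where m: "x = ?c m" "pres_below G u R m" using obt unfolding simps by metis
    then show "h x \<in> ecarrier E" using h msum_closed[OF E] by blast
  next
    fix x assume "x \<notin> ecarrier ?P"
    then show "h x = undefined" unfolding h_def simps by simp
  next
    show "h (eone ?P) = eone E"
      using h[OF pres_below_unit[OF uG RG]] single[OF uG] u unfolding simps by simp
  next
    fix x y z assume x: "x \<in> ecarrier ?P" and y: "y \<in> ecarrier ?P" and s: "osum ?P x y = Some z"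
    obtain m where m: "x = ?c m" "pres_below G u R m" "set_mset m \<subseteq> G" using x obt unfolding simps by metis
    obtain n where n: "y = ?c n" "pres_below G u R n" "set_mset n \<subseteq> G" using y obt unfolding simps by metis
    have mn: "pres_below G u R (m + n)" "z = ?c (m + n)" using s os[OF m(3) n(3)] m(1) n(1)
      by (auto split: if_splits)
    have "Some (h z) = tsum E (Some (h x)) (Some (h y))"
      using h[OF mn(1)] h[OF m(2)] h[OF n(2)] m(1) n(1) mn(2) by (simp add: msum_plus[OF E])
    moreover have "h x \<in> ecarrier E" "h y \<in> ecarrier E"
      using h[OF m(2)] h[OF n(2)] m(1) n(1) msum_closed[OF E] by auto
    ultimately show "osum E (h x) (h y) = Some (h z)" using tsum_Some[OF E] by simp
  qed
  have val: "h (?c {#g#}) = \<phi> g" if "g \<in> G" for g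
    using h[of "{#g#}"] single[OF that] gens[OF that] inC[of "{#g#}"] that by auto
  have uniq: "k = h" if k: "k \<in> ea_hom ?P E" "\<forall>g\<in>G. k (?c {#g#}) = \<phi> g" for k
  proof
    have kC: "k x \<in> ecarrier E" if "x \<in> ecarrier ?P" for x
      using k(1) that unfolding ea_hom_def by blast
    have ks: "osum E (k x) (k y) = Some (k z)"
      if "x \<in> ecarrier ?P" "y \<in> ecarrier ?P" "osum ?P x y = Some z" for x y z
      using k(1) that unfolding ea_hom_def by blast
    have k1: "k (eone ?P) = eone E" using k(1) unfolding ea_hom_def by blast
    fix x
    show "k x = h x"
    proof (cases "x \<in> pres_carrier G u R")
      case True
      then obtain m where m: "x = ?c m" "pres_below G u R m" "set_mset m \<subseteq> G" using obt by metis
      have "pres_below G u R m \<Longrightarrow> set_mset m \<subseteq> G \<Longrightarrow> Some (k (?c m)) = msum E \<phi> m" for m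
      proof (induction m)
        case empty
        have P: "effect_algebra ?P" by (rule presented_effect_algebra[OF uG RG])
        have "osum ?P (eone ?P) (ezero ?P) = Some (eone ?P)"
          using ea_comm[OF P ea_one[OF P] ea_zero[OF P]] ea_zero_left[OF P ea_one[OF P]] by simp
        then have 1: "osum E (eone E) (k (ezero ?P)) = Some (eone E)"
          using ks[OF ea_one[OF P] ea_zero[OF P]] k1 by simp
        have 2: "k (ezero ?P) \<in> ecarrier E" by (rule kC[OF ea_zero[OF P]])
        have "k (ezero ?P) = ezero E"
          using tsum_cancel[OF E, of "Some (eone E)" "Some (k (ezero ?P))" "eone E" "Some (ezero E)"]
            1 tsum_Some[OF E ea_one[OF E] 2] tsum_Some[OF E ea_one[OF E] ea_zero[OF E]]
            ea_zero_left[OF E ea_one[OF E]] ea_comm[OF E ea_one[OF E] ea_zero[OF E]] by simp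
        then show ?case unfolding simps by (simp add: msum_empty[OF E])
      next
        case (add g m)
        have g: "g \<in> G" and m: "set_mset m \<subseteq> G" using add.prems by auto
        have bm: "pres_below G u R m" using add.prems pres_below_add_left[OF uG RG, of m "{#g#}"] by simp
        have "osum ?P (?c {#g#}) (?c m) = Some (?c (add_mset g m))"
          using os[of "{#g#}" m] g m add.prems by simp
        moreover have "?c {#g#} \<in> ecarrier ?P" "?c m \<in> ecarrier ?P"
          using gens[OF g] inC[OF m] bm unfolding simps by auto
        ultimately have "osum E (k (?c {#g#})) (k (?c m)) = Some (k (?c (add_mset g m)))"
          and "k (?c m) \<in> ecarrier E"
          using ks kC by blast+
        then show ?case
          using k(2) g \<phi>[OF g] by (simp add: msum_add_mset[OF E] add.IH[OF bm m, symmetric] tsum_Some[OF E])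
      qed
      from this[OF m(2,3)] h[OF m(2)] show ?thesis using m(1) by simp
    next
      case False
      then have "x \<notin> ecarrier ?P" unfolding simps .
      moreover have "k \<in> ecarrier ?P \<rightarrow>\<^sub>E ecarrier E" "h \<in> ecarrier ?P \<rightarrow>\<^sub>E ecarrier E"
        using k(1) hom unfolding ea_hom_def by blast+
      ultimately show ?thesis by (metis PiE_arb)
    qed
  qed
  show ?thesis by (rule ex1I[of _ h]) (use hom val uniq in blast)+
qed

lemma tensor_generators:
  assumes E: "effect_algebra E" and F: "effect_algebra F"
  defines "G \<equiv> ecarrier E \<times> ecarrier F" and "u \<equiv> (eone E, eone F)"
  shows "u \<in> G"
    and "tensor_rels E F \<subseteq> {m. set_mset m \<subseteq> G} \<times> {m. set_mset m \<subseteq> G}"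
    and "g \<in> G \<Longrightarrow> pres_class G u (tensor_rels E F) {#g#} \<in> pres_carrier G u (tensor_rels E F)"
proof -
  let ?R = "tensor_rels E F"
  show u: "u \<in> G" unfolding u_def G_def using ea_one[OF E] ea_one[OF F] by simp
  show R: "?R \<subseteq> {m. set_mset m \<subseteq> G} \<times> {m. set_mset m \<subseteq> G}"
    unfolding tensor_rels_def G_def by auto
  show "pres_class G u ?R {#g#} \<in> pres_carrier G u ?R" if g: "g \<in> G"
  proof -
    obtain a b where ab: "g = (a, b)" "a \<in> ecarrier E" "b \<in> ecarrier F" using g unfolding G_def by auto
    obtain a' where a': "a' \<in> ecarrier E" "osum E a a' = Some (eone E)"
      using ea_compl[OF E ab(2)] by blast
    obtain b' where b': "b' \<in> ecarrier F" "osum F b b' = Some (eone F)"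
      using ea_compl[OF F ab(3)] by blast
    note o = ea_one[OF E] ea_one[OF F]
    have 1: "pres_cong G u ?R {#(eone E, b)#} {#(a, b), (a', b)#}"
      by (rule pres_cong.rel) (use ab a' o in \<open>auto simp: tensor_rels_def\<close>)
    have 2: "pres_cong G u ?R {#u#} {#(eone E, b), (eone E, b')#}"
      unfolding u_def by (rule pres_cong.rel) (use ab b' o in \<open>auto simp: tensor_rels_def\<close>)
    have "pres_cong G u ?R ({#(eone E, b)#} + {#(eone E, b')#}) ({#(a, b), (a', b)#} + {#(eone E, b')#})"
      by (rule pres_cong.add[OF 1]) (use b' o in \<open>auto simp: G_def\<close>)
    then have "pres_cong G u ?R {#(eone E, b), (eone E, b')#} ({#g#} + {#(a', b), (eone E, b')#})"
      using ab by (simp add: add_mset_commute)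
    then have "pres_cong G u ?R ({#g#} + {#(a', b), (eone E, b')#}) {#u#}"
      using 2 by (blast intro: pres_cong.trans pres_cong.sym)
    moreover have "set_mset {#(a', b), (eone E, b')#} \<subseteq> G" using a' b' ab o by (auto simp: G_def)
    moreover have "set_mset {#g#} \<subseteq> G" using g by simp
    ultimately show ?thesis unfolding pres_carrier_def by blast
  qed
qed

lemma tensor_effect_algebra:
  assumes "effect_algebra E" "effect_algebra F"
  shows "effect_algebra (E \<otimes> F)"
  unfolding tensor_def
  by (rule presented_effect_algebra) (use tensor_generators[OF assms] in blast)+

lemma bimorphism_ptens:
  assumes "effect_algebra E" "effect_algebra F"
  shows "bimorphism E F (E \<otimes> F) (ptens E F)"
proof -
  let ?G = "ecarrier E \<times> ecarrier F" and ?u = "(eone E, eone F)" and ?R = "tensor_rels E F"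
  note T = tensor_generators[OF assms]
  note simps = pres_carrier_simps[OF T(1,2)]
  have sum: "osum (E \<otimes> F) (pres_class ?G ?u ?R {#g#}) (pres_class ?G ?u ?R {#g'#}) =
      Some (pres_class ?G ?u ?R {#k#})"
    if g: "g \<in> ?G" "g' \<in> ?G" "k \<in> ?G" and r: "({#k#}, {#g, g'#}) \<in> ?R" for g g' k
  proof -
    have c: "pres_cong ?G ?u ?R {#k#} {#g, g'#}" using r by (rule pres_cong.rel)
    have eq: "pres_class ?G ?u ?R {#k#} = pres_class ?G ?u ?R ({#g#} + {#g'#})"
      using pres_class_eq_iff[OF T(1,2), of "{#k#}"] c g by (simp add: add_mset_commute)
    have "pres_below ?G ?u ?R ({#g#} + {#g'#})"
      using pres_class_in_carrier[OF T(1,2), of "{#g#} + {#g'#}"] T(3)[OF g(3)] eq g by simp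
    then show ?thesis
      using osum_presented[OF T(1,2), of "{#g#}" "{#g'#}"] eq g unfolding tensor_def by simp
  qed
  show ?thesis
    unfolding bimorphism_def ptens_def
  proof (intro conjI ballI allI impI)
    fix a b assume "a \<in> ecarrier E" "b \<in> ecarrier F"
    then show "pres_class ?G ?u ?R {#(a, b)#} \<in> ecarrier (E \<otimes> F)"
      using T(3)[of "(a, b)"] unfolding tensor_def simps by simp
  next
    show "pres_class ?G ?u ?R {#?u#} = eone (E \<otimes> F)" unfolding tensor_def simps ..
  next
    fix a a' c b assume h: "a \<in> ecarrier E" "a' \<in> ecarrier E" "b \<in> ecarrier F" "osum E a a' = Some c"
    then have "c \<in> ecarrier E" using ea_closed[OF assms(1)] by blast
    then show "osum (E \<otimes> F) (pres_class ?G ?u ?R {#(a, b)#}) (pres_class ?G ?u ?R {#(a', b)#}) =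
        Some (pres_class ?G ?u ?R {#(c, b)#})"
      using h by (intro sum) (auto simp: tensor_rels_def)
  next
    fix a b b' c assume h: "a \<in> ecarrier E" "b \<in> ecarrier F" "b' \<in> ecarrier F" "osum F b b' = Some c"
    then have "c \<in> ecarrier F" using ea_closed[OF assms(2)] by blast
    then show "osum (E \<otimes> F) (pres_class ?G ?u ?R {#(a, b)#}) (pres_class ?G ?u ?R {#(a, b')#}) =
        Some (pres_class ?G ?u ?R {#(a, c)#})"
      using h by (intro sum) (auto simp: tensor_rels_def)
  qed
qed

text \<open>The universal property that justifies \<^const>\<open>tensor_lift\<close>.\<close>

lemma tensor_universal:
  assumes "effect_algebra E" "effect_algebra F" "effect_algebra H" "bimorphism E F H \<beta>"
  shows "\<exists>!h. h \<in> ea_hom (E \<otimes> F) H \<and> (\<forall>a\<in>ecarrier E. \<forall>b\<in>ecarrier F. h (ptens E F a b) = \<beta> a b)"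
proof -
  let ?G = "ecarrier E \<times> ecarrier F" and ?u = "(eone E, eone F)" and ?R = "tensor_rels E F"
  let ?\<phi> = "\<lambda>(a, b). \<beta> a b"
  note T = tensor_generators[OF assms(1,2)]
  note B = assms(4)[unfolded bimorphism_def]
  have \<phi>: "?\<phi> g \<in> ecarrier H" if "g \<in> ?G" for g using B that by auto
  have single: "msum H ?\<phi> {#g#} = Some (?\<phi> g)" if "g \<in> ?G" for g
    by (rule msum_single[OF assms(3)]) (rule \<phi>[OF that])
  have pair: "msum H ?\<phi> {#g, g'#} = osum H (?\<phi> g) (?\<phi> g')" if "g \<in> ?G" "g' \<in> ?G" for g g'
    using msum_add_mset[OF assms(3), of ?\<phi> g "{#g'#}"] single[OF that(2)]
      tsum_Some[OF assms(3)] \<phi>[OF that(1)] \<phi>[OF that(2)] by simp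
  have rel: "msum H ?\<phi> m = msum H ?\<phi> n" if "(m, n) \<in> ?R" for m n
    using that unfolding tensor_rels_def
  proof (elim UnE CollectE exE conjE)
    fix a a' c b assume h: "(m, n) = ({#(c, b)#}, {#(a, b), (a', b)#})"
      "a \<in> ecarrier E" "a' \<in> ecarrier E" "c \<in> ecarrier E" "b \<in> ecarrier F" "osum E a a' = Some c"
    then have "osum H (\<beta> a b) (\<beta> a' b) = Some (\<beta> c b)" using B by blast
    then show ?thesis using h single[of "(c, b)"] pair[of "(a, b)" "(a', b)"] by simp
  next
    fix a b b' c assume h: "(m, n) = ({#(a, c)#}, {#(a, b), (a, b')#})"
      "a \<in> ecarrier E" "b \<in> ecarrier F" "b' \<in> ecarrier F" "c \<in> ecarrier F" "osum F b b' = Some c"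
    then have "osum H (\<beta> a b) (\<beta> a b') = Some (\<beta> a c)" using B by blast
    then show ?thesis using h single[of "(a, c)"] pair[of "(a, b)" "(a, b')"] by simp
  qed
  have "\<exists>!h. h \<in> ea_hom (presented ?G ?u ?R) H \<and> (\<forall>g\<in>?G. h (pres_class ?G ?u ?R {#g#}) = ?\<phi> g)"
    by (rule presented_universal[OF T assms(3)]) (use \<phi> rel B in auto)
  then show ?thesis unfolding tensor_def ptens_def by simp
qed

end

theory Submission
  imports Defs
begin

text \<open>
  A homomorphism \<open>h : C \<rightarrow> B\<close> gives a kernel \<open>B \<rightarrow> C\<close>, its composite with the unit of the monad
  \<open>\<I> \<otimes> (-)\<close>. By the unit law of the monad, following a kernel \<open>f : B \<rightarrow> \<I> \<otimes> A\<close> by it is just the map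
  \<open>f \<circ> h\<close> (\<open>bker_comp_of_hom\<close>), and such kernels are closed under tensor products
  (\<open>bker_tensor_of_homs\<close>). The marginals, the marginalizations \<open>X\<^sup>F' \<rightarrow> X\<^sup>F\<close>, and their tensor products
  with an identity all arise in this way, from the maps that insert \<open>1\<close> at the missing indices. A cone
  with apex \<open>Z\<close> over the diagram is therefore nothing but a cocone of effect algebra morphisms
  \<open>X\<^sup>F \<rightarrow> \<I> \<otimes> Z\<close>, and the two limit properties say that \<open>X\<^sup>I\<close>, respectively \<open>X\<^sup>I \<otimes> Y\<close>, is the colimit
  in \<open>EAlg\<close> of the finite tensor products \<open>X\<^sup>F\<close>, respectively \<open>X\<^sup>F \<otimes> Y\<close>. This is so because a generator of
  \<open>X\<^sup>I\<close> differs from \<open>1\<close> at finitely many indices only and a relation changes one further index, so that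
  generators and relations live at finite stages (\<open>fam_colimit_lift\<close>, \<open>fam_colimit_eqI\<close>).

  It remains to see that these objects are Boolean algebras. The meet of a Boolean algebra is an
  associative, commutative, unital and idempotent multiplication that is additive in each variable, and
  conversely an effect algebra with such a multiplication is Boolean
  (\<open>idempotent_effect_monoid_boolean\<close>). On a tensor product the componentwise meet of pure tensors
  extends to a multiplication of this kind. Idempotence passes from pure tensors to their sums,
  because idempotent summands of a defined sum are orthogonal (\<open>idempotent_sum\<close>). Since the product of
  pure tensors is known, Boolean homomorphisms on tensor products are determined by their values on the
  factors. This gives the coproduct property, the description of the codiagonal as the meet, and the
  determinism of all kernels that come from Boolean homomorphisms.

  Extensions from pure tensors are built one variable at a time. With one variable fixed, a
  bimorphism is additive but does not preserve the unit; this is why additive maps rather than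
  morphisms are the basic notion below.
\<close>

section \<open>Additive maps\<close>

definition ea_additive :: "'a ea \<Rightarrow> 'b ea \<Rightarrow> ('a \<Rightarrow> 'b) \<Rightarrow> bool" where
  "ea_additive E F f \<longleftrightarrow> (\<forall>a\<in>ecarrier E. f a \<in> ecarrier F) \<and>
     (\<forall>a\<in>ecarrier E. \<forall>b\<in>ecarrier E. \<forall>c. osum E a b = Some c \<longrightarrow> osum F (f a) (f b) = Some (f c))"

definition ea_biadditive :: "'a ea \<Rightarrow> 'b ea \<Rightarrow> 'c ea \<Rightarrow> ('a \<Rightarrow> 'b \<Rightarrow> 'c) \<Rightarrow> bool" where
  "ea_biadditive E F H \<beta> \<longleftrightarrow>
     (\<forall>b\<in>ecarrier F. ea_additive E H (\<lambda>a. \<beta> a b)) \<and> (\<forall>a\<in>ecarrier E. ea_additive F H (\<beta> a))"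

lemma ea_additiveI:
  assumes "\<And>a. a \<in> ecarrier E \<Longrightarrow> f a \<in> ecarrier F"
    and "\<And>a b c. a \<in> ecarrier E \<Longrightarrow> b \<in> ecarrier E \<Longrightarrow> osum E a b = Some c \<Longrightarrow> osum F (f a) (f b) = Some (f c)"
  shows "ea_additive E F f"
  using assms unfolding ea_additive_def by blast

lemma ea_additive_closed: "ea_additive E F f \<Longrightarrow> a \<in> ecarrier E \<Longrightarrow> f a \<in> ecarrier F"
  unfolding ea_additive_def by blast

lemma ea_additive_sum:
  "ea_additive E F f \<Longrightarrow> osum E a b = Some c \<Longrightarrow> a \<in> ecarrier E \<Longrightarrow> b \<in> ecarrier E \<Longrightarrow>
    osum F (f a) (f b) = Some (f c)"
  unfolding ea_additive_def by blast

lemma ea_additive_comp: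
  assumes "ea_additive E F f" "ea_additive F H g"
  shows "ea_additive E H (\<lambda>x. g (f x))"
  using assms unfolding ea_additive_def by blast

lemma ea_additive_cong:
  assumes "effect_algebra E" "\<And>a. a \<in> ecarrier E \<Longrightarrow> f a = g a"
  shows "ea_additive E F f \<longleftrightarrow> ea_additive E F g"
proof -
  have "osum E a b = Some c \<Longrightarrow> f c = g c" if "a \<in> ecarrier E" "b \<in> ecarrier E" for a b c
    using ea_closed[OF assms(1)] that assms(2) by blast
  then show ?thesis using assms(2) unfolding ea_additive_def by (simp cong: ball_cong)
qed

lemma ea_biadditive_left: "ea_biadditive E F H \<beta> \<Longrightarrow> b \<in> ecarrier F \<Longrightarrow> ea_additive E H (\<lambda>a. \<beta> a b)"
  unfolding ea_biadditive_def by blast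

lemma ea_biadditive_right: "ea_biadditive E F H \<beta> \<Longrightarrow> a \<in> ecarrier E \<Longrightarrow> ea_additive F H (\<beta> a)"
  unfolding ea_biadditive_def by blast

lemma ea_hom_iff:
  "f \<in> ea_hom E F \<longleftrightarrow> ea_additive E F f \<and> f \<in> extensional (ecarrier E) \<and> f (eone E) = eone F"
  unfolding ea_hom_def ea_additive_def by (auto simp: PiE_iff)

lemma ea_hom_additive: "f \<in> ea_hom E F \<Longrightarrow> ea_additive E F f"
  unfolding ea_hom_iff by blast

lemma ea_hom_closed: "f \<in> ea_hom E F \<Longrightarrow> a \<in> ecarrier E \<Longrightarrow> f a \<in> ecarrier F"
  unfolding ea_hom_iff ea_additive_def by blast

lemma ea_hom_one: "f \<in> ea_hom E F \<Longrightarrow> f (eone E) = eone F"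
  unfolding ea_hom_iff by blast

lemma ea_hom_eqI:
  assumes "f \<in> ea_hom E F" "g \<in> ea_hom E F'" "\<And>a. a \<in> ecarrier E \<Longrightarrow> f a = g a"
  shows "f = g"
  using assms extensionalityI unfolding ea_hom_iff by blast

lemma ea_hom_restrict:
  assumes E: "effect_algebra E" and f: "ea_additive E F f" "f (eone E) = eone F"
  shows "restrict f (ecarrier E) \<in> ea_hom E F"
  using f ea_additive_cong[OF E, of f "restrict f (ecarrier E)"] ea_one[OF E]
  unfolding ea_hom_iff by simp

lemma bimorphism_iff:
  "bimorphism E F H \<beta> \<longleftrightarrow> ea_biadditive E F H \<beta> \<and> \<beta> (eone E) (eone F) = eone H"
  unfolding bimorphism_def ea_biadditive_def ea_additive_def by blast

lemma ea_comp_apply [simp]: "a \<in> ecarrier E \<Longrightarrow> ea_comp E g f a = g (f a)"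
  unfolding ea_comp_def by (simp add: compose_eq)

lemma ea_comp_hom:
  assumes "effect_algebra E" "f \<in> ea_hom E F" "g \<in> ea_hom F H"
  shows "ea_comp E g f \<in> ea_hom E H"
proof -
  have "ea_comp E g f = restrict (\<lambda>x. g (f x)) (ecarrier E)"
    unfolding ea_comp_def compose_def ..
  then show ?thesis
    using ea_hom_restrict[OF assms(1), of H "\<lambda>x. g (f x)"] assms(2,3) ea_additive_comp
    unfolding ea_hom_iff by metis
qed

lemma ea_id_apply [simp]: "a \<in> ecarrier E \<Longrightarrow> ea_id E a = a"
  unfolding ea_id_def by simp

lemma ea_id_hom: "effect_algebra E \<Longrightarrow> ea_id E \<in> ea_hom E E"
  unfolding ea_id_def by (rule ea_hom_restrict) (auto simp: ea_additive_def)

lemma ea_cancel: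
  assumes "effect_algebra E" "osum E a b = Some c" "osum E a b' = Some c"
    and "a \<in> ecarrier E" "b \<in> ecarrier E" "b' \<in> ecarrier E"
  shows "b = b'"
  using tsum_cancel[OF assms(1), of "Some a" "Some b" c "Some b'"] assms tsum_Some[OF assms(1)] by simp

lemma tsum_SomeD: "effect_algebra E \<Longrightarrow> tsum E (Some a) (Some b) = Some c \<Longrightarrow> osum E a b = Some c"
  by (erule tsum_SomeE) auto

lemma ea_additive_zero:
  assumes E: "effect_algebra E" and F: "effect_algebra F" and f: "ea_additive E F f"
  shows "f (ezero E) = ezero F"
proof -
  note z = ea_zero[OF E]
  note fz = ea_additive_closed[OF f z]
  have "osum F (f (ezero E)) (f (ezero E)) = Some (f (ezero E))"
    by (rule ea_additive_sum[OF f ea_zero_left[OF E z] z z])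
  moreover have "osum F (f (ezero E)) (ezero F) = Some (f (ezero E))"
    using ea_zero_left[OF F fz] ea_comm[OF F fz ea_zero[OF F]] by simp
  ultimately show ?thesis using ea_cancel[OF F] fz ea_zero[OF F] by blast
qed

lemma ea_additive_msum:
  assumes E: "effect_algebra E" and F: "effect_algebra F" and f: "ea_additive E F f"
  shows "msum E \<phi> m = Some x \<Longrightarrow> msum F (\<lambda>g. f (\<phi> g)) m = Some (f x)"
proof (induction m arbitrary: x)
  case empty
  then show ?case using ea_additive_zero[OF E F f] by (simp add: msum_empty[OF E] msum_empty[OF F])
next
  case (add g m)
  obtain y where y: "msum E \<phi> m = Some y" "\<phi> g \<in> ecarrier E" "y \<in> ecarrier E" "osum E (\<phi> g) y = Some x"
    using add.prems unfolding msum_add_mset[OF E] by (auto elim: tsum_SomeE[OF E])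
  have "msum F (\<lambda>g. f (\<phi> g)) (add_mset g m) = tsum F (Some (f (\<phi> g))) (Some (f y))"
    using add.IH[OF y(1)] by (simp add: msum_add_mset[OF F])
  also have "\<dots> = osum F (f (\<phi> g)) (f y)"
    using tsum_Some[OF F] ea_additive_closed[OF f] y by blast
  finally show ?case using ea_additive_sum[OF f y(4,2,3)] by simp
qed

lemma msum_fun_cong:
  assumes E: "effect_algebra E"
  shows "(\<And>g. g \<in># m \<Longrightarrow> \<phi> g = \<psi> g) \<Longrightarrow> msum E \<phi> m = msum E \<psi> m"
  by (induction m) (simp_all add: msum_empty[OF E] msum_add_mset[OF E])

text \<open>The identity includes the case that a side is undefined, since \<^const>\<open>tsum\<close> is commutative and
  associative with \<^const>\<open>None\<close> as an absorbing element.\<close>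

lemma msum_pointwise:
  assumes E: "effect_algebra E"
  shows "(\<And>g. g \<in># m \<Longrightarrow> \<phi> g \<in> ecarrier E \<and> \<psi> g \<in> ecarrier E \<and> osum E (\<phi> g) (\<psi> g) = Some (\<chi> g)) \<Longrightarrow>
    msum E \<chi> m = tsum E (msum E \<phi> m) (msum E \<psi> m)"
proof (induction m)
  case empty
  then show ?case using tsum_zero[OF E ea_zero[OF E]] by (simp add: msum_empty[OF E])
next
  case (add g m)
  let ?t = "tsum E"
  have "Some (\<chi> g) = ?t (Some (\<phi> g)) (Some (\<psi> g))" using add.prems tsum_Some[OF E] by simp
  moreover have "?t (?t a b) (?t c d) = ?t (?t a c) (?t b d)" for a b c d
    by (metis tsum_assoc[OF E] tsum_comm[OF E])
  ultimately show ?case using add by (simp add: msum_add_mset[OF E])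
qed


section \<open>Presentations by sum relations\<close>

definition sum_rels :: "('g \<times> 'g \<times> 'g) set \<Rightarrow> ('g multiset \<times> 'g multiset) set" where
  "sum_rels S = {({#c#}, {#a, b#}) | a b c. (a, b, c) \<in> S}"

text \<open>Tensor products of pairs and of families are both presented by relations of the form
  \<open>c = a \<oplus> b\<close> between generators. The last condition says that every generator has a complement
  with respect to \<open>u\<close> in the presented monoid, so that it names an element of the effect algebra.\<close>

locale sum_presentation =
  fixes G :: "'g set" and u :: 'g and S :: "('g \<times> 'g \<times> 'g) set"
  assumes uG: "u \<in> G" and SG: "S \<subseteq> G \<times> G \<times> G"
    and gens: "\<And>g. g \<in> G \<Longrightarrow> pres_class G u (sum_rels S) {#g#} \<in> pres_carrier G u (sum_rels S)"
begin

abbreviation "R \<equiv> sum_rels S"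
abbreviation "P \<equiv> presented G u R"
abbreviation "cls g \<equiv> pres_class G u R {#g#}"

lemma RG: "R \<subseteq> {m. set_mset m \<subseteq> G} \<times> {m. set_mset m \<subseteq> G}"
  using SG unfolding sum_rels_def by auto

lemma algebra: "effect_algebra P"
  by (rule presented_effect_algebra[OF uG RG])

lemma cls_closed: "g \<in> G \<Longrightarrow> cls g \<in> ecarrier P"
  using gens pres_carrier_simps[OF uG RG] by simp

lemma cls_unit: "cls u = eone P"
  using pres_carrier_simps[OF uG RG] by simp

lemma cls_sum:
  assumes "(a, b, c) \<in> S"
  shows "osum P (cls a) (cls b) = Some (cls c)"
proof -
  have G: "a \<in> G" "b \<in> G" "c \<in> G" using assms SG by auto
  have "pres_cong G u R {#c#} {#a, b#}"
    by (rule pres_cong.rel) (use assms in \<open>auto simp: sum_rels_def\<close>)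
  then have eq: "cls c = pres_class G u R ({#a#} + {#b#})"
    using pres_class_eq_iff[OF uG RG, of "{#c#}"] G by (simp add: add_mset_commute)
  then have "pres_below G u R ({#a#} + {#b#})"
    using pres_class_in_carrier[OF uG RG, of "{#a#} + {#b#}"] gens[OF G(3)] G by simp
  then show ?thesis using osum_presented[OF uG RG, of "{#a#}" "{#b#}"] eq G by simp
qed

lemma msum_cls: "pres_below G u R m \<Longrightarrow> set_mset m \<subseteq> G \<Longrightarrow> msum P cls m = Some (pres_class G u R m)"
proof (induction m)
  case empty
  then show ?case using pres_carrier_simps[OF uG RG] by (simp add: msum_empty[OF algebra])
next
  case (add g m)
  have m: "set_mset m \<subseteq> G" and g: "g \<in> G" using add.prems by auto
  have b: "pres_below G u R m" using add.prems pres_below_add_left[OF uG RG, of m "{#g#}"] by simp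
  have "pres_class G u R m \<in> ecarrier P"
    using pres_class_in_carrier[OF uG RG m] b pres_carrier_simps[OF uG RG] by simp
  then have "msum P cls (add_mset g m) = osum P (cls g) (pres_class G u R m)"
    using add.IH[OF b m] tsum_Some[OF algebra cls_closed[OF g]] by (simp add: msum_add_mset[OF algebra])
  then show ?case using osum_presented[OF uG RG, of "{#g#}" m] g m add.prems by simp
qed

lemma span:
  assumes "x \<in> ecarrier P"
  obtains m where "set_mset m \<subseteq> G" "msum P cls m = Some x"
proof -
  have "x \<in> pres_carrier G u R" using assms pres_carrier_simps[OF uG RG] by simp
  then obtain m where "x = pres_class G u R m" "pres_below G u R m" "set_mset m \<subseteq> G"
    by (rule pres_carrier_obtain[OF uG RG])
  then show ?thesis using msum_cls that by blast
qed

text \<open>The sum of the values is invariant under the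
  congruence as soon as the relations hold, because \<open>E\<close> is cancellative and positive; it is defined on
  every \<open>m\<close> below \<open>u\<close>, being a summand of \<open>\<phi> u\<close>.\<close>

lemma lift:
  assumes E: "effect_algebra E" and \<phi>: "\<And>g. g \<in> G \<Longrightarrow> \<phi> g \<in> ecarrier E"
    and rel: "\<And>a b c. (a, b, c) \<in> S \<Longrightarrow> osum E (\<phi> a) (\<phi> b) = Some (\<phi> c)"
  shows "\<exists>h. ea_additive P E h \<and> (\<forall>g\<in>G. h (cls g) = \<phi> g)"
proof -
  let ?c = "pres_class G u R"
  note bel = pres_below_def[OF uG RG]
  have u': "\<phi> u \<in> ecarrier E" using \<phi> uG by blast
  have single: "msum E \<phi> {#g#} = Some (\<phi> g)" if "g \<in> G" for g
    by (rule msum_single[OF E]) (rule \<phi>[OF that])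
  have relE: "msum E \<phi> m = msum E \<phi> n" if mn: "(m, n) \<in> R" for m n
  proof -
    obtain a b c where abc: "m = {#c#}" "n = {#a, b#}" "(a, b, c) \<in> S"
      using mn unfolding sum_rels_def by blast
    then have G: "a \<in> G" "b \<in> G" "c \<in> G" using SG by auto
    show ?thesis
      using abc rel[OF abc(3)] single[OF G(3)] single[OF G(2)] tsum_Some[OF E \<phi>[OF G(1)] \<phi>[OF G(2)]]
      by (simp add: msum_add_mset[OF E, of _ a])
  qed
  have cong: "msum E \<phi> m = msum E \<phi> n" if "pres_cong G u R m n" for m n
    using that by (rule msum_cong[OF E]) (fact relE, fact u')
  have def: "msum E \<phi> m \<noteq> None" if b: "pres_below G u R m" for m
  proof -
    obtain n where "pres_cong G u R (m + n) {#u#}" using b unfolding bel by blast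
    then have "tsum E (msum E \<phi> m) (msum E \<phi> n) = Some (\<phi> u)"
      using cong[of "m + n" "{#u#}"] single[OF uG] by (simp add: msum_plus[OF E])
    then show ?thesis by (auto elim: tsum_SomeE[OF E])
  qed
  define h where "h x = the (msum E \<phi> (SOME m. x = ?c m \<and> set_mset m \<subseteq> G))" for x
  have h: "msum E \<phi> m = Some (h (?c m))" if m: "pres_below G u R m" for m
  proof -
    have mG: "set_mset m \<subseteq> G" using m unfolding bel by blast
    let ?n = "SOME n. ?c m = ?c n \<and> set_mset n \<subseteq> G"
    have "?c m = ?c ?n \<and> set_mset ?n \<subseteq> G" by (rule someI[of _ m]) (use mG in simp)
    then have "msum E \<phi> m = msum E \<phi> ?n" using pres_class_eq_iff[OF uG RG mG] cong by blast
    then show ?thesis using def[OF m] unfolding h_def by auto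
  qed
  have "ea_additive P E h"
  proof (rule ea_additiveI)
    fix x assume "x \<in> ecarrier P"
    then obtain m where "x = ?c m" "pres_below G u R m"
      using pres_carrier_obtain[OF uG RG] pres_carrier_simps(1)[OF uG RG] by metis
    then show "h x \<in> ecarrier E" using h msum_closed[OF E] by blast
  next
    fix x y z assume x: "x \<in> ecarrier P" and y: "y \<in> ecarrier P" and s: "osum P x y = Some z"
    obtain m where m: "x = ?c m" "pres_below G u R m" "set_mset m \<subseteq> G"
      using x pres_carrier_obtain[OF uG RG] pres_carrier_simps(1)[OF uG RG] by metis
    obtain n where n: "y = ?c n" "pres_below G u R n" "set_mset n \<subseteq> G"
      using y pres_carrier_obtain[OF uG RG] pres_carrier_simps(1)[OF uG RG] by metis
    have mn: "pres_below G u R (m + n)" "z = ?c (m + n)"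
      using s osum_presented[OF uG RG m(3) n(3)] m(1) n(1) by (auto split: if_splits)
    have "Some (h z) = tsum E (Some (h x)) (Some (h y))"
      using h[OF mn(1)] h[OF m(2)] h[OF n(2)] m(1) n(1) mn(2) by (simp add: msum_plus[OF E])
    then show "osum E (h x) (h y) = Some (h z)" by (intro tsum_SomeD[OF E]) simp
  qed
  moreover have "h (cls g) = \<phi> g" if g: "g \<in> G" for g
    using h[of "{#g#}"] single[OF g] gens[OF g] pres_class_in_carrier[OF uG RG, of "{#g#}"] g by auto
  ultimately show ?thesis by blast
qed

lemma additive_value:
  assumes E: "effect_algebra E" and f: "ea_additive P E f" and m: "msum P cls m = Some x"
  shows "msum E (\<lambda>g. f (cls g)) m = Some (f x)"
  by (rule ea_additive_msum[OF algebra E f m])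

lemma additive_eqI:
  assumes E: "effect_algebra E" and f: "ea_additive P E f" and h: "ea_additive P E h"
    and eq: "\<And>g. g \<in> G \<Longrightarrow> f (cls g) = h (cls g)" and x: "x \<in> ecarrier P"
  shows "f x = h x"
proof -
  obtain m where m: "set_mset m \<subseteq> G" "msum P cls m = Some x" using x by (rule span)
  have "msum E (\<lambda>g. f (cls g)) m = msum E (\<lambda>g. h (cls g)) m"
    by (rule msum_fun_cong[OF E]) (use m(1) eq in blast)
  then show ?thesis using additive_value[OF E f m(2)] additive_value[OF E h m(2)] by simp
qed

text \<open>Additivity of a family of maps in its parameter can be tested on generators.\<close>

lemma additive_sumI:
  assumes E: "effect_algebra E" and f: "ea_additive P E f" and h: "ea_additive P E h"
    and k: "ea_additive P E k"
    and eq: "\<And>g. g \<in> G \<Longrightarrow> osum E (f (cls g)) (h (cls g)) = Some (k (cls g))" and x: "x \<in> ecarrier P"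
  shows "osum E (f x) (h x) = Some (k x)"
proof -
  obtain m where m: "set_mset m \<subseteq> G" "msum P cls m = Some x" using x by (rule span)
  have "msum E (\<lambda>g. k (cls g)) m = tsum E (msum E (\<lambda>g. f (cls g)) m) (msum E (\<lambda>g. h (cls g)) m)"
    by (rule msum_pointwise[OF E])
      (use m(1) eq ea_additive_closed[OF f] ea_additive_closed[OF h] cls_closed in blast)
  then have "tsum E (Some (f x)) (Some (h x)) = Some (k x)"
    using additive_value[OF E f m(2)] additive_value[OF E h m(2)] additive_value[OF E k m(2)] by simp
  then show ?thesis by (rule tsum_SomeD[OF E])
qed

text \<open>The first variable is extended separately for each \<open>y\<close>. That the extensions still depend
  additively on \<open>y\<close> is a statement on generators by \<open>additive_sumI\<close>, where it is assumed.\<close>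

lemma lift_parametrized:
  assumes E: "effect_algebra E" and Y: "effect_algebra Y"
    and left: "\<And>a b c y. (a, b, c) \<in> S \<Longrightarrow> y \<in> ecarrier Y \<Longrightarrow> osum E (\<beta> a y) (\<beta> b y) = Some (\<beta> c y)"
    and right: "\<And>g. g \<in> G \<Longrightarrow> ea_additive Y E (\<beta> g)"
  shows "\<exists>B. ea_biadditive P Y E B \<and> (\<forall>g\<in>G. \<forall>y\<in>ecarrier Y. B (cls g) y = \<beta> g y)"
proof -
  have "\<exists>h. ea_additive P E h \<and> (\<forall>g\<in>G. h (cls g) = \<beta> g y)" if "y \<in> ecarrier Y" for y
    by (rule lift[OF E]) (use that left ea_additive_closed[OF right] in blast)+
  then obtain h where h: "\<And>y. y \<in> ecarrier Y \<Longrightarrow> ea_additive P E (h y)"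
    "\<And>y g. y \<in> ecarrier Y \<Longrightarrow> g \<in> G \<Longrightarrow> h y (cls g) = \<beta> g y" by metis
  have "ea_additive Y E (\<lambda>y. h y x)" if x: "x \<in> ecarrier P" for x
  proof (rule ea_additiveI)
    fix y assume "y \<in> ecarrier Y"
    then show "h y x \<in> ecarrier E" using ea_additive_closed[OF h(1)] x by blast
  next
    fix y y' z assume y: "y \<in> ecarrier Y" "y' \<in> ecarrier Y" "osum Y y y' = Some z"
    have z: "z \<in> ecarrier Y" by (rule ea_closed[OF Y y])
    show "osum E (h y x) (h y' x) = Some (h z x)"
    proof (rule additive_sumI[OF E h(1)[OF y(1)] h(1)[OF y(2)] h(1)[OF z] _ x])
      fix g assume g: "g \<in> G"
      then show "osum E (h y (cls g)) (h y' (cls g)) = Some (h z (cls g))"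
        using ea_additive_sum[OF right[OF g] y(3,1,2)] h(2) y z by simp
    qed
  qed
  then have "ea_biadditive P Y E (\<lambda>x y. h y x)" using h(1) unfolding ea_biadditive_def by blast
  then show ?thesis using h(2) by blast
qed

end


section \<open>Boolean algebras as idempotent effect monoids\<close>

context
  fixes E :: "'a ea" and p :: "'a \<Rightarrow> 'a \<Rightarrow> 'a"
  assumes E: "effect_algebra E" and p: "ea_biadditive E E E p"
    and comm: "\<And>x y. x \<in> ecarrier E \<Longrightarrow> y \<in> ecarrier E \<Longrightarrow> p x y = p y x"
    and unit: "\<And>x. x \<in> ecarrier E \<Longrightarrow> p x (eone E) = x"
begin

lemma mult_closed: "x \<in> ecarrier E \<Longrightarrow> y \<in> ecarrier E \<Longrightarrow> p x y \<in> ecarrier E"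
  using ea_additive_closed ea_biadditive_right[OF p] by metis

lemma mult_sum:
  assumes "x \<in> ecarrier E" "a \<in> ecarrier E" "b \<in> ecarrier E" "osum E a b = Some c"
  shows "osum E (p x a) (p x b) = Some (p x c)"
  using ea_additive_sum[OF ea_biadditive_right[OF p]] assms by blast

lemma sum_zero: "x \<in> ecarrier E \<Longrightarrow> osum E x (ezero E) = Some x"
  using ea_zero_left[OF E] ea_comm[OF E] ea_zero[OF E] by metis

lemma sum_eq_zero:
  assumes "x \<in> ecarrier E" "y \<in> ecarrier E" "osum E x y = Some (ezero E)"
  shows "x = ezero E"
  using tsum_eq_zero[OF E, of "Some x" "Some y"] tsum_Some[OF E assms(1,2)] assms(3) by simp

text \<open>Write \<open>x \<cdot> y\<close> for \<open>p x y\<close>. If \<open>r\<close> completes \<open>x \<oplus> y\<close> to \<open>1\<close>, then \<open>x = x \<cdot> 1 = x \<oplus> x \<cdot> (y \<oplus> r)\<close>, so \<open>x \<cdot> y\<close> is a summand of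
  zero.\<close>

lemma mult_orthogonal:
  assumes x: "x \<in> ecarrier E" and y: "y \<in> ecarrier E" and s: "osum E x y = Some s"
    and idem: "p x x = x"
  shows "p x y = ezero E"
proof -
  have sC: "s \<in> ecarrier E" by (rule ea_closed[OF E x y s])
  obtain r where r: "r \<in> ecarrier E" "osum E s r = Some (eone E)" using ea_compl[OF E sC] by blast
  obtain d where d: "osum E y r = Some d" "osum E x d = Some (eone E)"
    using ea_assoc[OF E x y r(1)] s r(2) by (cases "osum E y r") auto
  have dC: "d \<in> ecarrier E" by (rule ea_closed[OF E y r(1) d(1)])
  have "osum E x (p x d) = Some x"
    using mult_sum[OF x x dC d(2)] idem unit[OF x] by simp
  then have "p x d = ezero E"
    using ea_cancel[OF E _ sum_zero[OF x]] x mult_closed[OF x dC] ea_zero[OF E] by blast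
  then have "osum E (p x y) (p x r) = Some (ezero E)" using mult_sum[OF x y r(1) d(1)] by simp
  then show ?thesis using sum_eq_zero mult_closed x y r(1) by blast
qed

lemma idempotent_sum:
  assumes x: "x \<in> ecarrier E" and y: "y \<in> ecarrier E" and s: "osum E x y = Some s"
    and idem: "p x x = x" "p y y = y"
  shows "p s s = s"
proof -
  have sC: "s \<in> ecarrier E" by (rule ea_closed[OF E x y s])
  have xy: "p x y = ezero E" by (rule mult_orthogonal[OF x y s idem(1)])
  have "p x s = x" using mult_sum[OF x x y s] xy idem(1) sum_zero[OF x] by simp
  moreover have "p y s = y"
    using mult_sum[OF y x y s] xy comm[OF x y] idem(2) ea_zero_left[OF E y] by simp
  ultimately show ?thesis using mult_sum[OF sC x y s] comm[OF sC] x y s by simp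
qed

text \<open>The multiplication becomes the meet, and the join is defined by De Morgan duality. Everything rests
  on the decomposition \<open>y = x \<cdot> y \<oplus> x' \<cdot> y\<close>: it gives \<open>x \<or> y = x \<oplus> x' \<cdot> y\<close>, from which distributivity
  follows by additivity of the multiplication, and it shows that \<open>x \<oplus> y\<close> is defined and equal to
  \<open>x \<or> y\<close> when \<open>x \<cdot> y = 0\<close>.\<close>

lemma idempotent_effect_monoid_boolean:
  assumes assoc: "\<And>x y z. x \<in> ecarrier E \<Longrightarrow> y \<in> ecarrier E \<Longrightarrow> z \<in> ecarrier E \<Longrightarrow> p (p x y) z = p x (p y z)"
    and idem: "\<And>x. x \<in> ecarrier E \<Longrightarrow> p x x = x"
  shows "\<exists>j c. arises_from_boolean E p j c"
proof -
  let ?A = "ecarrier E" and ?z = "ezero E" and ?e = "eone E"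
  note z = ea_zero[OF E] and e = ea_one[OF E] and cl = mult_closed
  obtain c where c: "\<And>x. x \<in> ?A \<Longrightarrow> c x \<in> ?A" "\<And>x. x \<in> ?A \<Longrightarrow> osum E x (c x) = Some ?e"
    using ea_compl[OF E] by metis
  have cu: "y = c x" if "x \<in> ?A" "y \<in> ?A" "osum E x y = Some ?e" for x y
    using ea_compl[OF E that(1)] c that by blast
  have cc: "c (c x) = x" if "x \<in> ?A" for x
    using cu[OF c(1)[OF that] that] ea_comm[OF E that c(1)[OF that]] c(2)[OF that] by simp
  have cz: "c ?z = ?e" and ce: "c ?e = ?z"
    using cu[OF z e ea_zero_left[OF E e]] cu[OF e z sum_zero[OF e]] by simp_all
  have split: "osum E (p x y) (p x (c y)) = Some x" if "x \<in> ?A" "y \<in> ?A" for x y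
    using mult_sum[OF that(1) that(2) c(1)[OF that(2)] c(2)[OF that(2)]] unit[OF that(1)] by simp
  have xc: "p x (c x) = ?z" if "x \<in> ?A" for x
    by (rule mult_orthogonal[OF that c(1)[OF that] c(2)[OF that] idem[OF that]])
  define j where "j x y = c (p (c x) (c y))" for x y
  have jC: "j x y \<in> ?A" if "x \<in> ?A" "y \<in> ?A" for x y
    unfolding j_def using c(1) cl that by blast
  have jsum: "osum E x (p (c x) y) = Some (j x y)" if x: "x \<in> ?A" and y: "y \<in> ?A" for x y
  proof -
    note cx = c(1)[OF x] and cy = c(1)[OF y]
    note A = cl[OF cx y] and B = cl[OF cx cy]
    obtain d where d: "osum E x (p (c x) y) = Some d" "osum E d (p (c x) (c y)) = Some ?e"
      using ea_assoc[OF E x A B] split[OF cx y] c(2)[OF x]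
      by (cases "osum E x (p (c x) y)") auto
    have dC: "d \<in> ?A" by (rule ea_closed[OF E x A d(1)])
    have "p (c x) (c y) = c d" by (rule cu[OF dC B d(2)])
    then show ?thesis using d(1) cc[OF dC] unfolding j_def by simp
  qed
  have sum: "osum E x y = (if p x y = ?z then Some (j x y) else None)" if x: "x \<in> ?A" and y: "y \<in> ?A" for x y
  proof (cases "p x y = ?z")
    case True
    have "osum E ?z (p y (c x)) = Some y" using split[OF y x] comm[OF x y] True by simp
    then have "p (c x) y = y" using ea_zero_left[OF E cl[OF y c(1)[OF x]]] comm[OF y c(1)[OF x]] by simp
    then show ?thesis using jsum[OF x y] True by simp
  next
    case False
    then show ?thesis using mult_orthogonal[OF x y _ idem[OF x]] by (cases "osum E x y") auto
  qed
  have cj: "c (j x y) = p (c x) (c y)" if "x \<in> ?A" "y \<in> ?A" for x y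
    unfolding j_def using cc cl c(1) that by blast
  have cp: "c (p x y) = j (c x) (c y)" if "x \<in> ?A" "y \<in> ?A" for x y
    unfolding j_def using cc that by simp
  have dist: "p x (j y w) = j (p x y) (p x w)" if x: "x \<in> ?A" and y: "y \<in> ?A" and w: "w \<in> ?A" for x y w
  proof -
    note xy = cl[OF x y] and xw = cl[OF x w] and cy = c(1)[OF y]
    note cxy = c(1)[OF xy]
    \<comment> \<open>both \<open>x \<cdot> (x \<cdot> y)'\<close> and \<open>x \<cdot> y'\<close> complete \<open>x \<cdot> y\<close> to \<open>x\<close>\<close>
    have "osum E (p x y) (p x (c (p x y))) = Some x"
      using split[OF x xy] assoc[OF x x y] idem[OF x] by simp
    then have 1: "p x (c (p x y)) = p x (c y)"
      using ea_cancel[OF E _ split[OF x y] xy] cl x cxy cy by blast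
    have "p (c (p x y)) (p x w) = p (p x (c (p x y))) w"
      using assoc[OF cxy x w] comm[OF x cxy] by simp
    then have 2: "p (c (p x y)) (p x w) = p x (p (c y) w)" using 1 assoc[OF x cy w] by simp
    show ?thesis
      using mult_sum[OF x y cl[OF cy w] jsum[OF y w]] jsum[OF xy xw] 2 by simp
  qed
  have "boolean_algebra_on ?A p j c ?z ?e"
    unfolding boolean_algebra_on_def
  proof (intro conjI ballI)
    fix x assume x: "x \<in> ?A"
    note cx = c(1)[OF x]
    show "j x ?z = x" unfolding j_def using cz unit[OF cx] cc[OF x] by simp
    show "j x (c x) = ?e" unfolding j_def using xc[OF cx] cz by simp
  next
    fix x y assume x: "x \<in> ?A" and y: "y \<in> ?A"
    show "j x y = j y x" unfolding j_def using comm c(1) x y by simp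
  next
    fix x y w assume A: "x \<in> ?A" "y \<in> ?A" "w \<in> ?A"
    note C = c(1)[OF A(1)] c(1)[OF A(2)] c(1)[OF A(3)]
    show "j (j x y) w = j x (j y w)"
      unfolding j_def[of "j x y"] j_def[of x "j y w"] using cj A assoc C by simp
    have "c (p (j x y) (j x w)) = j (p (c x) (c y)) (p (c x) (c w))"
      using cp[OF jC jC] cj A by simp
    also have "\<dots> = p (c x) (c (p y w))" using dist[OF C] cp A by simp
    finally have "c (c (p (j x y) (j x w))) = j x (p y w)" unfolding j_def[of x "p y w"] by simp
    then show "j x (p y w) = p (j x y) (j x w)" using cc cl jC A by simp
  qed (use z e c cl unit xc comm assoc dist jC in auto)
  then show ?thesis unfolding arises_from_boolean_def using sum by blast
qed

end

context sum_presentation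
begin

text \<open>A multiplication of the generators that preserves the relations extends to a biadditive
  multiplication of the presented algebra. The equational laws carry over from generators one variable
  at a time; idempotence is not additive and is carried over by induction on the number of
  summands.\<close>

lemma boolean:
  assumes closed: "\<And>g h. g \<in> G \<Longrightarrow> h \<in> G \<Longrightarrow> f g h \<in> G"
    and assoc: "\<And>g h k. g \<in> G \<Longrightarrow> h \<in> G \<Longrightarrow> k \<in> G \<Longrightarrow> f (f g h) k = f g (f h k)"
    and comm: "\<And>g h. g \<in> G \<Longrightarrow> h \<in> G \<Longrightarrow> f g h = f h g"
    and idem: "\<And>g. g \<in> G \<Longrightarrow> f g g = g" and unit: "\<And>g. g \<in> G \<Longrightarrow> f g u = g"
    and stable: "\<And>g a b c. g \<in> G \<Longrightarrow> (a, b, c) \<in> S \<Longrightarrow> (f g a, f g b, f g c) \<in> S"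
  shows "\<exists>M J C. arises_from_boolean P M J C \<and> (\<forall>g\<in>G. \<forall>h\<in>G. M (cls g) (cls h) = cls (f g h))"
proof -
  note E = algebra
  have "\<exists>l. ea_additive P P l \<and> (\<forall>h\<in>G. l (cls h) = cls (f g h))" if "g \<in> G" for g
    by (rule lift[OF algebra]) (use that closed cls_closed stable cls_sum in blast)+
  then obtain l where l: "\<And>g. g \<in> G \<Longrightarrow> ea_additive P P (l g)"
    "\<And>g h. g \<in> G \<Longrightarrow> h \<in> G \<Longrightarrow> l g (cls h) = cls (f g h)" by metis
  have "\<exists>B. ea_biadditive P P P B \<and> (\<forall>g\<in>G. \<forall>y\<in>ecarrier P. B (cls g) y = l g y)"
  proof (rule lift_parametrized[OF E E _ l(1)])
    fix a b c y assume S: "(a, b, c) \<in> S" and y: "y \<in> ecarrier P"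
    then have G: "a \<in> G" "b \<in> G" "c \<in> G" using SG by auto
    show "osum P (l a y) (l b y) = Some (l c y)"
    proof (rule additive_sumI[OF E l(1)[OF G(1)] l(1)[OF G(2)] l(1)[OF G(3)] _ y])
      fix g assume g: "g \<in> G"
      show "osum P (l a (cls g)) (l b (cls g)) = Some (l c (cls g))"
        using cls_sum[OF stable[OF g S]] l(2) g G comm by simp
    qed
  qed
  then obtain B where B: "ea_biadditive P P P B"
    and "\<And>g y. g \<in> G \<Longrightarrow> y \<in> ecarrier P \<Longrightarrow> B (cls g) y = l g y" by blast
  then have Bc: "B (cls g) (cls h) = cls (f g h)" if "g \<in> G" "h \<in> G" for g h
    using l(2) that cls_closed by simp
  note L = ea_biadditive_left[OF B] and Rt = ea_biadditive_right[OF B]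
  have BC: "B x y \<in> ecarrier P" if "x \<in> ecarrier P" "y \<in> ecarrier P" for x y
    using ea_additive_closed[OF Rt] that by blast
  have Bcomm: "B x y = B y x" if x: "x \<in> ecarrier P" and y: "y \<in> ecarrier P" for x y
  proof (rule additive_eqI[OF E L[OF y] Rt[OF y] _ x])
    fix g assume g: "g \<in> G"
    note gc = cls_closed[OF g]
    show "B (cls g) y = B y (cls g)"
      by (rule additive_eqI[OF E Rt[OF gc] L[OF gc] _ y]) (use g Bc comm in simp)
  qed
  have Bunit: "B x (eone P) = x" if x: "x \<in> ecarrier P" for x
  proof (rule additive_eqI[OF E L _ _ x])
    show "ea_additive P P (\<lambda>x. x)" unfolding ea_additive_def by blast
    show "B (cls g) (eone P) = cls g" if "g \<in> G" for g
      using Bc[OF that uG] unit[OF that] cls_unit by simp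
  qed (rule ea_one[OF E])
  have Bassoc: "B (B x y) z = B x (B y z)"
    if x: "x \<in> ecarrier P" and y: "y \<in> ecarrier P" and z: "z \<in> ecarrier P" for x y z
  proof (rule additive_eqI[OF E ea_additive_comp[OF L[OF y] L[OF z]] L[OF BC[OF y z]] _ x])
    fix g assume g: "g \<in> G"
    note gc = cls_closed[OF g]
    show "B (B (cls g) y) z = B (cls g) (B y z)"
    proof (rule additive_eqI[OF E ea_additive_comp[OF Rt[OF gc] L[OF z]] ea_additive_comp[OF L[OF z] Rt[OF gc]] _ y])
      fix h assume h: "h \<in> G"
      note hc = cls_closed[OF h]
      show "B (B (cls g) (cls h)) z = B (cls g) (B (cls h) z)"
        by (rule additive_eqI[OF E Rt[OF BC[OF gc hc]] ea_additive_comp[OF Rt[OF hc] Rt[OF gc]] _ z])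
          (use g h Bc closed assoc in simp)
    qed
  qed
  have Bidem: "B x x = x" if x: "x \<in> ecarrier P" for x
  proof -
    have "set_mset m \<subseteq> G \<Longrightarrow> msum P cls m = Some x \<Longrightarrow> B x x = x" for m x
    proof (induction m arbitrary: x)
      case empty
      then show ?case using ea_additive_zero[OF E E Rt[OF ea_zero[OF E]]] by (simp add: msum_empty[OF E])
    next
      case (add g m)
      obtain y where y: "msum P cls m = Some y" "cls g \<in> ecarrier P" "y \<in> ecarrier P" "osum P (cls g) y = Some x"
        using add.prems unfolding msum_add_mset[OF E] by (auto elim: tsum_SomeE[OF E])
      show ?case
        by (rule idempotent_sum[OF E B Bcomm Bunit y(2-4)]) (use add y Bc idem in auto)
    qed
    then show ?thesis using span[OF x] by metis
  qed
  show ?thesis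
    using idempotent_effect_monoid_boolean[OF E B Bcomm Bunit Bassoc Bidem] Bc by blast
qed

end

section \<open>Tensor products of two effect algebras\<close>

definition tensor_sums :: "'a ea \<Rightarrow> 'b ea \<Rightarrow> (('a \<times> 'b) \<times> ('a \<times> 'b) \<times> ('a \<times> 'b)) set" where
  "tensor_sums E F =
     {((a, b), (a', b), (c, b)) | a a' c b.
        a \<in> ecarrier E \<and> a' \<in> ecarrier E \<and> c \<in> ecarrier E \<and> b \<in> ecarrier F \<and> osum E a a' = Some c} \<union>
     {((a, b), (a, b'), (a, c)) | a b b' c.
        a \<in> ecarrier E \<and> b \<in> ecarrier F \<and> b' \<in> ecarrier F \<and> c \<in> ecarrier F \<and> osum F b b' = Some c}"

lemma tensor_sumsE:
  assumes "(x, y, z) \<in> tensor_sums E F"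
  obtains (left) a a' c b where "x = (a, b)" "y = (a', b)" "z = (c, b)" "a \<in> ecarrier E"
      "a' \<in> ecarrier E" "c \<in> ecarrier E" "b \<in> ecarrier F" "osum E a a' = Some c"
    | (right) a b b' c where "x = (a, b)" "y = (a, b')" "z = (a, c)" "a \<in> ecarrier E"
      "b \<in> ecarrier F" "b' \<in> ecarrier F" "c \<in> ecarrier F" "osum F b b' = Some c"
  using assms unfolding tensor_sums_def by blast

lemma tensor_rels_eq: "tensor_rels E F = sum_rels (tensor_sums E F)"
  unfolding tensor_rels_def sum_rels_def tensor_sums_def by (intro set_eqI iffI; auto; blast)

lemma tensor_presentation:
  assumes "effect_algebra E" "effect_algebra F"
  shows "sum_presentation (ecarrier E \<times> ecarrier F) (eone E, eone F) (tensor_sums E F)"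
proof
  show "tensor_sums E F \<subseteq> (ecarrier E \<times> ecarrier F) \<times> (ecarrier E \<times> ecarrier F) \<times> (ecarrier E \<times> ecarrier F)"
    unfolding tensor_sums_def by auto
qed (use tensor_generators[OF assms, unfolded tensor_rels_eq] in auto)

lemma tensor_eq:
  "E \<otimes> F = presented (ecarrier E \<times> ecarrier F) (eone E, eone F) (sum_rels (tensor_sums E F))"
  unfolding tensor_def tensor_rels_eq ..

lemma ptens_eq:
  "ptens E F a b =
    pres_class (ecarrier E \<times> ecarrier F) (eone E, eone F) (sum_rels (tensor_sums E F)) {#(a, b)#}"
  unfolding ptens_def tensor_rels_eq ..

lemma ptens_biadditive:
  "effect_algebra E \<Longrightarrow> effect_algebra F \<Longrightarrow> ea_biadditive E F (E \<otimes> F) (ptens E F)"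
  using bimorphism_ptens bimorphism_iff by blast

lemma ptens_one:
  "effect_algebra E \<Longrightarrow> effect_algebra F \<Longrightarrow> ptens E F (eone E) (eone F) = eone (E \<otimes> F)"
  using bimorphism_ptens bimorphism_iff by blast

lemma ptens_closed:
  "effect_algebra E \<Longrightarrow> effect_algebra F \<Longrightarrow> a \<in> ecarrier E \<Longrightarrow> b \<in> ecarrier F \<Longrightarrow>
    ptens E F a b \<in> ecarrier (E \<otimes> F)"
  using ea_additive_closed[OF ea_biadditive_left[OF ptens_biadditive]] .

lemma tensor_additive_eqI:
  assumes E: "effect_algebra E" and F: "effect_algebra F" and H: "effect_algebra H"
    and f: "ea_additive (E \<otimes> F) H f" and g: "ea_additive (E \<otimes> F) H g"
    and eq: "\<And>a b. a \<in> ecarrier E \<Longrightarrow> b \<in> ecarrier F \<Longrightarrow> f (ptens E F a b) = g (ptens E F a b)"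
    and x: "x \<in> ecarrier (E \<otimes> F)"
  shows "f x = g x"
  by (rule sum_presentation.additive_eqI[OF tensor_presentation[OF E F] H
        f[unfolded tensor_eq] g[unfolded tensor_eq] _ x[unfolded tensor_eq]])
    (use eq in \<open>auto simp: ptens_eq\<close>)

lemma tensor_hom_eqI:
  assumes E: "effect_algebra E" and F: "effect_algebra F" and H: "effect_algebra H"
    and f: "f \<in> ea_hom (E \<otimes> F) H" and g: "g \<in> ea_hom (E \<otimes> F) H"
    and eq: "\<And>a b. a \<in> ecarrier E \<Longrightarrow> b \<in> ecarrier F \<Longrightarrow> f (ptens E F a b) = g (ptens E F a b)"
  shows "f = g"
  by (rule ea_hom_eqI[OF f g])
    (rule tensor_additive_eqI[OF E F H ea_hom_additive[OF f] ea_hom_additive[OF g] eq])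

lemma tensor_additive_lift:
  assumes E: "effect_algebra E" and F: "effect_algebra F" and H: "effect_algebra H"
    and \<beta>: "ea_biadditive E F H \<beta>"
  shows "\<exists>h. ea_additive (E \<otimes> F) H h \<and> (\<forall>a\<in>ecarrier E. \<forall>b\<in>ecarrier F. h (ptens E F a b) = \<beta> a b)"
proof -
  note L = ea_biadditive_left[OF \<beta>] and R = ea_biadditive_right[OF \<beta>]
  have "\<exists>h. ea_additive (E \<otimes> F) H h \<and> (\<forall>g\<in>ecarrier E \<times> ecarrier F.
      h (pres_class (ecarrier E \<times> ecarrier F) (eone E, eone F) (sum_rels (tensor_sums E F)) {#g#}) =
      (case g of (a, b) \<Rightarrow> \<beta> a b))"
    unfolding tensor_eq
  proof (rule sum_presentation.lift[OF tensor_presentation[OF E F] H])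
    show "(case g of (a, b) \<Rightarrow> \<beta> a b) \<in> ecarrier H" if "g \<in> ecarrier E \<times> ecarrier F" for g
      using that ea_additive_closed[OF R] by auto
    fix x y z assume "(x, y, z) \<in> tensor_sums E F"
    then show "osum H (case x of (a, b) \<Rightarrow> \<beta> a b) (case y of (a, b) \<Rightarrow> \<beta> a b) =
        Some (case z of (a, b) \<Rightarrow> \<beta> a b)"
      by (cases rule: tensor_sumsE) (use ea_additive_sum[OF L] ea_additive_sum[OF R] in auto)
  qed
  then show ?thesis unfolding ptens_eq by auto
qed

text \<open>The tool for extending maps of three and four variables from pure tensors, as the associativity
  and interchange maps require.\<close>

lemma tensor_lift_parametrized:
  assumes E: "effect_algebra E" and F: "effect_algebra F" and Y: "effect_algebra Y" and H: "effect_algebra H"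
    and \<beta>: "\<And>y. y \<in> ecarrier Y \<Longrightarrow> ea_biadditive E F H (\<lambda>a b. \<beta> a b y)"
    and R: "\<And>a b. a \<in> ecarrier E \<Longrightarrow> b \<in> ecarrier F \<Longrightarrow> ea_additive Y H (\<beta> a b)"
  shows "\<exists>B. ea_biadditive (E \<otimes> F) Y H B \<and>
    (\<forall>a\<in>ecarrier E. \<forall>b\<in>ecarrier F. \<forall>y\<in>ecarrier Y. B (ptens E F a b) y = \<beta> a b y)"
proof -
  have "\<exists>B. ea_biadditive (E \<otimes> F) Y H B \<and> (\<forall>g\<in>ecarrier E \<times> ecarrier F. \<forall>y\<in>ecarrier Y.
      B (pres_class (ecarrier E \<times> ecarrier F) (eone E, eone F) (sum_rels (tensor_sums E F)) {#g#}) y =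
      \<beta> (fst g) (snd g) y)"
    unfolding tensor_eq
  proof (rule sum_presentation.lift_parametrized[OF tensor_presentation[OF E F] H Y])
    show "ea_additive Y H (\<beta> (fst g) (snd g))" if "g \<in> ecarrier E \<times> ecarrier F" for g
      using that R by auto
    fix x y z w assume h: "(x, y, z) \<in> tensor_sums E F" "w \<in> ecarrier Y"
    note L1 = ea_additive_sum[OF ea_biadditive_left[OF \<beta>[OF h(2)]]]
      and L2 = ea_additive_sum[OF ea_biadditive_right[OF \<beta>[OF h(2)]]]
    from h(1) show "osum H (\<beta> (fst x) (snd x) w) (\<beta> (fst y) (snd y) w) = Some (\<beta> (fst z) (snd z) w)"
      by (cases rule: tensor_sumsE) (use L1 L2 in auto)
  qed
  then show ?thesis unfolding ptens_eq by auto
qed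

lemma tensor_lift_hom:
  assumes "effect_algebra E" "effect_algebra F" "effect_algebra H" "bimorphism E F H \<beta>"
  shows "tensor_lift E F H \<beta> \<in> ea_hom (E \<otimes> F) H"
    and "a \<in> ecarrier E \<Longrightarrow> b \<in> ecarrier F \<Longrightarrow> tensor_lift E F H \<beta> (ptens E F a b) = \<beta> a b"
  using theI'[OF tensor_universal[OF assms]] unfolding tensor_lift_def by blast+

lemma tensor_map_hom:
  assumes E: "effect_algebra E" and F: "effect_algebra F" and E': "effect_algebra E'" and F': "effect_algebra F'"
    and f: "f \<in> ea_hom E E'" and g: "g \<in> ea_hom F F'"
  shows "tensor_map E F E' F' f g \<in> ea_hom (E \<otimes> F) (E' \<otimes> F')"
    and "a \<in> ecarrier E \<Longrightarrow> b \<in> ecarrier F \<Longrightarrow>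
      tensor_map E F E' F' f g (ptens E F a b) = ptens E' F' (f a) (g b)"
proof -
  note p = ptens_biadditive[OF E' F']
  have "ea_biadditive E F (E' \<otimes> F') (\<lambda>a b. ptens E' F' (f a) (g b))"
    unfolding ea_biadditive_def
    using ea_additive_comp[OF ea_hom_additive[OF f] ea_biadditive_left[OF p ea_hom_closed[OF g]]]
      ea_additive_comp[OF ea_hom_additive[OF g] ea_biadditive_right[OF p ea_hom_closed[OF f]]] by blast
  then have "bimorphism E F (E' \<otimes> F') (\<lambda>a b. ptens E' F' (f a) (g b))"
    unfolding bimorphism_iff using ea_hom_one[OF f] ea_hom_one[OF g] ptens_one[OF E' F'] by simp
  note l = tensor_lift_hom[OF E F tensor_effect_algebra[OF E' F'] this]
  show "tensor_map E F E' F' f g \<in> ea_hom (E \<otimes> F) (E' \<otimes> F')"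
    and "a \<in> ecarrier E \<Longrightarrow> b \<in> ecarrier F \<Longrightarrow>
      tensor_map E F E' F' f g (ptens E F a b) = ptens E' F' (f a) (g b)"
    unfolding tensor_map_def using l by blast+
qed

lemma bimorphism_hom:
  assumes E: "effect_algebra E" and F: "effect_algebra F" and H: "effect_algebra H"
    and B: "ea_biadditive E F H \<beta>" "\<beta> (eone E) (eone F) = eone H"
  shows "\<exists>h\<in>ea_hom (E \<otimes> F) H. \<forall>a\<in>ecarrier E. \<forall>b\<in>ecarrier F. h (ptens E F a b) = \<beta> a b"
  using tensor_lift_hom[OF E F H] B bimorphism_iff by blast

text \<open>The map exists because \<open>(a \<otimes> b) \<otimes> c\<close> is additive in each of \<open>a\<close>, \<open>b\<close>, \<open>c\<close>: for fixed \<open>a\<close> it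
  extends to \<open>F \<otimes> H\<close>, and the result is biadditive.\<close>

lemma tensor_assoc_hom:
  assumes E: "effect_algebra E" and F: "effect_algebra F" and H: "effect_algebra H"
  shows "tensor_assoc E F H \<in> ea_hom (E \<otimes> (F \<otimes> H)) ((E \<otimes> F) \<otimes> H)"
    and "a \<in> ecarrier E \<Longrightarrow> b \<in> ecarrier F \<Longrightarrow> c \<in> ecarrier H \<Longrightarrow>
      tensor_assoc E F H (ptens E (F \<otimes> H) a (ptens F H b c)) = ptens (E \<otimes> F) H (ptens E F a b) c"
proof -
  note FH = tensor_effect_algebra[OF F H] and EF = tensor_effect_algebra[OF E F]
  note T = tensor_effect_algebra[OF EF H]
  note p = ptens_biadditive[OF E F] and q = ptens_biadditive[OF EF H]
  let ?T = "(E \<otimes> F) \<otimes> H"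
  let ?\<beta> = "\<lambda>b c a. ptens (E \<otimes> F) H (ptens E F a b) c"
  note pc = ptens_closed[OF E F]
  have "\<exists>B. ea_biadditive (F \<otimes> H) E ?T B \<and>
    (\<forall>b\<in>ecarrier F. \<forall>c\<in>ecarrier H. \<forall>a\<in>ecarrier E. B (ptens F H b c) a = ?\<beta> b c a)"
  proof (rule tensor_lift_parametrized[OF F H E T])
    fix a assume a: "a \<in> ecarrier E"
    show "ea_biadditive F H ?T (\<lambda>b c. ?\<beta> b c a)"
      unfolding ea_biadditive_def
      using ea_additive_comp[OF ea_biadditive_right[OF p a] ea_biadditive_left[OF q]]
        ea_biadditive_right[OF q pc[OF a]] by blast
  next
    fix b c assume "b \<in> ecarrier F" "c \<in> ecarrier H"
    then show "ea_additive E ?T (?\<beta> b c)"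
      using ea_additive_comp[OF ea_biadditive_left[OF p] ea_biadditive_left[OF q]] by blast
  qed
  then obtain B where B: "ea_biadditive (F \<otimes> H) E ?T B"
    "\<And>a b c. a \<in> ecarrier E \<Longrightarrow> b \<in> ecarrier F \<Longrightarrow> c \<in> ecarrier H \<Longrightarrow> B (ptens F H b c) a = ?\<beta> b c a"
    by blast
  have "ea_biadditive E (F \<otimes> H) ?T (\<lambda>a x. B x a)" using B(1) unfolding ea_biadditive_def by blast
  moreover have "B (eone (F \<otimes> H)) (eone E) = eone ?T"
    using B(2)[OF ea_one[OF E] ea_one[OF F] ea_one[OF H]] ptens_one[OF F H] ptens_one[OF E F]
      ptens_one[OF EF H] by simp
  ultimately obtain h where h: "h \<in> ea_hom (E \<otimes> (F \<otimes> H)) ?T"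
    "\<And>a x. a \<in> ecarrier E \<Longrightarrow> x \<in> ecarrier (F \<otimes> H) \<Longrightarrow> h (ptens E (F \<otimes> H) a x) = B x a"
    using bimorphism_hom[OF E FH T, of "\<lambda>a x. B x a"] by blast
  let ?Q = "\<lambda>h. h \<in> ea_hom (E \<otimes> (F \<otimes> H)) ?T \<and>
     (\<forall>a\<in>ecarrier E. \<forall>b\<in>ecarrier F. \<forall>c\<in>ecarrier H.
        h (ptens E (F \<otimes> H) a (ptens F H b c)) = ptens (E \<otimes> F) H (ptens E F a b) c)"
  have hQ: "?Q h" using h B(2) ptens_closed[OF F H] by simp
  have uniq: "k = h" if k: "?Q k" for k
  proof (rule tensor_hom_eqI[OF E FH T])
    fix a x assume a: "a \<in> ecarrier E" and x: "x \<in> ecarrier (F \<otimes> H)"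
    have ad: "ea_additive (F \<otimes> H) ?T (\<lambda>x. f (ptens E (F \<otimes> H) a x))" if "?Q f" for f
      using ea_additive_comp[OF ea_biadditive_right[OF ptens_biadditive[OF E FH] a] ea_hom_additive] that by blast
    show "k (ptens E (F \<otimes> H) a x) = h (ptens E (F \<otimes> H) a x)"
      by (rule tensor_additive_eqI[OF F H T ad[OF k] ad[OF hQ] _ x]) (use k hQ a in simp)
  qed (use k hQ in blast)+
  have "?Q (tensor_assoc E F H)"
    unfolding tensor_assoc_def by (rule theI[of ?Q, OF hQ uniq])
  then show "tensor_assoc E F H \<in> ea_hom (E \<otimes> (F \<otimes> H)) ((E \<otimes> F) \<otimes> H)"
    and "a \<in> ecarrier E \<Longrightarrow> b \<in> ecarrier F \<Longrightarrow> c \<in> ecarrier H \<Longrightarrow>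
      tensor_assoc E F H (ptens E (F \<otimes> H) a (ptens F H b c)) = ptens (E \<otimes> F) H (ptens E F a b) c"
    by blast+
qed

text \<open>Two extensions are needed: for fixed \<open>a\<close>, \<open>b\<close> the pure tensor extends to \<open>E' \<otimes> F'\<close>; the extension
  is additive in \<open>a\<close> and in \<open>b\<close>, as this can be tested on pure tensors, and so extends to \<open>E \<otimes> F\<close>.\<close>

lemma tensor_interchange_hom:
  assumes E: "effect_algebra E" and F: "effect_algebra F" and E': "effect_algebra E'" and F': "effect_algebra F'"
  shows "tensor_interchange E F E' F' \<in> ea_hom ((E \<otimes> F) \<otimes> (E' \<otimes> F')) ((E \<otimes> E') \<otimes> (F \<otimes> F'))"
    and "a \<in> ecarrier E \<Longrightarrow> b \<in> ecarrier F \<Longrightarrow> a' \<in> ecarrier E' \<Longrightarrow> b' \<in> ecarrier F' \<Longrightarrow>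
      tensor_interchange E F E' F' (ptens (E \<otimes> F) (E' \<otimes> F') (ptens E F a b) (ptens E' F' a' b')) =
        ptens (E \<otimes> E') (F \<otimes> F') (ptens E E' a a') (ptens F F' b b')"
proof -
  let ?A = "E \<otimes> F" and ?A' = "E' \<otimes> F'" and ?C = "E \<otimes> E'" and ?D = "F \<otimes> F'"
  let ?T = "?C \<otimes> ?D"
  note A = tensor_effect_algebra[OF E F] and A' = tensor_effect_algebra[OF E' F']
  note C = tensor_effect_algebra[OF E E'] and D = tensor_effect_algebra[OF F F']
  note T = tensor_effect_algebra[OF C D]
  note p = ptens_biadditive[OF E E'] and q = ptens_biadditive[OF F F'] and r = ptens_biadditive[OF C D]
  note pc = ptens_closed[OF E E'] and qc = ptens_closed[OF F F']
  let ?t = "\<lambda>a b a' b'. ptens ?C ?D (ptens E E' a a') (ptens F F' b b')"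
  have t1: "ea_additive E ?T (\<lambda>a. ?t a b a' b')"
    if "b \<in> ecarrier F" "a' \<in> ecarrier E'" "b' \<in> ecarrier F'" for b a' b'
    using that ea_additive_comp[OF ea_biadditive_left[OF p] ea_biadditive_left[OF r]] qc by blast
  have t2: "ea_additive F ?T (\<lambda>b. ?t a b a' b')"
    if "a \<in> ecarrier E" "a' \<in> ecarrier E'" "b' \<in> ecarrier F'" for a a' b'
    using that ea_additive_comp[OF ea_biadditive_left[OF q] ea_biadditive_right[OF r]] pc by blast
  have t3: "ea_additive E' ?T (\<lambda>a'. ?t a b a' b')"
    if "a \<in> ecarrier E" "b \<in> ecarrier F" "b' \<in> ecarrier F'" for a b b'
    using that ea_additive_comp[OF ea_biadditive_right[OF p] ea_biadditive_left[OF r]] qc by blast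
  have t4: "ea_additive F' ?T (\<lambda>b'. ?t a b a' b')"
    if "a \<in> ecarrier E" "b \<in> ecarrier F" "a' \<in> ecarrier E'" for a b a'
    using that ea_additive_comp[OF ea_biadditive_right[OF q] ea_biadditive_right[OF r]] pc by blast
  have "\<exists>h. ea_additive ?A' ?T h \<and> (\<forall>a'\<in>ecarrier E'. \<forall>b'\<in>ecarrier F'. h (ptens E' F' a' b') = ?t a b a' b')"
    if ab: "a \<in> ecarrier E" "b \<in> ecarrier F" for a b
    by (rule tensor_additive_lift[OF E' F' T]) (simp add: ea_biadditive_def t3[OF ab] t4[OF ab])
  then obtain l where l: "\<And>a b. a \<in> ecarrier E \<Longrightarrow> b \<in> ecarrier F \<Longrightarrow> ea_additive ?A' ?T (l a b)"
    "\<And>a b a' b'. a \<in> ecarrier E \<Longrightarrow> b \<in> ecarrier F \<Longrightarrow> a' \<in> ecarrier E' \<Longrightarrow> b' \<in> ecarrier F' \<Longrightarrow>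
      l a b (ptens E' F' a' b') = ?t a b a' b'" by metis
  have sumI: "osum ?T (f x) (g x) = Some (h x)"
    if "ea_additive ?A' ?T f" "ea_additive ?A' ?T g" "ea_additive ?A' ?T h" "x \<in> ecarrier ?A'"
      "\<And>a' b'. a' \<in> ecarrier E' \<Longrightarrow> b' \<in> ecarrier F' \<Longrightarrow>
        osum ?T (f (ptens E' F' a' b')) (g (ptens E' F' a' b')) = Some (h (ptens E' F' a' b'))" for f g h x
    by (rule sum_presentation.additive_sumI[OF tensor_presentation[OF E' F'] T
          that(1)[unfolded tensor_eq[of E' F']] that(2)[unfolded tensor_eq[of E' F']]
          that(3)[unfolded tensor_eq[of E' F']] _ that(4)[unfolded tensor_eq[of E' F']]])
      (use that(5) in \<open>auto simp: ptens_eq[of E' F']\<close>)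
  have "\<exists>B. ea_biadditive ?A ?A' ?T B \<and>
    (\<forall>a\<in>ecarrier E. \<forall>b\<in>ecarrier F. \<forall>y\<in>ecarrier ?A'. B (ptens E F a b) y = l a b y)"
  proof (rule tensor_lift_parametrized[OF E F A' T _ l(1)])
    fix y assume y: "y \<in> ecarrier ?A'"
    show "ea_biadditive E F ?T (\<lambda>a b. l a b y)"
      unfolding ea_biadditive_def
    proof (intro conjI ballI ea_additiveI)
      fix b a a' c assume h: "b \<in> ecarrier F" "a \<in> ecarrier E" "a' \<in> ecarrier E" "osum E a a' = Some c"
      have c: "c \<in> ecarrier E" by (rule ea_closed[OF E h(2-4)])
      show "osum ?T (l a b y) (l a' b y) = Some (l c b y)"
        by (rule sumI[OF l(1)[OF h(2,1)] l(1)[OF h(3,1)] l(1)[OF c h(1)] y])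
          (use l(2) h c ea_additive_sum[OF t1] in simp)
    next
      fix a b b' c assume h: "a \<in> ecarrier E" "b \<in> ecarrier F" "b' \<in> ecarrier F" "osum F b b' = Some c"
      have c: "c \<in> ecarrier F" by (rule ea_closed[OF F h(2-4)])
      show "osum ?T (l a b y) (l a b' y) = Some (l a c y)"
        by (rule sumI[OF l(1)[OF h(1,2)] l(1)[OF h(1,3)] l(1)[OF h(1) c] y])
          (use l(2) h c ea_additive_sum[OF t2] in simp)
    qed (use ea_additive_closed[OF l(1)] y in blast)+
  qed
  then obtain B where B: "ea_biadditive ?A ?A' ?T B"
    "\<And>a b y. a \<in> ecarrier E \<Longrightarrow> b \<in> ecarrier F \<Longrightarrow> y \<in> ecarrier ?A' \<Longrightarrow> B (ptens E F a b) y = l a b y"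
    by blast
  have val: "B (ptens E F a b) (ptens E' F' a' b') = ?t a b a' b'"
    if "a \<in> ecarrier E" "b \<in> ecarrier F" "a' \<in> ecarrier E'" "b' \<in> ecarrier F'" for a b a' b'
    using that B(2) l(2) ptens_closed[OF E' F'] by simp
  have "B (eone ?A) (eone ?A') = eone ?T"
    using val[OF ea_one[OF E] ea_one[OF F] ea_one[OF E'] ea_one[OF F']] ptens_one[OF E F]
      ptens_one[OF E' F'] ptens_one[OF E E'] ptens_one[OF F F'] ptens_one[OF C D] by simp
  then obtain h where h: "h \<in> ea_hom (?A \<otimes> ?A') ?T"
    "\<And>x y. x \<in> ecarrier ?A \<Longrightarrow> y \<in> ecarrier ?A' \<Longrightarrow> h (ptens ?A ?A' x y) = B x y"
    using bimorphism_hom[OF A A' T B(1)] by blast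
  let ?Q = "\<lambda>h. h \<in> ea_hom (?A \<otimes> ?A') ?T \<and>
       (\<forall>a\<in>ecarrier E. \<forall>b\<in>ecarrier F. \<forall>a'\<in>ecarrier E'. \<forall>b'\<in>ecarrier F'.
          h (ptens ?A ?A' (ptens E F a b) (ptens E' F' a' b')) = ?t a b a' b')"
  have hQ: "?Q h" using h val ptens_closed[OF E F] ptens_closed[OF E' F'] by simp
  note s = ptens_biadditive[OF A A']
  have uniq: "k = h" if k: "?Q k" for k
  proof (rule tensor_hom_eqI[OF A A' T])
    have kh: "ea_additive (?A \<otimes> ?A') ?T k" "ea_additive (?A \<otimes> ?A') ?T h"
      using k hQ ea_hom_additive by blast+
    fix x y assume x: "x \<in> ecarrier ?A" and y: "y \<in> ecarrier ?A'"
    note L = ea_additive_comp[OF ea_biadditive_left[OF s y]]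
    show "k (ptens ?A ?A' x y) = h (ptens ?A ?A' x y)"
    proof (rule tensor_additive_eqI[OF E F T L[OF kh(1)] L[OF kh(2)] _ x])
      fix a b assume ab: "a \<in> ecarrier E" "b \<in> ecarrier F"
      note R = ea_additive_comp[OF ea_biadditive_right[OF s ptens_closed[OF E F ab]]]
      show "k (ptens ?A ?A' (ptens E F a b) y) = h (ptens ?A ?A' (ptens E F a b) y)"
        by (rule tensor_additive_eqI[OF E' F' T R[OF kh(1)] R[OF kh(2)] _ y]) (use k hQ ab in simp)
    qed
  qed (use k hQ in blast)+
  have "?Q (tensor_interchange E F E' F')"
    unfolding tensor_interchange_def by (rule theI[of ?Q, OF hQ uniq])
  then show "tensor_interchange E F E' F' \<in> ea_hom ((E \<otimes> F) \<otimes> (E' \<otimes> F')) ((E \<otimes> E') \<otimes> (F \<otimes> F'))"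
    and "a \<in> ecarrier E \<Longrightarrow> b \<in> ecarrier F \<Longrightarrow> a' \<in> ecarrier E' \<Longrightarrow> b' \<in> ecarrier F' \<Longrightarrow>
      tensor_interchange E F E' F' (ptens (E \<otimes> F) (E' \<otimes> F') (ptens E F a b) (ptens E' F' a' b')) =
        ptens (E \<otimes> E') (F \<otimes> F') (ptens E E' a a') (ptens F F' b b')"
    by blast+
qed

section \<open>Boolean tensor products\<close>

lemma boolean_effect_algebra: "boolean_ea E \<Longrightarrow> effect_algebra E"
  unfolding boolean_ea_def using arises_effect_algebra by blast

lemma arises_boolean: "arises_from_boolean E m j c \<Longrightarrow> boolean_ea E"
  unfolding boolean_ea_def by blast

lemma boolean_meet:
  assumes "arises_from_boolean E m j c"
  shows meet_closed: "x \<in> ecarrier E \<Longrightarrow> y \<in> ecarrier E \<Longrightarrow> m x y \<in> ecarrier E"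
    and meet_comm: "x \<in> ecarrier E \<Longrightarrow> y \<in> ecarrier E \<Longrightarrow> m x y = m y x"
    and meet_assoc: "x \<in> ecarrier E \<Longrightarrow> y \<in> ecarrier E \<Longrightarrow> w \<in> ecarrier E \<Longrightarrow> m (m x y) w = m x (m y w)"
    and meet_one: "x \<in> ecarrier E \<Longrightarrow> m x (eone E) = x"
    and meet_idem: "x \<in> ecarrier E \<Longrightarrow> m x x = x"
    and meet_biadditive: "ea_biadditive E E E m"
proof -
  let ?A = "ecarrier E" and ?z = "ezero E" and ?e = "eone E"
  have B: "boolean_algebra_on ?A m j c ?z ?e"
    and s: "\<And>a b. a \<in> ?A \<Longrightarrow> b \<in> ?A \<Longrightarrow> osum E a b = (if m a b = ?z then Some (j a b) else None)"
    using assms unfolding arises_from_boolean_def by blast+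
  note B' = B[unfolded boolean_algebra_on_def]
  show cl: "x \<in> ?A \<Longrightarrow> y \<in> ?A \<Longrightarrow> m x y \<in> ?A"
    and co: "x \<in> ?A \<Longrightarrow> y \<in> ?A \<Longrightarrow> m x y = m y x"
    and as: "x \<in> ?A \<Longrightarrow> y \<in> ?A \<Longrightarrow> w \<in> ?A \<Longrightarrow> m (m x y) w = m x (m y w)"
    and "x \<in> ?A \<Longrightarrow> m x ?e = x" for x y w
    using B' by blast+
  show id: "x \<in> ?A \<Longrightarrow> m x x = x" for x by (rule boolean_algebra_on_facts(1)[OF B])
  have sum: "osum E (m x a) (m x b) = Some (m x d)"
    if "x \<in> ?A" "a \<in> ?A" "b \<in> ?A" "osum E a b = Some d" for x a b d
  proof -
    have ab: "m a b = ?z" "d = j a b" using s that by (auto split: if_splits)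
    have "m (m x a) (m x b) = m (m (m x a) x) b" using as cl that by simp
    also have "m (m x a) x = m x a" using as[of x x a] co[of "m x a" x] id cl that by simp
    also have "m (m x a) b = ?z" using as[of x a b] ab(1) boolean_algebra_on_facts(3)[OF B] that by simp
    finally have "m (m x a) (m x b) = ?z" .
    moreover have "m x d = j (m x a) (m x b)" unfolding ab(2) using B' that by blast
    ultimately show ?thesis using s cl that by simp
  qed
  show "ea_biadditive E E E m"
    unfolding ea_biadditive_def
  proof (intro conjI ballI ea_additiveI)
    fix x a b d assume h: "x \<in> ?A" "a \<in> ?A" "b \<in> ?A" "osum E a b = Some d"
    then have "d \<in> ?A" using ea_closed[OF arises_effect_algebra[OF assms]] by blast
    then show "osum E (m a x) (m b x) = Some (m d x)" using sum[OF h] co h by simp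
  qed (use cl sum in blast)+
qed

lemma hom_meet:
  assumes "arises_from_boolean E m j c" "arises_from_boolean F m' j' c'" "f \<in> ea_hom E F"
    and "a \<in> ecarrier E" "b \<in> ecarrier E"
  shows "f (m a b) = m' (f a) (f b)"
proof -
  have "f \<in> ecarrier E \<rightarrow>\<^sub>E ecarrier F" using assms(3) unfolding ea_hom_def by blast
  then show ?thesis using ea_hom_boolean_iff[OF assms(1,2)] assms(3-5) by blast
qed

text \<open>Meets distribute over disjoint joins, so the componentwise meet maps each relation of the
  tensor product to a relation.\<close>

lemma tensor_arises_from_boolean:
  assumes A: "arises_from_boolean A m j c" and B: "arises_from_boolean B m' j' c'"
  shows "\<exists>M J C. arises_from_boolean (A \<otimes> B) M J C \<and>
    (\<forall>a\<in>ecarrier A. \<forall>b\<in>ecarrier B. \<forall>x\<in>ecarrier A. \<forall>y\<in>ecarrier B.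
      M (ptens A B a b) (ptens A B x y) = ptens A B (m a x) (m' b y))"
proof -
  note EA = arises_effect_algebra[OF A] and EB = arises_effect_algebra[OF B]
  let ?G = "ecarrier A \<times> ecarrier B"
  let ?f = "\<lambda>g h. (m (fst g) (fst h), m' (snd g) (snd h))"
  note a = boolean_meet[OF A] and b = boolean_meet[OF B]
  have "\<exists>M J C. arises_from_boolean (A \<otimes> B) M J C \<and> (\<forall>g\<in>?G. \<forall>h\<in>?G.
      M (pres_class ?G (eone A, eone B) (sum_rels (tensor_sums A B)) {#g#})
        (pres_class ?G (eone A, eone B) (sum_rels (tensor_sums A B)) {#h#}) =
      pres_class ?G (eone A, eone B) (sum_rels (tensor_sums A B)) {#?f g h#})"
    unfolding tensor_eq
  proof (rule sum_presentation.boolean[OF tensor_presentation[OF EA EB]])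
    fix g x y z assume g: "g \<in> ?G" and S: "(x, y, z) \<in> tensor_sums A B"
    note L = ea_additive_sum[OF ea_biadditive_right[OF a(6)]]
      and R = ea_additive_sum[OF ea_biadditive_right[OF b(6)]]
    from S show "(?f g x, ?f g y, ?f g z) \<in> tensor_sums A B"
    proof (cases rule: tensor_sumsE)
      case (left s t r k)
      then show ?thesis using L[of "fst g" s t r] g a(1) b(1) unfolding tensor_sums_def by auto
    next
      case (right k s t r)
      then show ?thesis using R[of "snd g" s t r] g a(1) b(1) unfolding tensor_sums_def by auto
    qed
  next
    fix g h assume "g \<in> ?G" "h \<in> ?G"
    then show "?f g h = ?f h g" using a(2) b(2) by auto
  qed (use a(1,3,4,5) b(1,3,4,5) in auto)
  then show ?thesis unfolding ptens_eq by fastforce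
qed

lemma tensor_boolean: "boolean_ea A \<Longrightarrow> boolean_ea B \<Longrightarrow> boolean_ea (A \<otimes> B)"
  using tensor_arises_from_boolean unfolding boolean_ea_def by metis

text \<open>As \<open>a \<otimes> b\<close> is the meet of \<open>a \<otimes> 1\<close> and \<open>1 \<otimes> b\<close>, the conditions that define the codiagonal leave no
  choice on pure tensors.\<close>

lemma codiagonal_hom:
  assumes A: "arises_from_boolean A m j c"
  shows "codiagonal A \<in> ea_hom (A \<otimes> A) A"
    and "a \<in> ecarrier A \<Longrightarrow> b \<in> ecarrier A \<Longrightarrow> codiagonal A (ptens A A a b) = m a b"
proof -
  note E = arises_effect_algebra[OF A] and a = boolean_meet[OF A]
  note e = ea_one[OF E] and T = tensor_effect_algebra[OF E E]
  obtain M J C where M: "arises_from_boolean (A \<otimes> A) M J C"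
    and Mv: "\<And>a b x y. a \<in> ecarrier A \<Longrightarrow> b \<in> ecarrier A \<Longrightarrow> x \<in> ecarrier A \<Longrightarrow> y \<in> ecarrier A \<Longrightarrow>
      M (ptens A A a b) (ptens A A x y) = ptens A A (m a x) (m b y)"
    using tensor_arises_from_boolean[OF A A] by blast
  have one: "m (eone A) x = x" if "x \<in> ecarrier A" for x using a(2,4) e that by simp
  obtain h where h: "h \<in> ea_hom (A \<otimes> A) A"
    "\<And>x y. x \<in> ecarrier A \<Longrightarrow> y \<in> ecarrier A \<Longrightarrow> h (ptens A A x y) = m x y"
    using bimorphism_hom[OF E E E a(6)] one e by blast
  let ?Q = "\<lambda>h. h \<in> ea_hom (A \<otimes> A) A \<and>
     (\<forall>a\<in>ecarrier A. h (ptens A A a (eone A)) = a \<and> h (ptens A A (eone A) a) = a)"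
  have val: "k (ptens A A x y) = m x y" if k: "?Q k" and x: "x \<in> ecarrier A" and y: "y \<in> ecarrier A" for k x y
  proof -
    have "ptens A A x y = M (ptens A A x (eone A)) (ptens A A (eone A) y)"
      using Mv x y e one a(4) by simp
    then show ?thesis
      using hom_meet[OF M A conjunct1[OF k] ptens_closed[OF E E x e] ptens_closed[OF E E e y]] k x y by simp
  qed
  have hQ: "?Q h" using h one a(4) e by simp
  have "?Q (codiagonal A)"
    unfolding codiagonal_def
  proof (rule theI[of ?Q, OF hQ])
    show "k = h" if "?Q k" for k
      by (rule tensor_hom_eqI[OF E E E]) (use that h val in auto)
  qed
  then show "codiagonal A \<in> ea_hom (A \<otimes> A) A"
    and "a \<in> ecarrier A \<Longrightarrow> b \<in> ecarrier A \<Longrightarrow> codiagonal A (ptens A A a b) = m a b"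
    using val by blast+
qed



section \<open>Tensor products of families\<close>

definition fam_sums :: "'i set \<Rightarrow> ('i \<Rightarrow> 'a ea) \<Rightarrow> (('i \<Rightarrow> 'a) \<times> ('i \<Rightarrow> 'a) \<times> ('i \<Rightarrow> 'a)) set" where
  "fam_sums I X =
     {(x(i := a), x(i := b), x(i := c)) | x i a b c.
        x \<in> fam_gens I X \<and> i \<in> I \<and> a \<in> ecarrier (X i) \<and> b \<in> ecarrier (X i) \<and> c \<in> ecarrier (X i) \<and>
        osum (X i) a b = Some c}"

definition fam_supp :: "'i set \<Rightarrow> ('i \<Rightarrow> 'a ea) \<Rightarrow> ('i \<Rightarrow> 'a) \<Rightarrow> 'i set" where
  "fam_supp I X x = {i \<in> I. x i \<noteq> eone (X i)}"

lemma fam_rels_eq: "fam_rels I X = sum_rels (fam_sums I X)"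
proof
  show "fam_rels I X \<subseteq> sum_rels (fam_sums I X)"
  proof
    fix r assume "r \<in> fam_rels I X"
    then obtain x i a b c where r: "r = ({#x(i := c)#}, {#x(i := a), x(i := b)#})"
      and h: "x \<in> fam_gens I X" "i \<in> I" "a \<in> ecarrier (X i)" "b \<in> ecarrier (X i)" "c \<in> ecarrier (X i)"
        "osum (X i) a b = Some c" unfolding fam_rels_def by blast
    have "(x(i := a), x(i := b), x(i := c)) \<in> fam_sums I X" using h unfolding fam_sums_def by blast
    then show "r \<in> sum_rels (fam_sums I X)" unfolding r sum_rels_def by blast
  qed
  show "sum_rels (fam_sums I X) \<subseteq> fam_rels I X"
    unfolding fam_rels_def sum_rels_def fam_sums_def by blast
qed

lemma fam_tensor_eq: "fam_tensor I X = presented (fam_gens I X) (fam_one I X) (sum_rels (fam_sums I X))"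
  unfolding fam_tensor_def fam_rels_eq ..

lemma fam_ptens_eq:
  "fam_ptens I X x = pres_class (fam_gens I X) (fam_one I X) (sum_rels (fam_sums I X)) {#x#}"
  unfolding fam_ptens_def fam_rels_eq ..

lemma fam_gens_iff:
  "x \<in> fam_gens I X \<longleftrightarrow> (\<forall>i\<in>I. x i \<in> ecarrier (X i)) \<and> x \<in> extensional I \<and> finite (fam_supp I X x)"
  unfolding fam_gens_def fam_supp_def by (auto simp: PiE_iff)

lemma fam_gens_update:
  assumes "x \<in> fam_gens I X" "i \<in> I" "a \<in> ecarrier (X i)"
  shows "x(i := a) \<in> fam_gens I X"
proof -
  have "fam_supp I X (x(i := a)) \<subseteq> insert i (fam_supp I X x)" unfolding fam_supp_def by auto
  then have "finite (fam_supp I X (x(i := a)))"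
    using assms(1) unfolding fam_gens_iff by (meson finite_insert finite_subset)
  then show ?thesis using assms unfolding fam_gens_iff by (auto simp: extensional_def)
qed

lemma fam_one_apply [simp]: "i \<in> I \<Longrightarrow> fam_one I X i = eone (X i)"
  unfolding fam_one_def by simp

lemma fam_one_gens:
  assumes "\<forall>i\<in>I. effect_algebra (X i)"
  shows "fam_one I X \<in> fam_gens I X"
proof -
  have "fam_supp I X (fam_one I X) = {}" unfolding fam_supp_def by auto
  then show ?thesis using assms ea_one unfolding fam_gens_iff by (auto simp: fam_one_def)
qed

text \<open>Induction on the finite support: a generator arises from the constant family \<open>1\<close> by changing
  one coordinate at a time, each of them once.\<close>

lemma fam_gens_induct [consumes 1, case_names one update algebra]:
  assumes x: "x \<in> fam_gens I X"
    and one: "Q (fam_one I X)"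
    and update: "\<And>x i a. x \<in> fam_gens I X \<Longrightarrow> i \<in> I \<Longrightarrow> x i = eone (X i) \<Longrightarrow> a \<in> ecarrier (X i) \<Longrightarrow>
      Q x \<Longrightarrow> Q (x(i := a))"
    and X: "\<forall>i\<in>I. effect_algebra (X i)"
  shows "Q x"
proof -
  have "finite F \<Longrightarrow> fam_supp I X x \<subseteq> F \<Longrightarrow> x \<in> fam_gens I X \<Longrightarrow> Q x" for F x
  proof (induction F arbitrary: x rule: finite_induct)
    case empty
    have "x = fam_one I X"
    proof (rule extensionalityI[of _ I])
      show "x \<in> extensional I" using empty(2) unfolding fam_gens_iff by blast
      show "fam_one I X \<in> extensional I" unfolding fam_one_def by simp
      show "x i = fam_one I X i" if "i \<in> I" for i using empty(1) that unfolding fam_supp_def by auto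
    qed
    then show ?case using one by simp
  next
    case (insert i F)
    show ?case
    proof (cases "i \<in> I")
      case True
      let ?y = "x(i := eone (X i))"
      have y: "?y \<in> fam_gens I X" 
        by (rule fam_gens_update[OF insert.prems(2) True ea_one[OF bspec[OF X True]]])
      have "fam_supp I X ?y \<subseteq> F" using insert.prems(1) unfolding fam_supp_def by auto
      then have "Q ?y" by (rule insert.IH[OF _ y])
      have a: "x i \<in> ecarrier (X i)" using insert.prems(2) True unfolding fam_gens_iff by blast
      have "?y i = eone (X i)" by simp
      from update[OF y True this a \<open>Q ?y\<close>] show ?thesis by (simp only: fun_upd_upd fun_upd_triv)
    next
      case False
      then have "fam_supp I X x \<subseteq> F" using insert.prems(1) unfolding fam_supp_def by auto
      then show ?thesis by (rule insert.IH[OF _ insert.prems(2)])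
    qed
  qed
  moreover have "finite (fam_supp I X x)" using x unfolding fam_gens_iff by blast
  ultimately show ?thesis using x by blast
qed

text \<open>A generator has a complement because its value at an index \<open>i\<close> has one: \<open>x(i := a)\<close> is a summand
  of \<open>x(i := 1)\<close>, whose support is smaller.\<close>

lemma fam_presentation:
  assumes X: "\<forall>i\<in>I. effect_algebra (X i)"
  shows "sum_presentation (fam_gens I X) (fam_one I X) (fam_sums I X)"
proof
  let ?G = "fam_gens I X" and ?u = "fam_one I X" and ?S = "fam_sums I X"
  let ?R = "sum_rels ?S"
  show u: "?u \<in> ?G" by (rule fam_one_gens[OF X])
  show S: "?S \<subseteq> ?G \<times> ?G \<times> ?G"
    unfolding fam_sums_def by (auto intro: fam_gens_update)
  have R: "?R \<subseteq> {m. set_mset m \<subseteq> ?G} \<times> {m. set_mset m \<subseteq> ?G}" using S unfolding sum_rels_def by auto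
  show "pres_class ?G ?u ?R {#x#} \<in> pres_carrier ?G ?u ?R" if "x \<in> ?G" for x
    using that
  proof (induction rule: fam_gens_induct)
    case one
    then show ?case using pres_class_in_carrier[OF u R, of "{#?u#}"] pres_below_unit[OF u R] u by simp
  next
    case (update x i a)
    obtain b where b: "b \<in> ecarrier (X i)" "osum (X i) a b = Some (eone (X i))"
      using ea_compl[OF bspec[OF X update(2)] update(4)] by blast
    have x: "x(i := eone (X i)) = x" using update(3) by auto
    have "(x(i := a), x(i := b), x(i := eone (X i))) \<in> ?S"
      using update b ea_one[OF bspec[OF X update(2)]] unfolding fam_sums_def by blast
    then have "pres_cong ?G ?u ?R {#x#} {#x(i := a), x(i := b)#}"
      unfolding x by (intro pres_cong.rel) (auto simp: sum_rels_def)
    then have eq: "pres_class ?G ?u ?R {#x#} = pres_class ?G ?u ?R ({#x(i := a)#} + {#x(i := b)#})"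
      using pres_class_eq_iff[OF u R, of "{#x#}"] update(1) by (simp add: add_mset_commute)
    note ga = fam_gens_update[OF update(1,2,4)] and gb = fam_gens_update[OF update(1,2) b(1)]
    have "pres_below ?G ?u ?R ({#x(i := a)#} + {#x(i := b)#})"
      using pres_class_in_carrier[OF u R, of "{#x(i := a)#} + {#x(i := b)#}"] update(5) eq ga gb by simp
    then have "pres_below ?G ?u ?R {#x(i := a)#}" by (rule pres_below_add_left[OF u R])
    then have "pres_class ?G ?u ?R {#x(i := a)#} \<in> pres_carrier ?G ?u ?R"
      using pres_class_in_carrier[OF u R, of "{#x(i := a)#}"] ga by simp
    then show ?case .
  qed (rule X)
qed

context
  fixes I :: "'i set" and X :: "'i \<Rightarrow> 'a ea"
  assumes X: "\<forall>i\<in>I. effect_algebra (X i)"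
begin

lemma fam_effect_algebra: "effect_algebra (fam_tensor I X)"
  unfolding fam_tensor_eq by (rule sum_presentation.algebra[OF fam_presentation[OF X]])

lemma fam_ptens_closed: "x \<in> fam_gens I X \<Longrightarrow> fam_ptens I X x \<in> ecarrier (fam_tensor I X)"
  unfolding fam_tensor_eq fam_ptens_eq by (rule sum_presentation.cls_closed[OF fam_presentation[OF X]])

lemma fam_ptens_one: "fam_ptens I X (fam_one I X) = eone (fam_tensor I X)"
  unfolding fam_tensor_eq fam_ptens_eq by (rule sum_presentation.cls_unit[OF fam_presentation[OF X]])

lemma fam_ptens_sum:
  assumes "x \<in> fam_gens I X" "i \<in> I" "a \<in> ecarrier (X i)" "b \<in> ecarrier (X i)" "osum (X i) a b = Some c"
  shows "osum (fam_tensor I X) (fam_ptens I X (x(i := a))) (fam_ptens I X (x(i := b))) =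
    Some (fam_ptens I X (x(i := c)))"
  unfolding fam_tensor_eq fam_ptens_eq
proof (rule sum_presentation.cls_sum[OF fam_presentation[OF X]])
  have "c \<in> ecarrier (X i)" using ea_closed[OF bspec[OF X assms(2)] assms(3-5)] .
  then show "(x(i := a), x(i := b), x(i := c)) \<in> fam_sums I X" using assms unfolding fam_sums_def by blast
qed

lemma fam_additive_eqI:
  assumes "effect_algebra E" "ea_additive (fam_tensor I X) E f" "ea_additive (fam_tensor I X) E h"
    and eq: "\<And>x. x \<in> fam_gens I X \<Longrightarrow> f (fam_ptens I X x) = h (fam_ptens I X x)"
    and "p \<in> ecarrier (fam_tensor I X)"
  shows "f p = h p"
  by (rule sum_presentation.additive_eqI[OF fam_presentation[OF X] assms(1)
        assms(2)[unfolded fam_tensor_eq] assms(3)[unfolded fam_tensor_eq]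
        eq[unfolded fam_ptens_eq] assms(5)[unfolded fam_tensor_eq]])

lemma fam_lift_parametrized:
  assumes E: "effect_algebra E" and Y: "effect_algebra Y"
    and left: "\<And>x i a b c y. x \<in> fam_gens I X \<Longrightarrow> i \<in> I \<Longrightarrow> a \<in> ecarrier (X i) \<Longrightarrow> b \<in> ecarrier (X i) \<Longrightarrow>
      c \<in> ecarrier (X i) \<Longrightarrow> osum (X i) a b = Some c \<Longrightarrow> y \<in> ecarrier Y \<Longrightarrow>
      osum E (\<beta> (x(i := a)) y) (\<beta> (x(i := b)) y) = Some (\<beta> (x(i := c)) y)"
    and right: "\<And>x. x \<in> fam_gens I X \<Longrightarrow> ea_additive Y E (\<beta> x)"
  shows "\<exists>B. ea_biadditive (fam_tensor I X) Y E B \<and>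
    (\<forall>x\<in>fam_gens I X. \<forall>y\<in>ecarrier Y. B (fam_ptens I X x) y = \<beta> x y)"
  unfolding fam_tensor_eq fam_ptens_eq
  by (rule sum_presentation.lift_parametrized[OF fam_presentation[OF X] E Y _ right])
    (use left in \<open>auto simp: fam_sums_def\<close>)

lemma fam_lift_hom:
  assumes E: "effect_algebra E" and closed: "\<And>x. x \<in> fam_gens I X \<Longrightarrow> \<phi> x \<in> ecarrier E"
    and sum: "\<And>x i a b c. x \<in> fam_gens I X \<Longrightarrow> i \<in> I \<Longrightarrow> a \<in> ecarrier (X i) \<Longrightarrow> b \<in> ecarrier (X i) \<Longrightarrow>
      c \<in> ecarrier (X i) \<Longrightarrow> osum (X i) a b = Some c \<Longrightarrow>
      osum E (\<phi> (x(i := a))) (\<phi> (x(i := b))) = Some (\<phi> (x(i := c)))"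
    and one: "\<phi> (fam_one I X) = eone E"
  shows "\<exists>h\<in>ea_hom (fam_tensor I X) E. \<forall>x\<in>fam_gens I X. h (fam_ptens I X x) = \<phi> x"
proof -
  have "\<exists>h. ea_additive (fam_tensor I X) E h \<and> (\<forall>x\<in>fam_gens I X. h (fam_ptens I X x) = \<phi> x)"
    unfolding fam_tensor_eq fam_ptens_eq
    by (rule sum_presentation.lift[OF fam_presentation[OF X] E closed])
      (use sum in \<open>auto simp: fam_sums_def\<close>)
  then obtain h where h: "ea_additive (fam_tensor I X) E h"
    "\<And>x. x \<in> fam_gens I X \<Longrightarrow> h (fam_ptens I X x) = \<phi> x" by blast
  have "h (eone (fam_tensor I X)) = eone E"
    using h(2)[OF fam_one_gens[OF X]] fam_ptens_one one by simp
  then have "restrict h (ecarrier (fam_tensor I X)) \<in> ea_hom (fam_tensor I X) E"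
    by (rule ea_hom_restrict[OF fam_effect_algebra h(1)])
  then show ?thesis using h(2) fam_ptens_closed by (intro bexI) auto
qed

lemma fam_inj_apply: "a \<in> ecarrier (X i) \<Longrightarrow> fam_inj I X i a = fam_ptens I X ((fam_one I X)(i := a))"
  unfolding fam_inj_def by simp

lemma fam_inj_hom:
  assumes i: "i \<in> I"
  shows "fam_inj I X i \<in> ea_hom (X i) (fam_tensor I X)"
  unfolding fam_inj_def
proof (rule ea_hom_restrict[OF bspec[OF X i]])
  note u = fam_one_gens[OF X]
  show "ea_additive (X i) (fam_tensor I X) (\<lambda>a. fam_ptens I X ((fam_one I X)(i := a)))"
    by (rule ea_additiveI) (simp_all add: fam_ptens_closed fam_gens_update[OF u i] fam_ptens_sum[OF u i])
  have "(fam_one I X)(i := eone (X i)) = fam_one I X" using i by auto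
  then show "fam_ptens I X ((fam_one I X)(i := eone (X i))) = eone (fam_tensor I X)"
    using fam_ptens_one by simp
qed

end


section \<open>The coproduct of Boolean algebras\<close>

lemma fam_arises_from_boolean:
  assumes X: "\<forall>i\<in>I. arises_from_boolean (X i) (m i) (j i) (c i)"
  shows "\<exists>M J C. arises_from_boolean (fam_tensor I X) M J C \<and>
    (\<forall>x\<in>fam_gens I X. \<forall>y\<in>fam_gens I X.
      M (fam_ptens I X x) (fam_ptens I X y) = fam_ptens I X (\<lambda>i\<in>I. m i (x i) (y i)))"
proof -
  have EB: "\<forall>i\<in>I. effect_algebra (X i)" using X arises_effect_algebra by blast
  note E = bspec[OF EB]
  let ?G = "fam_gens I X" and ?f = "\<lambda>x y. \<lambda>i\<in>I. m i (x i) (y i)"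
  note b = boolean_meet[OF bspec[OF X]]
  have C: "x i \<in> ecarrier (X i)" if "x \<in> ?G" "i \<in> I" for x i using that unfolding fam_gens_iff by blast
  have ext: "x i = undefined" if "x \<in> ?G" "i \<notin> I" for x i
    using that unfolding fam_gens_iff extensional_def by blast
  have closed: "?f x y \<in> ?G" if x: "x \<in> ?G" and y: "y \<in> ?G" for x y
  proof -
    have "fam_supp I X (?f x y) \<subseteq> fam_supp I X x \<union> fam_supp I X y"
      unfolding fam_supp_def using b(5)[OF _ ea_one[OF E]] by auto
    then have "finite (fam_supp I X (?f x y))"
      using x y unfolding fam_gens_iff by (meson finite_UnI finite_subset)
    then show ?thesis using b(1)[OF _ C[OF x] C[OF y]] unfolding fam_gens_iff by auto
  qed
  show ?thesis
    unfolding fam_tensor_eq fam_ptens_eq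
  proof (rule sum_presentation.boolean[OF fam_presentation[OF EB] closed])
    fix x y z assume h: "x \<in> ?G" "y \<in> ?G" "z \<in> ?G"
    show "?f (?f x y) z = ?f x (?f y z)"
      by (rule restrict_ext) (simp add: b(3)[OF _ C[OF h(1)] C[OF h(2)] C[OF h(3)]])
  next
    fix x y assume h: "x \<in> ?G" "y \<in> ?G"
    show "?f x y = ?f y x" by (rule restrict_ext) (rule b(2)[OF _ C[OF h(1)] C[OF h(2)]])
  next
    fix x assume h: "x \<in> ?G"
    show "?f x x = x" "?f x (fam_one I X) = x"
      using b(4,5)[OF _ C[OF h]] ext[OF h] by (auto simp: fun_eq_iff)
  next
    fix g r s t assume g: "g \<in> ?G" and S: "(r, s, t) \<in> fam_sums I X"
    obtain x i a b' d where h: "r = x(i := a)" "s = x(i := b')" "t = x(i := d)" "x \<in> ?G" "i \<in> I"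
      "a \<in> ecarrier (X i)" "b' \<in> ecarrier (X i)" "d \<in> ecarrier (X i)" "osum (X i) a b' = Some d"
      using S unfolding fam_sums_def by blast
    have f: "?f g (x(i := k)) = (?f g x)(i := m i (g i) k)" for k using h(5) by (auto simp: fun_eq_iff)
    have "osum (X i) (m i (g i) a) (m i (g i) b') = Some (m i (g i) d)"
      using ea_additive_sum[OF ea_biadditive_right[OF b(6)]] h C[OF g] by blast
    moreover have "m i (g i) a \<in> ecarrier (X i)" "m i (g i) b' \<in> ecarrier (X i)" "m i (g i) d \<in> ecarrier (X i)"
      using b(1)[OF h(5) C[OF g h(5)]] h(6-8) by auto
    ultimately show "(?f g r, ?f g s, ?f g t) \<in> fam_sums I X"
      unfolding h(1-3) f fam_sums_def using closed[OF g h(4)] h(5) by blast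
  qed
qed

lemma fam_effect_algebras: "\<forall>i\<in>I. boolean_ea (X i) \<Longrightarrow> \<forall>i\<in>I. effect_algebra (X i)"
  using boolean_effect_algebra by blast

lemma arises_choice:
  assumes "\<forall>i\<in>I. boolean_ea (X i)"
  obtains m j c where "\<forall>i\<in>I. arises_from_boolean (X i) (m i) (j i) (c i)"
proof -
  have "\<forall>i\<in>I. \<exists>t. arises_from_boolean (X i) (fst t) (fst (snd t)) (snd (snd t))"
    using assms unfolding boolean_ea_def by simp
  from bchoice[OF this] obtain t where
    "\<forall>i\<in>I. arises_from_boolean (X i) (fst (t i)) (fst (snd (t i))) (snd (snd (t i)))" ..
  then show ?thesis by (rule that)
qed

lemma fam_boolean:
  assumes "\<forall>i\<in>I. boolean_ea (X i)"
  shows "boolean_ea (fam_tensor I X)"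
proof -
  obtain m j c where A: "\<forall>i\<in>I. arises_from_boolean (X i) (m i) (j i) (c i)"
    using assms by (rule arises_choice)
  show ?thesis using fam_arises_from_boolean[OF A] arises_boolean by blast
qed


text \<open>Every pure tensor is a finite meet of elements of the factors, and Boolean homomorphisms
  preserve meets.\<close>

lemma fam_boolean_hom_eqI:
  assumes X: "\<forall>i\<in>I. boolean_ea (X i)" and W: "boolean_ea W"
    and h: "h \<in> ea_hom (fam_tensor I X) W" and k: "k \<in> ea_hom (fam_tensor I X) W"
    and eq: "\<And>i a. i \<in> I \<Longrightarrow> a \<in> ecarrier (X i) \<Longrightarrow> h (fam_inj I X i a) = k (fam_inj I X i a)"
  shows "h = k"
proof -
  obtain m j c where A: "\<forall>i\<in>I. arises_from_boolean (X i) (m i) (j i) (c i)"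
    using X by (rule arises_choice)
  obtain M J C where M: "arises_from_boolean (fam_tensor I X) M J C"
    and Mv: "\<And>x y. x \<in> fam_gens I X \<Longrightarrow> y \<in> fam_gens I X \<Longrightarrow>
      M (fam_ptens I X x) (fam_ptens I X y) = fam_ptens I X (\<lambda>i\<in>I. m i (x i) (y i))"
    using fam_arises_from_boolean[OF A] by blast
  obtain mw jw cw where mw: "arises_from_boolean W mw jw cw" using W unfolding boolean_ea_def by blast
  note EB = fam_effect_algebras[OF X]
  note E = bspec[OF EB] and EW = boolean_effect_algebra[OF W]
  note b = boolean_meet[OF bspec[OF A]] and u = fam_one_gens[OF EB]
  have gen: "h (fam_ptens I X x) = k (fam_ptens I X x)" if "x \<in> fam_gens I X" for x
    using that
  proof (induction rule: fam_gens_induct)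
    case one
    show ?case using fam_ptens_one[OF EB] ea_hom_one[OF h] ea_hom_one[OF k] by simp
  next
    case (update x i a)
    let ?y = "(fam_one I X)(i := a)"
    have y: "?y \<in> fam_gens I X" by (rule fam_gens_update[OF u update(2,4)])
    have "x(i := a) = (\<lambda>i\<in>I. m i (x i) (?y i))"
      using update b(2)[of i "eone (X i)" a] b(4) ea_one[OF E]
      by (auto simp: fun_eq_iff fam_gens_iff extensional_def)
    then have eq': "fam_ptens I X (x(i := a)) = M (fam_ptens I X x) (fam_ptens I X ?y)"
      using Mv[OF update(1) y] by simp
    note cl = fam_ptens_closed[OF EB update(1)] fam_ptens_closed[OF EB y]
    have "h (fam_ptens I X ?y) = k (fam_ptens I X ?y)"
      using eq[OF update(2,4)] fam_inj_apply[OF EB update(4)] by simp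
    then have "h (fam_ptens I X (x(i := a))) = k (fam_ptens I X (x(i := a)))"
      unfolding eq' hom_meet[OF M mw h cl] hom_meet[OF M mw k cl] using update(5) by simp
    then show ?case .
  qed (rule EB)
  show ?thesis
    by (rule ea_hom_eqI[OF h k]) (rule fam_additive_eqI[OF EB EW ea_hom_additive[OF h] ea_hom_additive[OF k] gen])
qed


text \<open>The mediating map sends the pure tensor of \<open>x\<close> to the infimum of all \<open>f i (x i)\<close>. It exists since
  all but finitely many of these elements are \<open>1\<close>. Describing the infimum by its lower bounds makes
  its uniqueness and its behaviour under a change of one coordinate immediate.\<close>

lemma fam_tensor_coproduct:
  assumes X: "\<forall>i\<in>I. boolean_ea (X i)"
  shows "is_balg_coproduct TYPE('w) I X (fam_tensor I X) (fam_inj I X)"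
proof -
  note EB = fam_effect_algebras[OF X]
  note E = bspec[OF EB]
  have "\<exists>!h. h \<in> ea_hom (fam_tensor I X) W \<and> (\<forall>i\<in>I. ea_comp (X i) h (fam_inj I X i) = f i)"
    if W: "boolean_ea W" and f: "\<And>i. i \<in> I \<Longrightarrow> f i \<in> ea_hom (X i) W" for W :: "'w ea" and f
  proof -
    obtain m j c where mw: "arises_from_boolean W m j c" using W unfolding boolean_ea_def by blast
    note EW = boolean_effect_algebra[OF W] and b = boolean_meet[OF mw]
    note e = ea_one[OF EW]
    have fC: "f i a \<in> ecarrier W" if "i \<in> I" "a \<in> ecarrier (X i)" for i a
      by (rule ea_hom_closed[OF f[OF that(1)] that(2)])
    define inf where "inf x w \<longleftrightarrow> w \<in> ecarrier W \<and>
      (\<forall>v\<in>ecarrier W. m v w = v \<longleftrightarrow> (\<forall>i\<in>I. m v (f i (x i)) = v))" for x w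
    have uniq: "w = w'" if "inf x w" "inf x w'" for x w w'
    proof -
      have "m w w' = w" "m w' w = w'" using that b(5) unfolding inf_def by metis+
      then show ?thesis using b(2) that unfolding inf_def by metis
    qed
    have meet_iff: "m v (m a w) = v \<longleftrightarrow> m v a = v \<and> m v w = v"
      if "v \<in> ecarrier W" "a \<in> ecarrier W" "w \<in> ecarrier W" for v a w
      using that by (metis b(1-3,5))
    have inf_update: "inf (x(i := a)) (m (f i a) w)"
      if i: "i \<in> I" and x: "x \<in> fam_gens I X" "x i = eone (X i)" and a: "a \<in> ecarrier (X i)" and w: "inf x w" for x i a w
    proof -
      have wC: "w \<in> ecarrier W" using w unfolding inf_def by blast
      have "m v (f i (x i)) = v" if "v \<in> ecarrier W" for v
        using x(2) ea_hom_one[OF f[OF i]] b(4) that by simp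
      then show ?thesis
        using w meet_iff[OF _ fC[OF i a] wC] b(1)[OF fC[OF i a] wC] i unfolding inf_def by auto
    qed
    have inf_one: "inf (fam_one I X) (eone W)"
      using e b(4) ea_hom_one[OF f] unfolding inf_def by auto
    have ex: "\<exists>w. inf x w" if "x \<in> fam_gens I X" for x
      using that by (induction rule: fam_gens_induct) (use inf_one inf_update EB in blast)+
    then obtain \<phi> where \<phi>: "\<And>x. x \<in> fam_gens I X \<Longrightarrow> inf x (\<phi> x)" by metis
    have \<phi>C: "\<phi> x \<in> ecarrier W" if "x \<in> fam_gens I X" for x using \<phi>[OF that] unfolding inf_def by blast
    have \<phi>u: "\<phi> (x(i := a)) = m (f i a) (\<phi> (x(i := eone (X i))))"
      if "x \<in> fam_gens I X" "i \<in> I" "a \<in> ecarrier (X i)" for x i a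
    proof -
      have g: "x(i := eone (X i)) \<in> fam_gens I X"
        by (rule fam_gens_update[OF that(1,2) ea_one[OF E[OF that(2)]]])
      have "inf (x(i := a)) (m (f i a) (\<phi> (x(i := eone (X i)))))"
        using inf_update[OF that(2) g _ that(3) \<phi>[OF g]] by simp
      then show ?thesis by (rule uniq[OF \<phi>[OF fam_gens_update[OF that]]])
    qed
    have \<phi>1: "\<phi> (fam_one I X) = eone W" using uniq[OF \<phi>[OF fam_one_gens[OF EB]] inf_one] .
    obtain h where h: "h \<in> ea_hom (fam_tensor I X) W" "\<And>x. x \<in> fam_gens I X \<Longrightarrow> h (fam_ptens I X x) = \<phi> x"
    proof -
      have "\<exists>h\<in>ea_hom (fam_tensor I X) W. \<forall>x\<in>fam_gens I X. h (fam_ptens I X x) = \<phi> x"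
      proof (rule fam_lift_hom[where \<phi> = \<phi>, OF EB EW \<phi>C _ \<phi>1])
        fix x i a b' d assume h: "x \<in> fam_gens I X" "i \<in> I" "a \<in> ecarrier (X i)" "b' \<in> ecarrier (X i)"
          "d \<in> ecarrier (X i)" "osum (X i) a b' = Some d"
        have k: "\<phi> (x(i := eone (X i))) \<in> ecarrier W"
          by (rule \<phi>C[OF fam_gens_update[OF h(1,2) ea_one[OF E[OF h(2)]]]])
        have "ea_additive (X i) W (\<lambda>a. m (f i a) (\<phi> (x(i := eone (X i)))))"
          by (rule ea_additive_comp[OF ea_hom_additive[OF f[OF h(2)]] ea_biadditive_left[OF b(6) k]])
        then show "osum W (\<phi> (x(i := a))) (\<phi> (x(i := b'))) = Some (\<phi> (x(i := d)))"
          using \<phi>u[OF h(1,2)] h(3-6) ea_additive_sum by fastforce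
      qed
      then show ?thesis using that by blast
    qed
    have one_upd: "(fam_one I X)(i := eone (X i)) = fam_one I X" if "i \<in> I" for i using that by auto
    have val: "h (fam_inj I X i a) = f i a" if "i \<in> I" "a \<in> ecarrier (X i)" for i a
      using \<phi>u[OF fam_one_gens[OF EB] that] one_upd[OF that(1)] \<phi>1 b(4)[OF fC[OF that]]
        h(2)[OF fam_gens_update[OF fam_one_gens[OF EB] that]] fam_inj_apply[OF EB that(2)] by simp
    have iff: "(\<forall>i\<in>I. ea_comp (X i) k (fam_inj I X i) = f i) \<longleftrightarrow>
      (\<forall>i\<in>I. \<forall>a\<in>ecarrier (X i). k (fam_inj I X i a) = f i a)" if k: "k \<in> ea_hom (fam_tensor I X) W" for k
    proof -
      have "ea_comp (X i) k (fam_inj I X i) = f i \<longleftrightarrow> (\<forall>a\<in>ecarrier (X i). k (fam_inj I X i a) = f i a)"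
        if i: "i \<in> I" for i
      proof
        assume "ea_comp (X i) k (fam_inj I X i) = f i"
        then show "\<forall>a\<in>ecarrier (X i). k (fam_inj I X i a) = f i a" by (metis ea_comp_apply)
      qed (rule ea_hom_eqI[OF ea_comp_hom[OF E[OF i] fam_inj_hom[OF EB i] k] f[OF i]], simp)
      then show ?thesis by blast
    qed
    show ?thesis
    proof (rule ex1I[of _ h])
      show "h \<in> ea_hom (fam_tensor I X) W \<and> (\<forall>i\<in>I. ea_comp (X i) h (fam_inj I X i) = f i)"
        using h(1) iff[OF h(1)] val by blast
      fix k assume "k \<in> ea_hom (fam_tensor I X) W \<and> (\<forall>i\<in>I. ea_comp (X i) k (fam_inj I X i) = f i)"
      then have k: "k \<in> ea_hom (fam_tensor I X) W"
        "\<And>i a. i \<in> I \<Longrightarrow> a \<in> ecarrier (X i) \<Longrightarrow> k (fam_inj I X i a) = f i a"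
        using iff by blast+
      show "k = h" by (rule fam_boolean_hom_eqI[OF X W k(1) h(1)]) (simp_all add: k(2) val)
    qed
  qed
  then show ?thesis
    unfolding is_balg_coproduct_def using fam_boolean[OF X] fam_inj_hom[OF EB] by blast
qed

section \<open>The category of Boolean kernels\<close>

lemma unit_interval_simps:
  "ecarrier unit_interval = {0..1}" "ezero unit_interval = 0" "eone unit_interval = 1"
  "osum unit_interval a b = (if a + b \<le> 1 then Some (a + b) else None)"
  unfolding unit_interval_def by simp_all

lemma unit_interval_effect_algebra: "effect_algebra unit_interval"
  unfolding effect_algebra_def unit_interval_simps
proof (intro conjI ballI allI impI)
  fix a :: real assume a: "a \<in> {0..1}"
  show "\<exists>!a'. a' \<in> {0..1} \<and> (if a + a' \<le> 1 then Some (a + a') else None) = Some 1"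
    by (rule ex1I[of _ "1 - a"]) (use a in \<open>auto split: if_splits\<close>)
qed (auto split: if_splits bind_splits)

lemma two_arises_from_boolean: "arises_from_boolean two (\<and>) (\<or>) Not"
  unfolding arises_from_boolean_def boolean_algebra_on_def two_def by auto

lemmas two_effect_algebra = arises_effect_algebra[OF two_arises_from_boolean]

lemma two_simps: "ecarrier two = UNIV" "ezero two = False" "eone two = True"
  "osum two a b = (if a \<and> b then None else Some (a \<or> b))"
  unfolding two_def by simp_all

text \<open>The unique morphism out of the initial object \<open>2\<close>.\<close>

definition two_map :: "'a ea \<Rightarrow> bool \<Rightarrow> 'a" where
  "two_map E b = (if b then eone E else ezero E)"

lemma two_scale_additive:
  assumes E: "effect_algebra E" and a: "a \<in> ecarrier E"
  shows "ea_additive two E (\<lambda>b. if b then a else ezero E)"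
  unfolding ea_additive_def two_simps
  using a ea_zero[OF E] ea_zero_left[OF E] ea_comm[OF E a ea_zero[OF E]] by auto

lemma two_map_hom: "effect_algebra E \<Longrightarrow> two_map E \<in> ea_hom two E"
  using two_scale_additive[OF _ ea_one]
  unfolding ea_hom_iff two_simps two_map_def[abs_def] by (simp add: extensional_def)

lemma two_hom_unique:
  assumes E: "effect_algebra E" and f: "f \<in> ea_hom two E"
  shows "f = two_map E"
proof
  fix b
  show "f b = two_map E b"
    using ea_hom_one[OF f] ea_additive_zero[OF two_effect_algebra E ea_hom_additive[OF f]]
    unfolding two_simps two_map_def by (cases b) simp_all
qed

lemma two_the_hom: "effect_algebra E \<Longrightarrow> (THE f. f \<in> ea_hom two E) = two_map E"
  using two_map_hom two_hom_unique by (intro the_equality)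

lemma two_to_interval_eq: "two_to_interval = two_map unit_interval"
  unfolding two_to_interval_def by (rule two_the_hom[OF unit_interval_effect_algebra])

lemma scal_effect_algebra: "effect_algebra A \<Longrightarrow> effect_algebra (scal A)"
  by (rule tensor_effect_algebra[OF unit_interval_effect_algebra])

lemma scal_unit_hom:
  assumes A: "effect_algebra A"
  shows "scal_unit A \<in> ea_hom A (scal A)"
    and "a \<in> ecarrier A \<Longrightarrow> scal_unit A a = ptens unit_interval A 1 a"
proof -
  note I = unit_interval_effect_algebra and T = two_effect_algebra
  have r: "restrict (\<lambda>a. ptens two A True a) (ecarrier A) \<in> ea_hom A (two \<otimes> A)"
    by (rule ea_hom_restrict[OF A])
      (use ea_biadditive_right[OF ptens_biadditive[OF T A], of True] ptens_one[OF T A] in \<open>simp_all add: two_simps\<close>)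
  have t: "two_to_interval \<in> ea_hom two unit_interval"
    unfolding two_to_interval_eq by (rule two_map_hom[OF I])
  note m = tensor_map_hom[OF T A I A t ea_id_hom[OF A]]
  show "scal_unit A \<in> ea_hom A (scal A)"
    unfolding scal_unit_def by (rule ea_comp_hom[OF A r m(1)])
  show "scal_unit A a = ptens unit_interval A 1 a" if "a \<in> ecarrier A"
    unfolding scal_unit_def using that m(2)[of True a]
    by (simp add: two_simps two_to_interval_eq two_map_def unit_interval_simps)
qed

lemma interval_mult_hom:
  shows "interval_mult \<in> ea_hom (unit_interval \<otimes> unit_interval) unit_interval"
    and "r \<in> {0..1} \<Longrightarrow> s \<in> {0..1} \<Longrightarrow> interval_mult (ptens unit_interval unit_interval r s) = r * s"
proof -
  note I = unit_interval_effect_algebra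
  have "r * s + r * t \<le> 1" if "0 \<le> r" "r \<le> 1" "s + t \<le> 1" for r s t :: real
  proof -
    have "r * (s + t) \<le> r * 1" using that by (intro mult_left_mono)
    then show ?thesis using that by (simp add: distrib_left)
  qed
  then have "ea_biadditive unit_interval unit_interval unit_interval (\<lambda>r s. r * s)"
    unfolding ea_biadditive_def ea_additive_def unit_interval_simps
    by (auto simp: mult_le_one algebra_simps split: if_splits)
  then have b: "bimorphism unit_interval unit_interval unit_interval (\<lambda>r s. r * s)"
    unfolding bimorphism_iff by (simp add: unit_interval_simps)
  show "interval_mult \<in> ea_hom (unit_interval \<otimes> unit_interval) unit_interval"
    unfolding interval_mult_def by (rule tensor_lift_hom(1)[OF I I I b])
  show "interval_mult (ptens unit_interval unit_interval r s) = r * s" if "r \<in> {0..1}" "s \<in> {0..1}"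
    unfolding interval_mult_def
    by (rule tensor_lift_hom(2)[OF I I I b]) (use that in \<open>simp_all add: unit_interval_simps\<close>)
qed

text \<open>The second part is the unit law of the monad for the unit of \<open>\<I> \<otimes> A\<close>.\<close>

lemma scal_mult_hom:
  assumes A: "effect_algebra A"
  shows "scal_mult A \<in> ea_hom (scal (scal A)) (scal A)"
    and "x \<in> ecarrier (scal A) \<Longrightarrow> scal_mult A (ptens unit_interval (scal A) 1 x) = x"
proof -
  let ?I = unit_interval
  note I = unit_interval_effect_algebra and S = scal_effect_algebra[OF A]
  note II = tensor_effect_algebra[OF I I] and SS = scal_effect_algebra[OF S]
  note a = tensor_assoc_hom[OF I I A] and m = tensor_map_hom[OF II A I A interval_mult_hom(1) ea_id_hom[OF A]]
  show h: "scal_mult A \<in> ea_hom (scal (scal A)) (scal A)"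
    unfolding scal_mult_def by (rule ea_comp_hom[OF SS a(1) m(1)])
  note one = ea_one[OF I, unfolded unit_interval_simps(3)]
  have l: "ea_additive (scal A) (scal A) (\<lambda>x. scal_mult A (ptens ?I (scal A) 1 x))"
    by (rule ea_additive_comp[OF ea_biadditive_right[OF ptens_biadditive[OF I S] one] ea_hom_additive[OF h]])
  have r: "ea_additive (scal A) (scal A) (\<lambda>x. x)" unfolding ea_additive_def by blast
  show "scal_mult A (ptens ?I (scal A) 1 x) = x" if x: "x \<in> ecarrier (scal A)"
  proof (rule tensor_additive_eqI[OF I A S l r _ x])
    fix s b assume s: "s \<in> ecarrier ?I" and b: "b \<in> ecarrier A"
    have "scal_mult A (ptens ?I (scal A) 1 (ptens ?I A s b)) =
      tensor_map (?I \<otimes> ?I) A ?I A interval_mult (ea_id A) (ptens (?I \<otimes> ?I) A (ptens ?I ?I 1 s) b)"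
      unfolding scal_mult_def
      using a(2)[OF one s b] ptens_closed[OF I S one ptens_closed[OF I A s b]] by simp
    also have "\<dots> = ptens ?I A (interval_mult (ptens ?I ?I 1 s)) b"
      using m(2)[OF ptens_closed[OF I I one s] b] b by simp
    also have "interval_mult (ptens ?I ?I 1 s) = s"
      using interval_mult_hom(2)[of 1 s] s by (simp add: unit_interval_simps)
    finally show "scal_mult A (ptens ?I (scal A) 1 (ptens ?I A s b)) = ptens ?I A s b" .
  qed
qed

lemma ea_comp_cong:
  "(\<And>a. a \<in> ecarrier E \<Longrightarrow> g (f a) = g' (f' a)) \<Longrightarrow> ea_comp E g f = ea_comp E g' f'"
  unfolding ea_comp_def compose_def by (rule restrict_ext)

lemma bker_of_hom_hom:
  assumes A: "effect_algebra A" and B: "effect_algebra B" and h: "h \<in> ea_hom B A"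
  shows "bker_of_hom A B h \<in> ea_hom B (scal A)"
    and "b \<in> ecarrier B \<Longrightarrow> bker_of_hom A B h b = ptens unit_interval A 1 (h b)"
  unfolding bker_of_hom_def
  using ea_comp_hom[OF B h scal_unit_hom(1)[OF A]] scal_unit_hom(2)[OF A ea_hom_closed[OF h]] by simp_all

text \<open>The reason why limits over diagrams of homomorphisms in \<open>BKer\<close> are colimits in \<open>EAlg\<close>.\<close>

lemma bker_comp_of_hom:
  assumes A: "effect_algebra A" and B: "effect_algebra B" and C: "effect_algebra C"
    and h: "h \<in> ea_hom C B" and f: "f \<in> ea_hom B (scal A)"
  shows "bker_comp A B C (bker_of_hom B C h) f = ea_comp C f h"
  unfolding bker_comp_def
proof (rule ea_comp_cong)
  note I = unit_interval_effect_algebra and S = scal_effect_algebra[OF A]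
  fix c assume c: "c \<in> ecarrier C"
  note hc = ea_hom_closed[OF h c] and one = ea_one[OF I, unfolded unit_interval_simps(3)]
  show "scal_mult A (ea_comp C (tensor_map unit_interval B unit_interval (scal A) (ea_id unit_interval) f)
      (bker_of_hom B C h) c) = f (h c)"
    using c bker_of_hom_hom(2)[OF B C h c] tensor_map_hom(2)[OF I B I S ea_id_hom[OF I] f one hc] one
      scal_mult_hom(2)[OF A ea_hom_closed[OF f hc]] by simp
qed

lemma bker_comp_of_homs:
  assumes A: "effect_algebra A" and B: "effect_algebra B" and C: "effect_algebra C"
    and k: "k \<in> ea_hom C B" and h: "h \<in> ea_hom B A"
  shows "bker_comp A B C (bker_of_hom B C k) (bker_of_hom A B h) = bker_of_hom A C (ea_comp C h k)"
  unfolding bker_comp_of_hom[OF A B C k bker_of_hom_hom(1)[OF A B h]]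
  unfolding bker_of_hom_def by (rule ea_comp_cong) (use ea_hom_closed[OF k] in simp)

lemma bker_id_eq: "bker_id A = bker_of_hom A A (ea_id A)"
proof -
  have "scal_unit A = ea_comp A (scal_unit A) (ea_id A)"
    unfolding scal_unit_def by (rule ea_comp_cong) simp
  then show ?thesis unfolding bker_id_def bker_of_hom_def .
qed

lemma bker_discard_eq:
  assumes A: "effect_algebra A"
  shows "bker_discard A = bker_of_hom A two (two_map A)"
  unfolding bker_discard_def two_the_hom[OF scal_effect_algebra[OF A]]
  by (rule two_hom_unique[OF scal_effect_algebra[OF A], symmetric])
    (rule bker_of_hom_hom(1)[OF A two_effect_algebra two_map_hom[OF A]])

lemma bker_tensor_of_homs:
  assumes A: "effect_algebra A" and B: "effect_algebra B" and A': "effect_algebra A'" and B': "effect_algebra B'"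
    and h: "h \<in> ea_hom B A" and h': "h' \<in> ea_hom B' A'"
  shows "bker_tensor A B A' B' (bker_of_hom A B h) (bker_of_hom A' B' h') =
    bker_of_hom (A \<otimes> A') (B \<otimes> B') (tensor_map B B' A A' h h')"
proof -
  let ?I = unit_interval
  note I = unit_interval_effect_algebra and S = scal_effect_algebra[OF A] and S' = scal_effect_algebra[OF A']
  note II = tensor_effect_algebra[OF I I] and AA = tensor_effect_algebra[OF A A']
    and BB = tensor_effect_algebra[OF B B']
  note m = tensor_map_hom[OF II AA I AA interval_mult_hom(1) ea_id_hom[OF AA]]
    and i = tensor_interchange_hom[OF I A I A']
    and t = tensor_map_hom[OF B B' S S' bker_of_hom_hom(1)[OF A B h] bker_of_hom_hom(1)[OF A' B' h']]
    and t' = tensor_map_hom[OF B B' A A' h h']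
  note one = ea_one[OF I, unfolded unit_interval_simps(3)]
  show ?thesis
    unfolding bker_tensor_def
  proof (rule tensor_hom_eqI[OF B B' scal_effect_algebra[OF AA]
        ea_comp_hom[OF BB ea_comp_hom[OF BB t(1) i(1)] m(1)] bker_of_hom_hom(1)[OF AA BB t'(1)]])
    fix b b' assume b: "b \<in> ecarrier B" and b': "b' \<in> ecarrier B'"
    note hb = ea_hom_closed[OF h b] and hb' = ea_hom_closed[OF h' b']
    note bb = ptens_closed[OF B B' b b']
    have 1: "interval_mult (ptens ?I ?I 1 1) = 1" using interval_mult_hom(2)[of 1 1] by simp
    show "ea_comp (B \<otimes> B') (tensor_map (?I \<otimes> ?I) (A \<otimes> A') ?I (A \<otimes> A') interval_mult (ea_id (A \<otimes> A')))
        (ea_comp (B \<otimes> B') (tensor_interchange ?I A ?I A')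
          (tensor_map B B' (scal A) (scal A') (bker_of_hom A B h) (bker_of_hom A' B' h'))) (ptens B B' b b') =
      bker_of_hom (A \<otimes> A') (B \<otimes> B') (tensor_map B B' A A' h h') (ptens B B' b b')"
      using bb t(2)[OF b b'] t'(2)[OF b b'] bker_of_hom_hom(2)[OF A B h b] bker_of_hom_hom(2)[OF A' B' h' b']
        i(2)[OF one hb one hb'] m(2)[OF ptens_closed[OF I I one one] ptens_closed[OF A A' hb hb']] 1
        ptens_closed[OF A A' hb hb'] bker_of_hom_hom(2)[OF AA BB t'(1) bb] by simp
  qed
qed

text \<open>For kernels that come from homomorphisms, determinism says that \<open>h\<close> commutes with the
  codiagonals, which are the meets.\<close>

lemma bker_of_hom_deterministic:
  assumes "boolean_ea A" "boolean_ea B" and h: "h \<in> ea_hom B A"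
  shows "bker_deterministic A B (bker_of_hom A B h)"
proof -
  obtain m j c where A: "arises_from_boolean A m j c" using assms(1) unfolding boolean_ea_def by blast
  obtain m' j' c' where B: "arises_from_boolean B m' j' c'" using assms(2) unfolding boolean_ea_def by blast
  note EA = arises_effect_algebra[OF A] and EB = arises_effect_algebra[OF B]
  note AA = tensor_effect_algebra[OF EA EA] and BB = tensor_effect_algebra[OF EB EB]
  note cA = codiagonal_hom[OF A] and cB = codiagonal_hom[OF B]
  note t = tensor_map_hom[OF EB EB EA EA h h]
  have "ea_comp (B \<otimes> B) h (codiagonal B) = ea_comp (B \<otimes> B) (codiagonal A) (tensor_map B B A A h h)"
  proof (rule tensor_hom_eqI[OF EB EB EA ea_comp_hom[OF BB cB(1) h] ea_comp_hom[OF BB t(1) cA(1)]])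
    fix a b assume ab: "a \<in> ecarrier B" "b \<in> ecarrier B"
    then show "ea_comp (B \<otimes> B) h (codiagonal B) (ptens B B a b) =
        ea_comp (B \<otimes> B) (codiagonal A) (tensor_map B B A A h h) (ptens B B a b)"
      using ptens_closed[OF EB EB ab] cB(2) cA(2) t(2) hom_meet[OF B A h ab] ea_hom_closed[OF h] by simp
  qed
  then show ?thesis
    unfolding bker_deterministic_def bker_copy_def bker_tensor_of_homs[OF EA EB EA EB h h]
    using bker_comp_of_homs[OF EA EB BB cB(1) h] bker_comp_of_homs[OF EA AA BB t(1) cA(1)] by simp
qed


section \<open>Limits of Boolean kernels as colimits of effect algebras\<close>

text \<open>The last two assumptions together say that \<open>L\<close> is the colimit of the algebras \<open>D F\<close> in \<open>EAlg\<close>, tested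
  against the effect algebras on the type of \<open>\<I> \<otimes> Z\<close>.\<close>

lemma is_bker_limitI:
  fixes \<delta> :: "'i set \<Rightarrow> 'i set \<Rightarrow> 'd \<Rightarrow> 'd" and \<iota> :: "'i set \<Rightarrow> 'd \<Rightarrow> 'l"
  assumes L: "boolean_ea L" and D: "\<And>F. finite F \<Longrightarrow> F \<subseteq> I \<Longrightarrow> boolean_ea (D F)"
    and \<iota>: "\<And>F. finite F \<Longrightarrow> F \<subseteq> I \<Longrightarrow> \<iota> F \<in> ea_hom (D F) L"
    and \<delta>: "\<And>F F'. F \<subseteq> F' \<Longrightarrow> finite F' \<Longrightarrow> F' \<subseteq> I \<Longrightarrow> \<delta> F F' \<in> ea_hom (D F) (D F')"
    and cocone: "\<And>F F'. F \<subseteq> F' \<Longrightarrow> finite F' \<Longrightarrow> F' \<subseteq> I \<Longrightarrow> ea_comp (D F) (\<iota> F') (\<delta> F F') = \<iota> F"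
    and p: "\<And>F. finite F \<Longrightarrow> F \<subseteq> I \<Longrightarrow> p F = bker_of_hom L (D F) (\<iota> F)"
    and d: "\<And>F F'. F \<subseteq> F' \<Longrightarrow> finite F' \<Longrightarrow> F' \<subseteq> I \<Longrightarrow> d F F' = bker_of_hom (D F') (D F) (\<delta> F F')"
    and ex: "\<And>(E :: 'z scaled ea) q. effect_algebra E \<Longrightarrow>
      (\<And>F. finite F \<Longrightarrow> F \<subseteq> I \<Longrightarrow> q F \<in> ea_hom (D F) E) \<Longrightarrow>
      (\<And>F F' x. F \<subseteq> F' \<Longrightarrow> finite F' \<Longrightarrow> F' \<subseteq> I \<Longrightarrow> x \<in> ecarrier (D F) \<Longrightarrow> q F' (\<delta> F F' x) = q F x) \<Longrightarrow>
      \<exists>h\<in>ea_hom L E. \<forall>F x. finite F \<longrightarrow> F \<subseteq> I \<longrightarrow> x \<in> ecarrier (D F) \<longrightarrow> h (\<iota> F x) = q F x"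
    and uniq: "\<And>(E :: 'z scaled ea) h k. effect_algebra E \<Longrightarrow> h \<in> ea_hom L E \<Longrightarrow> k \<in> ea_hom L E \<Longrightarrow>
      (\<And>F x. finite F \<Longrightarrow> F \<subseteq> I \<Longrightarrow> x \<in> ecarrier (D F) \<Longrightarrow> h (\<iota> F x) = k (\<iota> F x)) \<Longrightarrow> h = k"
  shows "is_bker_limit TYPE('z) I D d L p"
proof -
  note EL = boolean_effect_algebra[OF L] and ED = boolean_effect_algebra[OF D]
  have sub: "finite F \<and> F \<subseteq> I" if "F \<subseteq> F'" "finite F'" "F' \<subseteq> I" for F F'
    using that finite_subset by blast
  have pC: "p F \<in> bker_hom L (D F)" if F: "finite F" "F \<subseteq> I" for F
    unfolding bker_hom_def p[OF F] by (rule bker_of_hom_hom(1)[OF EL ED[OF F] \<iota>[OF F]])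
  have dC: "d F F' \<in> bker_hom (D F') (D F)"
    and dp: "bker_comp L (D F') (D F) (d F F') (p F') = p F"
    if F: "F \<subseteq> F'" "finite F'" "F' \<subseteq> I" for F F'
  proof -
    have F0: "finite F" "F \<subseteq> I" using sub[OF F] by auto
    show "d F F' \<in> bker_hom (D F') (D F)"
      unfolding bker_hom_def d[OF F] by (rule bker_of_hom_hom(1)[OF ED[OF F(2,3)] ED[OF F0] \<delta>[OF F]])
    show "bker_comp L (D F') (D F) (d F F') (p F') = p F"
      unfolding d[OF F] p[OF F(2,3)] p[OF F0]
        bker_comp_of_homs[OF EL ED[OF F(2,3)] ED[OF F0] \<delta>[OF F] \<iota>[OF F(2,3)]] cocone[OF F] ..
  qed
  have univ: "\<exists>!h. h \<in> bker_hom Z L \<and> (\<forall>F. finite F \<and> F \<subseteq> I \<longrightarrow> bker_comp Z L (D F) (p F) h = q F)"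
    if Z: "boolean_ea Z" and q: "\<And>F. finite F \<Longrightarrow> F \<subseteq> I \<Longrightarrow> q F \<in> bker_hom Z (D F)"
      and qq: "\<And>F F'. F \<subseteq> F' \<Longrightarrow> finite F' \<Longrightarrow> F' \<subseteq> I \<Longrightarrow> bker_comp Z (D F') (D F) (d F F') (q F') = q F"
    for Z :: "'z ea" and q
  proof -
    note EZ = boolean_effect_algebra[OF Z]
    note S = scal_effect_algebra[OF EZ]
    note q' = q[unfolded bker_hom_def]
    have compat: "q F' (\<delta> F F' x) = q F x"
      if F: "F \<subseteq> F'" "finite F'" "F' \<subseteq> I" and x: "x \<in> ecarrier (D F)" for F F' x
    proof -
      have F0: "finite F" "F \<subseteq> I" using sub[OF F] by auto
      have "ea_comp (D F) (q F') (\<delta> F F') = q F"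
        using qq[OF F] bker_comp_of_hom[OF EZ ED[OF F(2,3)] ED[OF F0] \<delta>[OF F] q'[OF F(2,3)]]
        unfolding d[OF F] by simp
      then show ?thesis using ea_comp_apply[OF x] by metis
    qed
    have iff: "bker_comp Z L (D F) (p F) h = q F \<longleftrightarrow> (\<forall>x\<in>ecarrier (D F). h (\<iota> F x) = q F x)"
      if h: "h \<in> ea_hom L (scal Z)" and F: "finite F" "F \<subseteq> I" for h F
    proof -
      have "bker_comp Z L (D F) (p F) h = ea_comp (D F) h (\<iota> F)"
        unfolding p[OF F] by (rule bker_comp_of_hom[OF EZ EL ED[OF F] \<iota>[OF F] h])
      moreover have "ea_comp (D F) h (\<iota> F) = q F \<longleftrightarrow> (\<forall>x\<in>ecarrier (D F). h (\<iota> F x) = q F x)"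
      proof
        assume "ea_comp (D F) h (\<iota> F) = q F"
        then show "\<forall>x\<in>ecarrier (D F). h (\<iota> F x) = q F x" by (metis ea_comp_apply)
      qed (rule ea_hom_eqI[OF ea_comp_hom[OF ED[OF F] \<iota>[OF F] h] q'[OF F]], simp)
      ultimately show ?thesis by simp
    qed
    have "\<exists>h\<in>ea_hom L (scal Z).
        \<forall>F x. finite F \<longrightarrow> F \<subseteq> I \<longrightarrow> x \<in> ecarrier (D F) \<longrightarrow> h (\<iota> F x) = q F x"
      by (rule ex[of "scal Z" q, OF S q' compat])
    then obtain h where h: "h \<in> ea_hom L (scal Z)"
      "\<And>F x. finite F \<Longrightarrow> F \<subseteq> I \<Longrightarrow> x \<in> ecarrier (D F) \<Longrightarrow> h (\<iota> F x) = q F x"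
      by blast
    show ?thesis
      unfolding bker_hom_def
    proof (rule ex1I[of _ h])
      show "h \<in> ea_hom L (scal Z) \<and> (\<forall>F. finite F \<and> F \<subseteq> I \<longrightarrow> bker_comp Z L (D F) (p F) h = q F)"
        using iff[OF h(1)] h by simp
      fix k assume k: "k \<in> ea_hom L (scal Z) \<and> (\<forall>F. finite F \<and> F \<subseteq> I \<longrightarrow> bker_comp Z L (D F) (p F) k = q F)"
      show "k = h"
      proof (rule uniq[OF S conjunct1[OF k] h(1)])
        fix F x assume F: "finite F" "F \<subseteq> I" and x: "x \<in> ecarrier (D F)"
        have "bker_comp Z L (D F) (p F) k = q F" using k F by blast
        then show "k (\<iota> F x) = h (\<iota> F x)" using iff[OF conjunct1[OF k] F] h(2)[OF F x] x by simp
      qed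
    qed
  qed
  show ?thesis
    unfolding is_bker_limit_def
  proof (intro conjI allI impI)
    show "boolean_ea L" by (rule L)
    show "boolean_ea (D F)" "p F \<in> bker_hom L (D F)" if "finite F \<and> F \<subseteq> I" for F
      using D[of F] pC[of F] that by simp_all
    show "d F F' \<in> bker_hom (D F') (D F)" "bker_comp L (D F') (D F) (d F F') (p F') = p F"
      if "F \<subseteq> F' \<and> finite F' \<and> F' \<subseteq> I" for F F'
      using dC[of F F'] dp[of F F'] that by simp_all
    fix Z :: "'z ea" and q
    assume "boolean_ea Z \<and> (\<forall>F. finite F \<and> F \<subseteq> I \<longrightarrow> q F \<in> bker_hom Z (D F)) \<and>
      (\<forall>F F'. F \<subseteq> F' \<and> finite F' \<and> F' \<subseteq> I \<longrightarrow> bker_comp Z (D F') (D F) (d F F') (q F') = q F)"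
    then show "\<exists>!h. h \<in> bker_hom Z L \<and> (\<forall>F. finite F \<and> F \<subseteq> I \<longrightarrow> bker_comp Z L (D F) (p F) h = q F)"
      by (intro univ) simp_all
  qed
qed

section \<open>Inclusions of tensor products over subfamilies\<close>

definition fam_extend :: "'i set \<Rightarrow> 'i set \<Rightarrow> ('i \<Rightarrow> 'a ea) \<Rightarrow> ('i \<Rightarrow> 'a) \<Rightarrow> 'i \<Rightarrow> 'a" where
  "fam_extend J I X x = (\<lambda>i\<in>I. if i \<in> J then x i else eone (X i))"

text \<open>The map underlying \<^const>\<open>bker_marginal\<close>, made available for inclusions between arbitrary index
  sets.\<close>

definition fam_incl ::
  "'i set \<Rightarrow> 'i set \<Rightarrow> ('i \<Rightarrow> 'a ea) \<Rightarrow> ('i \<Rightarrow> 'a) multiset set \<Rightarrow> ('i \<Rightarrow> 'a) multiset set" where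
  "fam_incl J I X = (THE h. h \<in> ea_hom (fam_tensor J X) (fam_tensor I X) \<and>
     (\<forall>i\<in>J. ea_comp (X i) h (fam_inj J X i) = fam_inj I X i))"

lemma fam_extend_gens:
  assumes X: "\<forall>i\<in>I. effect_algebra (X i)" and J: "J \<subseteq> I" and x: "x \<in> fam_gens J X"
  shows "fam_extend J I X x \<in> fam_gens I X"
proof -
  have "fam_supp I X (fam_extend J I X x) \<subseteq> fam_supp J X x" unfolding fam_supp_def fam_extend_def by auto
  then have "finite (fam_supp I X (fam_extend J I X x))"
    using x finite_subset unfolding fam_gens_iff by blast
  then show ?thesis using x ea_one X unfolding fam_gens_iff by (auto simp: fam_extend_def)
qed

lemma fam_restrict_gens:
  assumes x: "x \<in> fam_gens I X" and J: "J \<subseteq> I"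
  shows "restrict x J \<in> fam_gens J X"
proof -
  have "fam_supp J X (restrict x J) \<subseteq> fam_supp I X x" using J unfolding fam_supp_def by auto
  then have "finite (fam_supp J X (restrict x J))" using x finite_subset unfolding fam_gens_iff by blast
  then show ?thesis using x J unfolding fam_gens_iff by auto
qed

lemma fam_extend_restrict:
  assumes "x \<in> fam_gens I X" "fam_supp I X x \<subseteq> J" "J \<subseteq> K" "K \<subseteq> I"
  shows "fam_extend J K X (restrict x J) = restrict x K"
  using assms unfolding fam_extend_def fam_supp_def by (auto simp: fun_eq_iff)

lemma fam_extend_update: "i \<in> J \<Longrightarrow> J \<subseteq> I \<Longrightarrow> fam_extend J I X (x(i := a)) = (fam_extend J I X x)(i := a)"
  unfolding fam_extend_def by (auto simp: fun_eq_iff)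

lemma fam_extend_one: "J \<subseteq> I \<Longrightarrow> fam_extend J I X (fam_one J X) = fam_one I X"
  unfolding fam_extend_def fam_one_def by (auto simp: fun_eq_iff)

text \<open>The map that inserts \<open>1\<close> at the missing indices exists on the level of presentations and is compatible
  with the injections; it is the only such map because the source is generated by its factors.\<close>

lemma fam_incl_hom:
  assumes X: "\<forall>i\<in>I. boolean_ea (X i)" and J: "J \<subseteq> I"
  shows "fam_incl J I X \<in> ea_hom (fam_tensor J X) (fam_tensor I X)"
    and "x \<in> fam_gens J X \<Longrightarrow> fam_incl J I X (fam_ptens J X x) = fam_ptens I X (fam_extend J I X x)"
proof -
  have XJ: "\<forall>i\<in>J. boolean_ea (X i)" using X J by blast
  note E = fam_effect_algebras[OF X] and EJ = fam_effect_algebras[OF XJ]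
  let ?e = "fam_extend J I X"
  let ?\<phi> = "\<lambda>x. fam_ptens I X (?e x)"
  have "\<exists>h\<in>ea_hom (fam_tensor J X) (fam_tensor I X). \<forall>x\<in>fam_gens J X. h (fam_ptens J X x) = ?\<phi> x"
  proof (rule fam_lift_hom[OF EJ fam_effect_algebra[OF E]])
    show "?\<phi> x \<in> ecarrier (fam_tensor I X)" if "x \<in> fam_gens J X" for x
      by (rule fam_ptens_closed[OF E fam_extend_gens[OF E J that]])
    show "?\<phi> (fam_one J X) = eone (fam_tensor I X)"
      unfolding fam_extend_one[OF J] by (rule fam_ptens_one[OF E])
    fix x i a b c assume h: "x \<in> fam_gens J X" "i \<in> J" "a \<in> ecarrier (X i)" "b \<in> ecarrier (X i)"
      "c \<in> ecarrier (X i)" "osum (X i) a b = Some c"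
    have i: "i \<in> I" using h(2) J by blast
    show "osum (fam_tensor I X) (?\<phi> (x(i := a))) (?\<phi> (x(i := b))) = Some (?\<phi> (x(i := c)))"
      unfolding fam_extend_update[OF h(2) J]
      by (rule fam_ptens_sum[OF E fam_extend_gens[OF E J h(1)] i h(3,4,6)])
  qed
  then obtain h where h: "h \<in> ea_hom (fam_tensor J X) (fam_tensor I X)"
    "\<And>x. x \<in> fam_gens J X \<Longrightarrow> h (fam_ptens J X x) = ?\<phi> x" by blast
  have inj: "h (fam_inj J X i a) = fam_inj I X i a" if i: "i \<in> J" and a: "a \<in> ecarrier (X i)" for i a
    using h(2)[OF fam_gens_update[OF fam_one_gens[OF EJ] i a]] fam_inj_apply[OF EJ a] fam_inj_apply[OF E a]
    by (simp add: fam_extend_update[OF i J] fam_extend_one[OF J])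
  let ?Q = "\<lambda>h. h \<in> ea_hom (fam_tensor J X) (fam_tensor I X) \<and>
    (\<forall>i\<in>J. ea_comp (X i) h (fam_inj J X i) = fam_inj I X i)"
  have "ea_comp (X i) h (fam_inj J X i) = fam_inj I X i" if i: "i \<in> J" for i
  proof (rule ea_hom_eqI)
    show "ea_comp (X i) h (fam_inj J X i) \<in> ea_hom (X i) (fam_tensor I X)"
      by (rule ea_comp_hom[OF bspec[OF EJ i] fam_inj_hom[OF EJ i] h(1)])
    show "fam_inj I X i \<in> ea_hom (X i) (fam_tensor I X)" using fam_inj_hom[OF E] i J by blast
  qed (simp add: inj[OF i])
  then have hQ: "?Q h" using h(1) by blast
  have "fam_incl J I X = h"
    unfolding fam_incl_def
  proof (rule the_equality[of ?Q, OF hQ])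
    fix k assume k: "?Q k"
    show "k = h"
    proof (rule fam_boolean_hom_eqI[OF XJ fam_boolean[OF X] conjunct1[OF k] h(1)])
      fix i a assume i: "i \<in> J" and a: "a \<in> ecarrier (X i)"
      have "ea_comp (X i) k (fam_inj J X i) a = fam_inj I X i a" using k i by simp
      then show "k (fam_inj J X i a) = h (fam_inj J X i a)" using inj[OF i a] a by simp
    qed
  qed
  then show "fam_incl J I X \<in> ea_hom (fam_tensor J X) (fam_tensor I X)"
    and "x \<in> fam_gens J X \<Longrightarrow> fam_incl J I X (fam_ptens J X x) = fam_ptens I X (fam_extend J I X x)"
    using h by auto
qed

lemma fam_incl_comp:
  assumes X: "\<forall>i\<in>I. boolean_ea (X i)" and JK: "J \<subseteq> K" "K \<subseteq> I"
  shows "ea_comp (fam_tensor J X) (fam_incl K I X) (fam_incl J K X) = fam_incl J I X"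
proof -
  have XK: "\<forall>i\<in>K. boolean_ea (X i)" and XJ: "\<forall>i\<in>J. boolean_ea (X i)" and JI: "J \<subseteq> I" using X JK by auto
  note E = fam_effect_algebras[OF X] and EK = fam_effect_algebras[OF XK] and EJ = fam_effect_algebras[OF XJ]
  note TI = fam_effect_algebra[OF E] and TJ = fam_effect_algebra[OF EJ]
  note i = fam_incl_hom[OF XK JK(1)] fam_incl_hom[OF X JK(2)] fam_incl_hom[OF X JI]
  note c = ea_comp_hom[OF TJ i(1) i(3)]
  show ?thesis
  proof (rule ea_hom_eqI[OF c i(5)], rule fam_additive_eqI[OF EJ TI ea_hom_additive[OF c] ea_hom_additive[OF i(5)]])
    fix x assume x: "x \<in> fam_gens J X"
    have "fam_extend K I X (fam_extend J K X x) = fam_extend J I X x"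
      using JK unfolding fam_extend_def by (auto simp: fun_eq_iff)
    then show "ea_comp (fam_tensor J X) (fam_incl K I X) (fam_incl J K X) (fam_ptens J X x) =
        fam_incl J I X (fam_ptens J X x)"
      using fam_ptens_closed[OF EJ x] i(2)[OF x] i(4)[OF fam_extend_gens[OF EK JK(1) x]] i(6)[OF x] by simp
  qed
qed

text \<open>The map underlying \<^const>\<open>bker_split\<close>.\<close>

definition fam_merge ::
  "('i \<Rightarrow> 'a ea) \<Rightarrow> 'i set \<Rightarrow> 'i set \<Rightarrow>
   (('i \<Rightarrow> 'a) multiset set \<times> ('i \<Rightarrow> 'a) multiset set) multiset set \<Rightarrow> ('i \<Rightarrow> 'a) multiset set" where
  "fam_merge X F F' = (THE h. h \<in> ea_hom (fam_tensor F X \<otimes> fam_tensor (F' - F) X) (fam_tensor F' X) \<and>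
     (\<forall>x\<in>fam_gens F X. \<forall>y\<in>fam_gens (F' - F) X.
        h (ptens (fam_tensor F X) (fam_tensor (F' - F) X) (fam_ptens F X x) (fam_ptens (F' - F) X y)) =
        fam_ptens F' X (\<lambda>i. if i \<in> F then x i else y i)))"

text \<open>On pure tensors the map is the meet of the two families, each extended by \<open>1\<close>; the meet in
  \<open>X\<^sup>F'\<close> of the images of \<open>p\<close> and \<open>q\<close> is biadditive, which provides existence.\<close>

lemma fam_merge_hom:
  assumes X: "\<forall>i\<in>F'. boolean_ea (X i)" and F: "F \<subseteq> F'"
  shows "fam_merge X F F' \<in> ea_hom (fam_tensor F X \<otimes> fam_tensor (F' - F) X) (fam_tensor F' X)"
    and "x \<in> fam_gens F X \<Longrightarrow> y \<in> fam_gens (F' - F) X \<Longrightarrow>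
      fam_merge X F F' (ptens (fam_tensor F X) (fam_tensor (F' - F) X) (fam_ptens F X x) (fam_ptens (F' - F) X y)) =
      fam_ptens F' X (\<lambda>i. if i \<in> F then x i else y i)"
proof -
  let ?R = "F' - F"
  have R: "?R \<subseteq> F'" by blast
  have XF: "\<forall>i\<in>F. boolean_ea (X i)" and XR: "\<forall>i\<in>?R. boolean_ea (X i)" using X F by auto
  note E' = fam_effect_algebras[OF X] and EF = fam_effect_algebras[OF XF] and ER = fam_effect_algebras[OF XR]
  note T' = fam_effect_algebra[OF E'] and TF = fam_effect_algebra[OF EF] and TR = fam_effect_algebra[OF ER]
  let ?A = "fam_tensor F X" and ?B = "fam_tensor ?R X" and ?C = "fam_tensor F' X"
  let ?m = "\<lambda>x y. \<lambda>i. if i \<in> F then x i else y i"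
  obtain m j c where A: "\<forall>i\<in>F'. arises_from_boolean (X i) (m i) (j i) (c i)"
    using X by (rule arises_choice)
  obtain M J C where M: "arises_from_boolean ?C M J C"
    and Mv: "\<And>x y. x \<in> fam_gens F' X \<Longrightarrow> y \<in> fam_gens F' X \<Longrightarrow>
      M (fam_ptens F' X x) (fam_ptens F' X y) = fam_ptens F' X (\<lambda>i\<in>F'. m i (x i) (y i))"
    using fam_arises_from_boolean[OF A] by blast
  note b = boolean_meet[OF M] and b' = boolean_meet[OF bspec[OF A]]
  note iF = fam_incl_hom[OF X F] and iR = fam_incl_hom[OF X R]
  let ?\<beta> = "\<lambda>p q. M (fam_incl F F' X p) (fam_incl ?R F' X q)"
  have "ea_biadditive ?A ?B ?C ?\<beta>"
    unfolding ea_biadditive_def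
    using ea_additive_comp[OF ea_hom_additive[OF iF(1)] ea_biadditive_left[OF b(6) ea_hom_closed[OF iR(1)]]]
      ea_additive_comp[OF ea_hom_additive[OF iR(1)] ea_biadditive_right[OF b(6) ea_hom_closed[OF iF(1)]]]
    by simp
  moreover have "?\<beta> (eone ?A) (eone ?B) = eone ?C"
    using ea_hom_one[OF iF(1)] ea_hom_one[OF iR(1)] b(4)[OF ea_one[OF T']] by simp
  ultimately obtain h where h: "h \<in> ea_hom (?A \<otimes> ?B) ?C"
    "\<And>p q. p \<in> ecarrier ?A \<Longrightarrow> q \<in> ecarrier ?B \<Longrightarrow> h (ptens ?A ?B p q) = ?\<beta> p q"
    using bimorphism_hom[OF TF TR T', of ?\<beta>] by blast
  have val: "?\<beta> (fam_ptens F X x) (fam_ptens ?R X y) = fam_ptens F' X (?m x y)"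
    if x: "x \<in> fam_gens F X" and y: "y \<in> fam_gens ?R X" for x y
  proof -
    have xC: "x i \<in> ecarrier (X i)" if "i \<in> F" for i using x that unfolding fam_gens_iff by blast
    have yC: "y i \<in> ecarrier (X i)" if "i \<in> F'" "i \<notin> F" for i using y that unfolding fam_gens_iff by blast
    have yu: "y i = undefined" if "i \<notin> F'" for i using y that unfolding fam_gens_iff extensional_def by blast
    have "(\<lambda>i\<in>F'. m i (fam_extend F F' X x i) (fam_extend ?R F' X y i)) = ?m x y"
    proof
      fix i
      show "(\<lambda>i\<in>F'. m i (fam_extend F F' X x i) (fam_extend ?R F' X y i)) i = ?m x y i"
      proof (cases "i \<in> F'")
        case True
        note o = ea_one[OF bspec[OF E' True]]
        show ?thesis
        proof (cases "i \<in> F")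
          case iF: True
          then show ?thesis using True b'(4)[OF True xC[OF iF]] unfolding fam_extend_def by simp
        next
          case False
          have "m i (eone (X i)) (y i) = y i"
            using b'(2)[OF True o yC[OF True False]] b'(4)[OF True yC[OF True False]] by simp
          then show ?thesis using True False unfolding fam_extend_def by simp
        qed
      next
        case False
        then show ?thesis using yu F by auto
      qed
    qed
    then show ?thesis
      using Mv[OF fam_extend_gens[OF E' F x] fam_extend_gens[OF E' R y]] iF(2)[OF x] iR(2)[OF y] by simp
  qed
  let ?Q = "\<lambda>h. h \<in> ea_hom (?A \<otimes> ?B) ?C \<and> (\<forall>x\<in>fam_gens F X. \<forall>y\<in>fam_gens ?R X.
     h (ptens ?A ?B (fam_ptens F X x) (fam_ptens ?R X y)) = fam_ptens F' X (?m x y))"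
  have hQ: "?Q h" using h val fam_ptens_closed[OF EF] fam_ptens_closed[OF ER] by simp
  note s = ptens_biadditive[OF TF TR]
  have uniq: "k = h" if k: "?Q k" for k
  proof (rule tensor_hom_eqI[OF TF TR T' conjunct1[OF k] h(1)])
    note kh = ea_hom_additive[OF conjunct1[OF k]] ea_hom_additive[OF h(1)]
    fix p q assume p: "p \<in> ecarrier ?A" and q: "q \<in> ecarrier ?B"
    note L = ea_additive_comp[OF ea_biadditive_left[OF s q]]
    show "k (ptens ?A ?B p q) = h (ptens ?A ?B p q)"
    proof (rule fam_additive_eqI[OF EF T' L[OF kh(1)] L[OF kh(2)] _ p])
      fix x assume x: "x \<in> fam_gens F X"
      note Rt = ea_additive_comp[OF ea_biadditive_right[OF s fam_ptens_closed[OF EF x]]]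
      show "k (ptens ?A ?B (fam_ptens F X x) q) = h (ptens ?A ?B (fam_ptens F X x) q)"
        by (rule fam_additive_eqI[OF ER T' Rt[OF kh(1)] Rt[OF kh(2)] _ q]) (use k hQ x in simp)
    qed
  qed
  have "?Q (fam_merge X F F')"
    unfolding fam_merge_def by (rule theI[of ?Q, OF hQ uniq])
  then show "fam_merge X F F' \<in> ea_hom (?A \<otimes> ?B) ?C"
    and "x \<in> fam_gens F X \<Longrightarrow> y \<in> fam_gens ?R X \<Longrightarrow>
      fam_merge X F F' (ptens ?A ?B (fam_ptens F X x) (fam_ptens ?R X y)) = fam_ptens F' X (?m x y)"
    by blast+
qed

text \<open>The homomorphism underlying the composite sends the pure tensor of \<open>x\<close> to \<open>x \<otimes> True\<close>, then to
  \<open>x \<otimes> 1\<close>, and then merges \<open>x\<close> with the constant family \<open>1\<close>.\<close>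

lemma bker_marginalize_eq:
  assumes X: "\<forall>i\<in>F'. boolean_ea (X i)" and F: "F \<subseteq> F'"
  shows "bker_marginalize X F F' = bker_of_hom (fam_tensor F' X) (fam_tensor F X) (fam_incl F F' X)"
proof -
  let ?R = "F' - F"
  have XF: "\<forall>i\<in>F. boolean_ea (X i)" and XR: "\<forall>i\<in>?R. boolean_ea (X i)" using X F by auto
  note E' = fam_effect_algebras[OF X] and EF = fam_effect_algebras[OF XF] and ER = fam_effect_algebras[OF XR]
  note T' = fam_effect_algebra[OF E'] and TF = fam_effect_algebra[OF EF] and TR = fam_effect_algebra[OF ER]
  note T2 = two_effect_algebra
  let ?A = "fam_tensor F X" and ?B = "fam_tensor ?R X" and ?C = "fam_tensor F' X"
  let ?\<rho> = "restrict (\<lambda>a. ptens ?A two a True) (ecarrier ?A)"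
  let ?t = "tensor_map ?A two ?A ?B (ea_id ?A) (two_map ?B)"
  note A2 = tensor_effect_algebra[OF TF T2] and AB = tensor_effect_algebra[OF TF TR]
  have \<rho>: "?\<rho> \<in> ea_hom ?A (?A \<otimes> two)"
    by (rule ea_hom_restrict[OF TF])
      (use ea_biadditive_left[OF ptens_biadditive[OF TF T2], of True] ptens_one[OF TF T2] in \<open>simp_all add: two_simps\<close>)
  note t = tensor_map_hom[OF TF T2 TF TR ea_id_hom[OF TF] two_map_hom[OF TR]]
  note s = fam_merge_hom[OF X F] and i = fam_incl_hom[OF X F]
  note ts = ea_comp_hom[OF A2 t(1) s(1)]
  have split: "bker_split X F F' = bker_of_hom ?C (?A \<otimes> ?B) (fam_merge X F F')"
    unfolding bker_split_def fam_merge_def ..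
  note c = ea_comp_hom[OF TF \<rho> ts]
  have "ea_comp ?A (ea_comp (?A \<otimes> two) (fam_merge X F F') ?t) ?\<rho> = fam_incl F F' X"
  proof (rule ea_hom_eqI[OF c i(1)], rule fam_additive_eqI[OF EF T' ea_hom_additive[OF c] ea_hom_additive[OF i(1)]])
    fix x assume x: "x \<in> fam_gens F X"
    note xC = fam_ptens_closed[OF EF x]
    have x2: "ptens ?A two (fam_ptens F X x) True \<in> ecarrier (?A \<otimes> two)"
      by (rule ptens_closed[OF TF T2 xC]) (simp add: two_simps)
    have "?t (ptens ?A two (fam_ptens F X x) True) = ptens ?A ?B (fam_ptens F X x) (fam_ptens ?R X (fam_one ?R X))"
      using t(2)[OF xC, of True] xC fam_ptens_one[OF ER] by (simp add: two_simps two_map_def)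
    moreover have "(\<lambda>i. if i \<in> F then x i else fam_one ?R X i) = fam_extend F F' X x"
      using F unfolding fam_one_def fam_extend_def by (auto simp: fun_eq_iff)
    ultimately show "ea_comp ?A (ea_comp (?A \<otimes> two) (fam_merge X F F') ?t) ?\<rho> (fam_ptens F X x) =
        fam_incl F F' X (fam_ptens F X x)"
      using xC x2 s(2)[OF x fam_one_gens[OF ER]] i(2)[OF x] by simp
  qed
  then show ?thesis
    unfolding bker_marginalize_def Let_def split bker_id_eq bker_discard_eq[OF TR] bker_right_unitor_def
      bker_tensor_of_homs[OF TF TF TR T2 ea_id_hom[OF TF] two_map_hom[OF TR]]
      bker_comp_of_homs[OF T' AB A2 t(1) s(1)] bker_comp_of_homs[OF T' A2 TF \<rho> ts] by simp
qed


section \<open>Tensor products of families as filtered colimits\<close>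

lemma fam_incl_supp:
  assumes X: "\<forall>i\<in>I. boolean_ea (X i)" and x: "x \<in> fam_gens I X" and F: "fam_supp I X x \<subseteq> F" "F \<subseteq> K" "K \<subseteq> I"
  shows "fam_incl F K X (fam_ptens F X (restrict x F)) = fam_ptens K X (restrict x K)"
proof -
  have XK: "\<forall>i\<in>K. boolean_ea (X i)" using X F by blast
  have FI: "F \<subseteq> I" using F by blast
  show ?thesis
    using fam_incl_hom(2)[OF XK F(2) fam_restrict_gens[OF x FI]] fam_extend_restrict[OF x F] by simp
qed

lemma fam_gens_restrict_id: "x \<in> fam_gens I X \<Longrightarrow> restrict x I = x"
  unfolding fam_gens_iff by (blast intro: extensional_restrict)

text \<open>The parameter \<open>Y\<close> makes this serve both the colimit \<open>X\<^sup>I\<close> and the colimit \<open>X\<^sup>I \<otimes> Y\<close>. A generator \<open>x\<close> is sent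
  to the value of the cocone at the support of \<open>x\<close>; by compatibility every larger finite index
  set gives the same value, so a relation at the index \<open>i\<close> can be verified at the stage
  \<open>insert i (fam_supp I X x)\<close>.\<close>

lemma fam_colimit_lift:
  assumes X: "\<forall>i\<in>I. boolean_ea (X i)" and E: "effect_algebra E" and Y: "effect_algebra Y"
    and q: "\<And>F. finite F \<Longrightarrow> F \<subseteq> I \<Longrightarrow> ea_biadditive (fam_tensor F X) Y E (q F)"
    and compat: "\<And>F F' p y. F \<subseteq> F' \<Longrightarrow> finite F' \<Longrightarrow> F' \<subseteq> I \<Longrightarrow> p \<in> ecarrier (fam_tensor F X) \<Longrightarrow>
      y \<in> ecarrier Y \<Longrightarrow> q F' (fam_incl F F' X p) y = q F p y"
  shows "\<exists>B. ea_biadditive (fam_tensor I X) Y E B \<and>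
    (\<forall>F p y. finite F \<longrightarrow> F \<subseteq> I \<longrightarrow> p \<in> ecarrier (fam_tensor F X) \<longrightarrow> y \<in> ecarrier Y \<longrightarrow>
      B (fam_incl F I X p) y = q F p y)"
proof -
  note EI = fam_effect_algebras[OF X]
  have XF: "\<forall>i\<in>F. boolean_ea (X i)" if "F \<subseteq> I" for F using that X by blast
  note EF = fam_effect_algebras[OF XF]
  let ?s = "fam_supp I X"
  have s: "finite (?s x)" "?s x \<subseteq> I" if "x \<in> fam_gens I X" for x
    using that unfolding fam_gens_iff fam_supp_def by auto
  define \<phi> where "\<phi> x y = q (?s x) (fam_ptens (?s x) X (restrict x (?s x))) y" for x y
  have \<phi>: "\<phi> x y = q F (fam_ptens F X (restrict x F)) y"
    if x: "x \<in> fam_gens I X" and F: "finite F" "F \<subseteq> I" "?s x \<subseteq> F" and y: "y \<in> ecarrier Y" for x F y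
    using compat[OF F(3,1,2) fam_ptens_closed[OF EF[OF s(2)[OF x]] fam_restrict_gens[OF x s(2)[OF x]]] y]
      fam_incl_supp[OF X x subset_refl F(3,2)] unfolding \<phi>_def by simp
  have "\<exists>B. ea_biadditive (fam_tensor I X) Y E B \<and>
    (\<forall>x\<in>fam_gens I X. \<forall>y\<in>ecarrier Y. B (fam_ptens I X x) y = \<phi> x y)"
  proof (rule fam_lift_parametrized[OF EI E Y])
    fix x i a b c y assume h: "x \<in> fam_gens I X" "i \<in> I" "a \<in> ecarrier (X i)" "b \<in> ecarrier (X i)"
      "c \<in> ecarrier (X i)" "osum (X i) a b = Some c" "y \<in> ecarrier Y"
    let ?F = "insert i (?s x)"
    have F: "finite ?F" "?F \<subseteq> I" using s[OF h(1)] h(2) by auto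
    have i: "i \<in> ?F" by simp
    have v: "\<phi> (x(i := k)) y = q ?F (fam_ptens ?F X ((restrict x ?F)(i := k))) y" if k: "k \<in> ecarrier (X i)" for k
    proof -
      have "?s (x(i := k)) \<subseteq> ?F" unfolding fam_supp_def by auto
      moreover have "restrict (x(i := k)) ?F = (restrict x ?F)(i := k)" by (auto simp: fun_eq_iff)
      ultimately show ?thesis using \<phi>[OF fam_gens_update[OF h(1,2) k] F _ h(7)] by simp
    qed
    note r = fam_restrict_gens[OF h(1) F(2)]
    note g = fam_ptens_closed[OF EF[OF F(2)] fam_gens_update[OF r i]]
    show "osum E (\<phi> (x(i := a)) y) (\<phi> (x(i := b)) y) = Some (\<phi> (x(i := c)) y)"
      unfolding v[OF h(3)] v[OF h(4)] v[OF h(5)]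
      by (rule ea_additive_sum[OF ea_biadditive_left[OF q[OF F] h(7)]
            fam_ptens_sum[OF EF[OF F(2)] r i h(3,4,6)] g[OF h(3)] g[OF h(4)]])
  next
    fix x assume x: "x \<in> fam_gens I X"
    show "ea_additive Y E (\<phi> x)"
      unfolding \<phi>_def
      by (rule ea_biadditive_right[OF q[OF s[OF x]]
            fam_ptens_closed[OF EF[OF s(2)[OF x]] fam_restrict_gens[OF x s(2)[OF x]]]])
  qed
  then obtain B where B: "ea_biadditive (fam_tensor I X) Y E B"
    "\<And>x y. x \<in> fam_gens I X \<Longrightarrow> y \<in> ecarrier Y \<Longrightarrow> B (fam_ptens I X x) y = \<phi> x y" by blast
  have "B (fam_incl F I X p) y = q F p y"
    if F: "finite F" "F \<subseteq> I" and p: "p \<in> ecarrier (fam_tensor F X)" and y: "y \<in> ecarrier Y" for F p y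
  proof (rule fam_additive_eqI[OF EF[OF F(2)] E
        ea_additive_comp[OF ea_hom_additive[OF fam_incl_hom(1)[OF X F(2)]] ea_biadditive_left[OF B(1) y]]
        ea_biadditive_left[OF q[OF F] y] _ p])
    fix x assume x: "x \<in> fam_gens F X"
    note e = fam_extend_gens[OF EI F(2) x]
    have "?s (fam_extend F I X x) \<subseteq> F" unfolding fam_supp_def fam_extend_def by auto
    moreover have "restrict (fam_extend F I X x) F = restrict x F"
      using F(2) unfolding fam_extend_def by (auto simp: fun_eq_iff)
    ultimately show "B (fam_incl F I X (fam_ptens F X x)) y = q F (fam_ptens F X x) y"
      using fam_incl_hom(2)[OF X F(2) x] B(2)[OF e y] \<phi>[OF e F _ y] fam_gens_restrict_id[OF x] by simp
  qed
  then show ?thesis using B(1) by blast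
qed

lemma fam_colimit_eqI:
  assumes X: "\<forall>i\<in>I. boolean_ea (X i)" and E: "effect_algebra E"
    and f: "ea_additive (fam_tensor I X) E f" and g: "ea_additive (fam_tensor I X) E g"
    and eq: "\<And>F p. finite F \<Longrightarrow> F \<subseteq> I \<Longrightarrow> p \<in> ecarrier (fam_tensor F X) \<Longrightarrow>
      f (fam_incl F I X p) = g (fam_incl F I X p)"
    and p: "p \<in> ecarrier (fam_tensor I X)"
  shows "f p = g p"
proof (rule fam_additive_eqI[OF fam_effect_algebras[OF X] E f g _ p])
  fix x assume x: "x \<in> fam_gens I X"
  let ?F = "fam_supp I X x"
  have F: "finite ?F" "?F \<subseteq> I" using x unfolding fam_gens_iff fam_supp_def by auto
  have XF: "\<forall>i\<in>?F. boolean_ea (X i)" using X F(2) by blast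
  have "fam_ptens I X x = fam_incl ?F I X (fam_ptens ?F X (restrict x ?F))"
    using fam_incl_supp[OF X x subset_refl F(2) subset_refl] fam_gens_restrict_id[OF x] by simp
  then show "f (fam_ptens I X x) = g (fam_ptens I X x)"
    using eq[OF F fam_ptens_closed[OF fam_effect_algebras[OF XF] fam_restrict_gens[OF x F(2)]]] by simp
qed

lemma bker_marginal_eq:
  "bker_marginal I X F = bker_of_hom (fam_tensor I X) (fam_tensor F X) (fam_incl F I X)"
  unfolding bker_marginal_def fam_incl_def ..

lemma fam_tensor_bker_limit:
  assumes X: "\<forall>i\<in>I. boolean_ea (X i)"
  shows "is_bker_limit TYPE('z) I (\<lambda>F. fam_tensor F X) (bker_marginalize X) (fam_tensor I X) (bker_marginal I X)"
proof (rule is_bker_limitI[where \<iota> = "\<lambda>F. fam_incl F I X" and \<delta> = "\<lambda>F F'. fam_incl F F' X"])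
  have XF: "\<forall>i\<in>F. boolean_ea (X i)" if "F \<subseteq> I" for F using that X by blast
  show "boolean_ea (fam_tensor I X)" by (rule fam_boolean[OF X])
  show "boolean_ea (fam_tensor F X)" "fam_incl F I X \<in> ea_hom (fam_tensor F X) (fam_tensor I X)"
    if "F \<subseteq> I" for F
    using fam_boolean[OF XF[OF that]] fam_incl_hom(1)[OF X that] by simp_all
  show "fam_incl F F' X \<in> ea_hom (fam_tensor F X) (fam_tensor F' X)"
    "ea_comp (fam_tensor F X) (fam_incl F' I X) (fam_incl F F' X) = fam_incl F I X"
    "bker_marginalize X F F' = bker_of_hom (fam_tensor F' X) (fam_tensor F X) (fam_incl F F' X)"
    if "F \<subseteq> F'" "F' \<subseteq> I" for F F'
    using fam_incl_hom(1)[OF XF[OF that(2)] that(1)] fam_incl_comp[OF X that]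
      bker_marginalize_eq[OF XF[OF that(2)] that(1)] by simp_all
  show "bker_marginal I X F = bker_of_hom (fam_tensor I X) (fam_tensor F X) (fam_incl F I X)" for F
    by (rule bker_marginal_eq)
next
  fix E :: "'z scaled ea" and q
  assume E: "effect_algebra E" and q: "\<And>F. finite F \<Longrightarrow> F \<subseteq> I \<Longrightarrow> q F \<in> ea_hom (fam_tensor F X) E"
    and compat: "\<And>F F' x. F \<subseteq> F' \<Longrightarrow> finite F' \<Longrightarrow> F' \<subseteq> I \<Longrightarrow> x \<in> ecarrier (fam_tensor F X) \<Longrightarrow>
      q F' (fam_incl F F' X x) = q F x"
  \<comment> \<open>biadditive maps on \<open>X\<^sup>F \<times> 2\<close> are additive maps on \<open>X\<^sup>F\<close>, so \<open>2\<close> can be the parameter algebra\<close>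
  let ?q = "\<lambda>F p b. if b then q F p else ezero E"
  have XF: "\<forall>i\<in>F. boolean_ea (X i)" if "F \<subseteq> I" for F using that X by blast
  have "\<exists>B. ea_biadditive (fam_tensor I X) two E B \<and>
    (\<forall>F p y. finite F \<longrightarrow> F \<subseteq> I \<longrightarrow> p \<in> ecarrier (fam_tensor F X) \<longrightarrow> y \<in> ecarrier two \<longrightarrow>
      B (fam_incl F I X p) y = ?q F p y)"
  proof (rule fam_colimit_lift[OF X E two_effect_algebra])
    fix F assume F: "finite F" "F \<subseteq> I"
    have z: "ea_additive (fam_tensor F X) E (\<lambda>a. ezero E)"
      unfolding ea_additive_def using ea_zero[OF E] ea_zero_left[OF E ea_zero[OF E]] by simp
    show "ea_biadditive (fam_tensor F X) two E (?q F)"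
      unfolding ea_biadditive_def
    proof (intro conjI ballI)
      fix b show "ea_additive (fam_tensor F X) E (\<lambda>a. ?q F a b)"
        using z ea_hom_additive[OF q[OF F]] by (cases b) simp_all
    next
      fix a assume "a \<in> ecarrier (fam_tensor F X)"
      then show "ea_additive two E (?q F a)" by (rule two_scale_additive[OF E ea_hom_closed[OF q[OF F]]])
    qed
  qed (simp add: compat)
  then obtain B where B: "ea_biadditive (fam_tensor I X) two E B"
    "\<And>F p. finite F \<Longrightarrow> F \<subseteq> I \<Longrightarrow> p \<in> ecarrier (fam_tensor F X) \<Longrightarrow> B (fam_incl F I X p) True = q F p"
    by (auto simp: two_simps)
  let ?P = "fam_tensor I X"
  note EP = fam_effect_algebra[OF fam_effect_algebras[OF X]]
  \<comment> \<open>the stage at the empty index set suffices to compare units\<close>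
  have e: "{} \<subseteq> I" by simp
  note E0 = fam_effect_algebra[OF fam_effect_algebras[OF XF[OF e]]]
  have "B (eone ?P) True = eone E"
    using B(2)[OF finite.emptyI e ea_one[OF E0]] ea_hom_one[OF fam_incl_hom(1)[OF X e]]
      ea_hom_one[OF q[OF finite.emptyI e]] by simp
  then have "restrict (\<lambda>p. B p True) (ecarrier ?P) \<in> ea_hom ?P E"
    by (intro ea_hom_restrict[OF EP] ea_biadditive_left[OF B(1)]) (simp_all add: two_simps)
  moreover have "restrict (\<lambda>p. B p True) (ecarrier ?P) (fam_incl F I X x) = q F x"
    if "finite F" "F \<subseteq> I" "x \<in> ecarrier (fam_tensor F X)" for F x
    using B(2)[OF that] ea_hom_closed[OF fam_incl_hom(1)[OF X that(2)] that(3)] by simp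
  ultimately show "\<exists>h\<in>ea_hom ?P E. \<forall>F x. finite F \<longrightarrow> F \<subseteq> I \<longrightarrow> x \<in> ecarrier (fam_tensor F X) \<longrightarrow>
      h (fam_incl F I X x) = q F x" by blast
next
  fix E :: "'z scaled ea" and h k
  assume E: "effect_algebra E" and h: "h \<in> ea_hom (fam_tensor I X) E" and k: "k \<in> ea_hom (fam_tensor I X) E"
    and eq: "\<And>F x. finite F \<Longrightarrow> F \<subseteq> I \<Longrightarrow> x \<in> ecarrier (fam_tensor F X) \<Longrightarrow>
      h (fam_incl F I X x) = k (fam_incl F I X x)"
  show "h = k"
    by (rule ea_hom_eqI[OF h k]) (rule fam_colimit_eqI[OF X E ea_hom_additive[OF h] ea_hom_additive[OF k] eq])
qed

lemma fam_tensor_bker_limit_tensor: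
  fixes Y :: "'y ea"
  assumes X: "\<forall>i\<in>I. boolean_ea (X i)" and Y: "boolean_ea Y"
  shows "is_bker_limit TYPE('z) I (\<lambda>F. fam_tensor F X \<otimes> Y)
    (\<lambda>F F'. bker_tensor (fam_tensor F' X) (fam_tensor F X) Y Y (bker_marginalize X F F') (bker_id Y))
    (fam_tensor I X \<otimes> Y)
    (\<lambda>F. bker_tensor (fam_tensor I X) (fam_tensor F X) Y Y (bker_marginal I X F) (bker_id Y))"
proof -
  let ?T = "\<lambda>F. fam_tensor F X"
  let ?inc = "\<lambda>F F'. tensor_map (?T F) Y (?T F') Y (fam_incl F F' X) (ea_id Y)"
  note EY = boolean_effect_algebra[OF Y]
  note idY = ea_id_hom[OF EY]
  have XF: "\<forall>i\<in>F. boolean_ea (X i)" if "F \<subseteq> I" for F using that X by blast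
  have T: "effect_algebra (?T F)" if "F \<subseteq> I" for F
    by (rule fam_effect_algebra[OF fam_effect_algebras[OF XF[OF that]]])
  note TY = tensor_effect_algebra[OF T EY]
  have sub: "F \<subseteq> I" if "F \<subseteq> F'" "F' \<subseteq> I" for F F' using that by blast
  have i: "fam_incl F F' X \<in> ea_hom (?T F) (?T F')" if "F \<subseteq> F'" "F' \<subseteq> I" for F F'
    by (rule fam_incl_hom(1)[OF XF[OF that(2)] that(1)])
  have inc: "?inc F F' \<in> ea_hom (?T F \<otimes> Y) (?T F' \<otimes> Y)"
    and incv: "\<And>p y. p \<in> ecarrier (?T F) \<Longrightarrow> y \<in> ecarrier Y \<Longrightarrow>
      ?inc F F' (ptens (?T F) Y p y) = ptens (?T F') Y (fam_incl F F' X p) y"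
    if F: "F \<subseteq> F'" "F' \<subseteq> I" for F F'
    using tensor_map_hom[OF T[OF sub[OF F]] EY T[OF F(2)] EY i[OF F] idY] by simp_all
  show ?thesis
  proof (rule is_bker_limitI[where \<iota> = "\<lambda>F. ?inc F I" and \<delta> = ?inc])
    show "boolean_ea (?T I \<otimes> Y)" by (rule tensor_boolean[OF fam_boolean[OF X] Y])
    show "boolean_ea (?T F \<otimes> Y)" if "F \<subseteq> I" for F
      by (rule tensor_boolean[OF fam_boolean[OF XF[OF that]] Y])
    show "?inc F I \<in> ea_hom (?T F \<otimes> Y) (?T I \<otimes> Y)" if "F \<subseteq> I" for F by (rule inc[OF that subset_refl])
    show "bker_tensor (?T I) (?T F) Y Y (bker_marginal I X F) (bker_id Y) = bker_of_hom (?T I \<otimes> Y) (?T F \<otimes> Y) (?inc F I)"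
      if "F \<subseteq> I" for F
      unfolding bker_marginal_eq bker_id_eq
      by (rule bker_tensor_of_homs[OF T[OF subset_refl] T[OF that] EY EY i[OF that subset_refl] idY])
    fix F F' assume F: "F \<subseteq> F'" "F' \<subseteq> I"
    show "?inc F F' \<in> ea_hom (?T F \<otimes> Y) (?T F' \<otimes> Y)" by (rule inc[OF F])
    show "bker_tensor (?T F') (?T F) Y Y (bker_marginalize X F F') (bker_id Y) = bker_of_hom (?T F' \<otimes> Y) (?T F \<otimes> Y) (?inc F F')"
      unfolding bker_marginalize_eq[OF XF[OF F(2)] F(1)] bker_id_eq
      by (rule bker_tensor_of_homs[OF T[OF F(2)] T[OF sub[OF F]] EY EY i[OF F] idY])
    note FI = sub[OF F]
    show "ea_comp (?T F \<otimes> Y) (?inc F' I) (?inc F F') = ?inc F I"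
    proof (rule tensor_hom_eqI[OF T[OF FI] EY TY[OF subset_refl]
          ea_comp_hom[OF TY[OF FI] inc[OF F] inc[OF F(2) subset_refl]] inc[OF FI subset_refl]])
      fix p y assume p: "p \<in> ecarrier (?T F)" and y: "y \<in> ecarrier Y"
      have "fam_incl F' I X (fam_incl F F' X p) = fam_incl F I X p"
        using fam_incl_comp[OF X F] ea_comp_apply[OF p, of "fam_incl F' I X" "fam_incl F F' X"] by simp
      then show "ea_comp (?T F \<otimes> Y) (?inc F' I) (?inc F F') (ptens (?T F) Y p y) = ?inc F I (ptens (?T F) Y p y)"
        using ptens_closed[OF T[OF FI] EY p y] incv[OF F p y] incv[OF FI subset_refl p y]
          incv[OF F(2) subset_refl ea_hom_closed[OF i[OF F] p] y] by simp
    qed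
  next
    fix E :: "'z scaled ea" and q
    assume E: "effect_algebra E" and q: "\<And>F. finite F \<Longrightarrow> F \<subseteq> I \<Longrightarrow> q F \<in> ea_hom (?T F \<otimes> Y) E"
      and compat: "\<And>F F' x. F \<subseteq> F' \<Longrightarrow> finite F' \<Longrightarrow> F' \<subseteq> I \<Longrightarrow> x \<in> ecarrier (?T F \<otimes> Y) \<Longrightarrow>
        q F' (?inc F F' x) = q F x"
    let ?q = "\<lambda>F p y. q F (ptens (?T F) Y p y)"
    have "\<exists>B. ea_biadditive (?T I) Y E B \<and>
      (\<forall>F p y. finite F \<longrightarrow> F \<subseteq> I \<longrightarrow> p \<in> ecarrier (?T F) \<longrightarrow> y \<in> ecarrier Y \<longrightarrow>
        B (fam_incl F I X p) y = ?q F p y)"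
    proof (rule fam_colimit_lift[OF X E EY])
      fix F assume F: "finite F" "F \<subseteq> I"
      note b = ptens_biadditive[OF T[OF F(2)] EY] and qa = ea_hom_additive[OF q[OF F]]
      show "ea_biadditive (?T F) Y E (?q F)"
        unfolding ea_biadditive_def
        using ea_additive_comp[OF ea_biadditive_left[OF b] qa] ea_additive_comp[OF ea_biadditive_right[OF b] qa]
        by simp
    next
      fix F F' p y assume h: "F \<subseteq> F'" "finite F'" "F' \<subseteq> I" "p \<in> ecarrier (?T F)" "y \<in> ecarrier Y"
      show "?q F' (fam_incl F F' X p) y = ?q F p y"
        using compat[OF h(1-3) ptens_closed[OF T[OF sub[OF h(1,3)]] EY h(4,5)]] incv[OF h(1,3-5)] by simp
    qed
    then obtain B where B: "ea_biadditive (?T I) Y E B"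
      "\<And>F p y. finite F \<Longrightarrow> F \<subseteq> I \<Longrightarrow> p \<in> ecarrier (?T F) \<Longrightarrow> y \<in> ecarrier Y \<Longrightarrow>
        B (fam_incl F I X p) y = ?q F p y" by blast
    have e: "{} \<subseteq> I" by simp
    have "B (eone (?T I)) (eone Y) = eone E"
      using B(2)[OF finite.emptyI e ea_one[OF T[OF e]] ea_one[OF EY]] ea_hom_one[OF i[OF e subset_refl]]
        ea_hom_one[OF q[OF finite.emptyI e]] ptens_one[OF T[OF e] EY] by simp
    then obtain h where h: "h \<in> ea_hom (?T I \<otimes> Y) E"
      "\<And>p y. p \<in> ecarrier (?T I) \<Longrightarrow> y \<in> ecarrier Y \<Longrightarrow> h (ptens (?T I) Y p y) = B p y"
      using bimorphism_hom[OF T[OF subset_refl] EY E B(1)] by blast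
    have "h (?inc F I x) = q F x" if F: "finite F" "F \<subseteq> I" and x: "x \<in> ecarrier (?T F \<otimes> Y)" for F x
    proof (rule tensor_additive_eqI[OF T[OF F(2)] EY E
          ea_additive_comp[OF ea_hom_additive[OF inc[OF F(2) subset_refl]] ea_hom_additive[OF h(1)]]
          ea_hom_additive[OF q[OF F]] _ x])
      fix p y assume p: "p \<in> ecarrier (?T F)" and y: "y \<in> ecarrier Y"
      show "h (?inc F I (ptens (?T F) Y p y)) = q F (ptens (?T F) Y p y)"
        using incv[OF F(2) subset_refl p y] h(2)[OF ea_hom_closed[OF i[OF F(2) subset_refl] p] y] B(2)[OF F p y]
        by simp
    qed
    then show "\<exists>h\<in>ea_hom (?T I \<otimes> Y) E. \<forall>F x. finite F \<longrightarrow> F \<subseteq> I \<longrightarrow> x \<in> ecarrier (?T F \<otimes> Y) \<longrightarrow>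
        h (?inc F I x) = q F x" using h(1) by blast
  next
    fix E :: "'z scaled ea" and h k
    assume E: "effect_algebra E" and h: "h \<in> ea_hom (?T I \<otimes> Y) E" and k: "k \<in> ea_hom (?T I \<otimes> Y) E"
      and eq: "\<And>F x. finite F \<Longrightarrow> F \<subseteq> I \<Longrightarrow> x \<in> ecarrier (?T F \<otimes> Y) \<Longrightarrow> h (?inc F I x) = k (?inc F I x)"
    show "h = k"
    proof (rule tensor_hom_eqI[OF T[OF subset_refl] EY E h k])
      fix p y assume p: "p \<in> ecarrier (?T I)" and y: "y \<in> ecarrier Y"
      note l = ea_additive_comp[OF ea_biadditive_left[OF ptens_biadditive[OF T[OF subset_refl] EY] y]]
      show "h (ptens (?T I) Y p y) = k (ptens (?T I) Y p y)"
      proof (rule fam_colimit_eqI[OF X E l[OF ea_hom_additive[OF h]] l[OF ea_hom_additive[OF k]] _ p])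
        fix F r assume F: "finite F" "F \<subseteq> I" and r: "r \<in> ecarrier (?T F)"
        show "h (ptens (?T I) Y (fam_incl F I X r) y) = k (ptens (?T I) Y (fam_incl F I X r) y)"
          using eq[OF F ptens_closed[OF T[OF F(2)] EY r y]] incv[OF F(2) subset_refl r y] by simp
      qed
    qed
  qed
qed

theorem mainTheorem12:
  fixes I :: "'i set" and X :: "'i \<Rightarrow> 'a ea"
  assumes "\<And>i. i \<in> I \<Longrightarrow> boolean_ea (X i)"
  shows "is_balg_coproduct TYPE('w) I X (fam_tensor I X) (fam_inj I X) \<and>
         kolmogorov_product TYPE('y) TYPE('z) I X (fam_tensor I X) (bker_marginal I X)"
proof
  have X: "\<forall>i\<in>I. boolean_ea (X i)" using assms by blast
  show "is_balg_coproduct TYPE('w) I X (fam_tensor I X) (fam_inj I X)"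
    by (rule fam_tensor_coproduct[OF X])
  have "bker_deterministic (fam_tensor I X) (fam_tensor F X) (bker_marginal I X F)" if F: "F \<subseteq> I" for F
  proof -
    have XF: "\<forall>i\<in>F. boolean_ea (X i)" using X F by blast
    show ?thesis
      unfolding bker_marginal_eq
      by (rule bker_of_hom_deterministic[OF fam_boolean[OF X] fam_boolean[OF XF] fam_incl_hom(1)[OF X F]])
  qed
  then show "kolmogorov_product TYPE('y) TYPE('z) I X (fam_tensor I X) (bker_marginal I X)"
    unfolding kolmogorov_product_def infinite_tensor_product_def
    by (intro conjI allI impI fam_tensor_bker_limit[OF X] fam_tensor_bker_limit_tensor[OF X]) simp_all
qed

end
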